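(* Let $\lambda_1,\ldots,\lambda_k\in\mathbb{C}$ be algebraic numbers and let $K=\mathbb{Q}(\lambda_1,\ldots,\lambda_k)$. For every $C>0$ and $p\in\mathbb{N}$, there are constants $n$ and $F$ such that for any finite non-empty $A\subset K$ satisfying $$|A+\lambda_1\cdot A+\cdots+\lambda_k\cdot A|\leq C|A|,$$ there exists a $p$-proper $\mathcal{O}_K$-GAP $P\subset K$ containing $A$ of dimension at most $n$ and size at most $F|A|$.
   Context: The numbers $\lambda_1,\ldots,\lambda_k$ (and hence $K$) are fixed throughout, as is the basis of $\mathcal{O}_K$ below; the constants $n$ and $F$ may depend on these as well as on $C$ and $p$, but not on $A$. $A+\lambda_1\cdot A+\cdots+\lambda_k\cdot A:=\{a_0+\lambda_1a_1+\cdots+\lambda_ka_k:a_0,\ldots,a_k\in A\}$. Let $d=\deg(K/\mathbb{Q})$ and fix a $\mathbb{Z}$-basis $e_1=1,e_2,\ldots,e_d$ of the ring of integers $\mathcal{O}_K$ of $K$. For $L>0$ let $$B(L):=\{l_1e_1+\cdots+l_de_d\in\mathcal{O}_K: l_i\in\mathbb{Z},\ |l_i|<L\text{ for all } i\}.$$ An $\mathcal{O}_K$-GAP of dimension $n$ is a set $P\subset K$ of the form $$P=\{v_0+l_1v_1+\cdots+l_nv_n: l_j\in B(L_j)\text{ for all } j\}$$ for some $v_0,\ldots,v_n\in K$ and positive integers $L_1,\ldots,L_n$ (an $\mathcal{O}_K$-GAP is considered together with this data). It is $p$-proper if the elements $pv_0+l_1v_1+\cdots+l_nv_n$ with $l_j\in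 B(pL_j)$ for all $j$ are distinct for distinct tuples $(l_1,\ldots,l_n)$.
   Formalization: The formal theorem additionally assumes that at least one λ_i is nonzero; if all λ_i are 0 then K = ℚ and A + 0·A + … = A, so every finite A ⊂ ℚ qualifies with C = 1, and A = {1, 2, 4, …, 2^(N-1)} refutes the claim. *)

theory Defs
  imports Complex_Main "HOL-Library.FuncSet" "HOL-Computational_Algebra.Polynomial"
    "HOL-Algebra.Generated_Fields" "HOL-Algebra.Algebraic_Closure_Type"
begin

(* A subfield of the complex numbers automatically contains the rationals, so this is Q(S). *)
definition rat_adjoin :: "complex set \<Rightarrow> complex set" where
  "rat_adjoin S = generate_field ring_of_type_algebra S"

definition rat_scale :: "rat \<Rightarrow> complex \<Rightarrow> complex" where
  "rat_scale q x = of_rat q * x"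

lemma vector_space_rat_scale: "vector_space rat_scale"
  by standard (simp_all add: rat_scale_def algebra_simps of_rat_add of_rat_mult)

definition degree_over_rat :: "complex set \<Rightarrow> nat" where
  "degree_over_rat K = vector_space.dim rat_scale K"

definition ring_of_integers :: "complex set \<Rightarrow> complex set" where
  "ring_of_integers K = {x \<in> K. algebraic_int x}"

(* Coordinate functions are extensional so that uniqueness concerns the indices 1..d only. *)
definition int_basis :: "nat \<Rightarrow> (nat \<Rightarrow> complex) \<Rightarrow> complex set \<Rightarrow> bool" where
  "int_basis d e M \<longleftrightarrow>
     (\<forall>i\<in>{1..d}. e i \<in> M) \<and>
     (\<forall>x\<in>M. \<exists>!l :: nat \<Rightarrow> int. l \<in> extensional {1..d} \<and> x = (\<Sum>i=1..d. of_int (l i) * e i))"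

definition sum_of_dilates :: "nat \<Rightarrow> (nat \<Rightarrow> complex) \<Rightarrow> complex set \<Rightarrow> complex set" where
  "sum_of_dilates k lam A = {a 0 + (\<Sum>i=1..k. lam i * a i) | a. \<forall>i\<le>k. a i \<in> A}"

definition int_box :: "nat \<Rightarrow> (nat \<Rightarrow> complex) \<Rightarrow> real \<Rightarrow> complex set" where
  "int_box d e L =
     {\<Sum>i=1..d. of_int (l i) * e i | l :: nat \<Rightarrow> int. \<forall>i\<in>{1..d}. real_of_int \<bar>l i\<bar> < L}"

(* P is the O_K-GAP of dimension n with data v_0, ..., v_n and L_1, ..., L_n, where the boxes
   in O_K are taken with respect to the basis e_1, ..., e_d. *)
definition is_OK_GAP ::
    "complex set \<Rightarrow> nat \<Rightarrow> (nat \<Rightarrow> complex) \<Rightarrow>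
     nat \<Rightarrow> (nat \<Rightarrow> complex) \<Rightarrow> (nat \<Rightarrow> nat) \<Rightarrow> complex set \<Rightarrow> bool" where
  "is_OK_GAP K d e n v L P \<longleftrightarrow>
     (\<forall>j\<le>n. v j \<in> K) \<and> (\<forall>j\<in>{1..n}. 0 < L j) \<and>
     P = {v 0 + (\<Sum>j=1..n. l j * v j) | l. \<forall>j\<in>{1..n}. l j \<in> int_box d e (real (L j))}"

(* Properness depends on the data v, L and not only on the underlying set. *)
definition proper_OK_GAP ::
    "nat \<Rightarrow> nat \<Rightarrow> (nat \<Rightarrow> complex) \<Rightarrow>
     nat \<Rightarrow> (nat \<Rightarrow> complex) \<Rightarrow> (nat \<Rightarrow> nat) \<Rightarrow> bool" where
  "proper_OK_GAP p d e n v L \<longleftrightarrow>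
     inj_on (\<lambda>l. of_nat p * v 0 + (\<Sum>j=1..n. l j * v j))
       (\<Pi>\<^sub>E j\<in>{1..n}. int_box d e (real (p * L j)))"

end

theory Submission
  imports Defs
    "HOL-Library.Set_Algebras" "HOL-Library.Disjoint_Sets" "HOL-Library.Function_Algebras"
    "HOL-Computational_Algebra.Primes" "HOL-Analysis.Kronecker_Approximation_Theorem"
    "Jordan_Normal_Form.Char_Poly"
begin

text \<open>By Petridis' form of Pluennecke's inequality and Ruzsa's triangle inequality, the \<open>\<mu>\<close> for which
  \<open>A + \<mu> \<cdot> A\<close> has size \<open>O(|A|)\<close> form a field, hence all of \<open>K\<close> qualifies, and all sums of boundedly
  many dilates of \<open>A\<close> by fixed elements of \<open>K\<close> have size \<open>O(|A|)\<close>. A large part of \<open>A\<close> is modelled in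
  the integers modulo \<open>N\<close>, where Bogolyubov's lemma finds a Bohr set; a reduced basis of the associated
  lattice turns it into a progression of bounded rank in \<open>2A - 2A\<close> of size proportional to \<open>|A|\<close>.
  Ruzsa's covering lemma and multiplication by the integral basis then place \<open>A\<close> in the image of a box
  in some \<open>O_K^n\<close> under a linear map to \<open>K\<close>, the image having size \<open>O(|A|)\<close>.

  For properness, collect linearly independent kernel vectors of the map, allowing much longer vectors
  at every step, until none of the current scale remain, and pass to the quotient of \<open>O_K^n\<close> by their
  span. A reduced basis of this quotient with respect to the induced seminorm spans an \<open>O_K\<close>-sublattice
  of bounded index; dividing it by the index gives the generators of the proper progression. No class
  group or unit theory is needed, since coordinates are only controlled up to bounded denominators.\<close>

section \<open>Sumset inequalities\<close>

text \<open>The lattice arguments take place in one locale, \<open>seminormed_lattice\<close>, which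
  occurs three times: for the Bohr lattice over the integers, for a free module over the order with
  the gauge of a box, and for quotients of the latter. Seminorms are due to the quotients: a
  quotient of a free module over the order need not be free, so the module is kept and the vectors
  to be killed receive seminorm 0. Dirichlet's simultaneous approximation stands in for Minkowski's
  theorem on successive minima. Its constants depend only on the rank and on the order, never on the
  seminorm; this is why n and F can be chosen before A. The obstacle to properness is that a
  relation in the quotient lifts to a kernel vector whose length includes an error growing with the
  vectors already killed. The kernel must therefore be searched in a ball whose radius depends on
  the previous one. Since the killed vectors are independent, the rank bounds the number of rounds,
  and the last radius is bounded in terms of p, the rank and the order.\<close>

lemma card_translate: "card ((+) (c::'a::ab_group_add) ` S) = card S"
  by (rule card_image) simp

text \<open>Induction on \<open>C\<close>. When \<open>c\<close> is added, the translates
  \<open>x + c + B\<close> with \<open>x\<close> in \<open>Z'\<close> bring nothing new, so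
  \<open>Z + B + C\<close> gains at most |Z + B| - |Z' + B| points, while \<open>Z + C\<close> gains
  at least |Z| - |Z'|; minimality of the ratio compares the two. The hypothesis \<open>min\<close>
  is cross-multiplied so that it covers the empty subset too.\<close>

lemma petridis:
  fixes Z B C :: "'a::ab_group_add set"
  assumes fin: "finite Z" "finite B" "finite C"
    and min: "\<And>Z'. Z' \<subseteq> Z \<Longrightarrow> card (Z + B) * card Z' \<le> card (Z' + B) * card Z"
  shows "card (Z + B + C) * card Z \<le> card (Z + B) * card (Z + C)"
  using fin(3)
proof (induction C rule: finite_induct)
  case empty
  have "S + {} = {}" for S :: "'a set" by (auto elim: set_plus_elim)
  then show ?case by simp
next
  case (insert c C)
  define Z' where "Z' = {x\<in>Z. (+) (x + c) ` B \<subseteq> Z + B + C}"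
  have Z': "Z' \<subseteq> Z" and finZ': "finite Z'"
    using fin by (auto simp: Z'_def)
  have fXB: "finite (Z + B)" "finite (Z + B + C)" "finite (Z + C)" "finite (Z' + B)"
    using fin insert.hyps finZ' by (simp_all add: finite_set_plus)
  have sub: "(+) c ` (Z' + B) \<subseteq> (+) c ` (Z + B)"
    using Z' by (intro image_mono set_plus_mono2) auto
  have "Z + B + insert c C \<subseteq> (Z + B + C) \<union> ((+) c ` (Z + B) - (+) c ` (Z' + B))"
  proof
    fix z assume "z \<in> Z + B + insert c C"
    then obtain x b c' where z: "z = x + b + c'" "x \<in> Z" "b \<in> B" "c' \<in> insert c C"
      by (auto elim!: set_plus_elim)
    show "z \<in> (Z + B + C) \<union> ((+) c ` (Z + B) - (+) c ` (Z' + B))"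
    proof (cases "z \<in> Z + B + C")
      case False
      with z have "c' = c" by (auto intro: set_plus_intro)
      with z have 1: "z \<in> (+) c ` (Z + B)"
        by (intro image_eqI[of _ _ "x + b"] set_plus_intro) (simp_all add: algebra_simps)
      have "z \<notin> (+) c ` (Z' + B)"
      proof
        assume "z \<in> (+) c ` (Z' + B)"
        then obtain y b' where "z = c + (y + b')" "y \<in> Z'" "b' \<in> B" 
          by (auto elim!: set_plus_elim)
        then have "z \<in> Z + B + C"
          unfolding Z'_def by (auto simp: algebra_simps image_subset_iff)
        with False show False by simp
      qed
      with 1 show ?thesis by simp
    qed simp
  qed
  then have "card (Z + B + insert c C) \<le> card (Z + B + C) + card ((+) c ` (Z + B) - (+) c ` (Z' + B))"
    using fXB by (meson card_Un_le card_mono finite_Diff finite_UnI finite_imageI le_trans)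
  also have "card ((+) c ` (Z + B) - (+) c ` (Z' + B)) = card (Z + B) - card (Z' + B)"
    using fXB sub by (simp add: card_Diff_subset card_translate)
  finally have up: "card (Z + B + insert c C) + card (Z' + B) \<le> card (Z + B + C) + card (Z + B)"
    using card_mono[OF _ set_plus_mono2[OF Z' order.refl, of B]] fXB by simp
  \<comment> \<open>These points of \<open>Z + insert c C\<close> are new: from
    \<open>x + c = y + c'\<close> with \<open>c'\<close> in \<open>C\<close> it would follow that
    \<open>x + c + B\<close> lies in \<open>Z + B + C\<close>, that is, that \<open>x\<close> is in
    \<open>Z'\<close>.\<close>
  define D where "D = (\<lambda>x. x + c) ` (Z - Z')"
  have D: "D \<subseteq> Z + insert c C" "D \<inter> (Z + C) = {}"
  proof -
    show "D \<subseteq> Z + insert c C" by (auto simp: D_def intro: set_plus_intro)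
    show "D \<inter> (Z + C) = {}"
    proof (rule ccontr)
      assume "D \<inter> (Z + C) \<noteq> {}"
      then obtain x where x: "x \<in> Z" "x \<notin> Z'" "x + c \<in> Z + C" by (auto simp: D_def)
      then obtain y c' where y: "x + c = y + c'" "y \<in> Z" "c' \<in> C" by (auto elim!: set_plus_elim)
      have "(x + c) + b \<in> Z + B + C" if "b \<in> B" for b
        unfolding y(1) using y that
        by (metis add.assoc add.commute set_plus_intro)
      with x show False by (auto simp: Z'_def)
    qed
  qed
  have "card D = card Z - card Z'"
    unfolding D_def using Z' finZ' by (subst card_image) (auto simp: inj_on_def card_Diff_subset)
  moreover have "card D + card (Z + C) \<le> card (Z + insert c C)"
  proof -
    have sub: "D \<union> (Z + C) \<subseteq> Z + insert c C"
      using D(1) set_plus_mono2[of Z Z C "insert c C"] by auto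
    have f: "finite (Z + insert c C)" using fin insert.hyps by (simp add: finite_set_plus)
    have "finite D" using sub f by (blast intro: finite_subset)
    with fXB D(2) have "card D + card (Z + C) = card (D \<union> (Z + C))"
      by (simp add: card_Un_disjoint)
    then show ?thesis using card_mono[OF f sub] by simp
  qed
  ultimately have lo: "card Z + card (Z + C) \<le> card (Z + insert c C) + card Z'" by simp
  have "(card (Z + B + insert c C) + card (Z' + B)) * card Z \<le> (card (Z + B + C) + card (Z + B)) * card Z"
    using up by simp
  also have "\<dots> \<le> card (Z + B) * card (Z + C) + card (Z + B) * card Z"
    using insert.IH by (simp add: algebra_simps)
  also have "\<dots> = card (Z + B) * (card Z + card (Z + C))" by (simp add: algebra_simps)
  also have "\<dots> \<le> card (Z + B) * (card (Z + insert c C) + card Z')"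
    using lo by simp
  also have "\<dots> \<le> card (Z + B) * card (Z + insert c C) + card (Z' + B) * card Z"
    using min[OF Z'] by (simp add: algebra_simps)
  finally show ?case by (simp add: algebra_simps)
qed

lemma finite_sum_list_sets: "(\<And>S. S \<in> set Bs \<Longrightarrow> finite S) \<Longrightarrow> finite (sum_list Bs :: 'a::comm_monoid_add set)"
  by (induction Bs) (simp_all add: finite_set_plus)

text \<open>\<open>Z\<close> minimises |Z + B| / |Z| among the non-empty subsets of
  \<open>A\<close>; each further summand then costs one factor by \<open>petridis\<close>. The same
  \<open>Z\<close> serves every list \<open>Bs\<close>, which is what the triangle inequality needs
  in \<open>tame_uminus\<close>.\<close>

lemma plunnecke:
  fixes A B :: "'a::ab_group_add set" and \<rho> :: real
  assumes "finite A" "finite B" "A \<noteq> {}" and le: "real (card (A + B)) \<le> \<rho> * card A"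
  shows "\<exists>Z\<subseteq>A. Z \<noteq> {} \<and> (\<forall>Bs. (\<forall>S\<in>set Bs. S \<subseteq> B) \<longrightarrow>
            real (card (Z + sum_list Bs)) \<le> \<rho> ^ length Bs * card Z)"
proof -
  define F where "F = Pow A - {{}}"
  define r where "r Z = real (card (Z + B)) / card Z" for Z
  have F: "finite F" "A \<in> F" using assms by (auto simp: F_def)
  obtain Z where Z: "Z \<in> F" "\<And>Y. Y \<in> F \<Longrightarrow> r Z \<le> r Y"
    using ex_min_if_finite[of "r ` F"] F by (force simp: not_less)
  have finZ: "finite Z" "Z \<noteq> {}" "Z \<subseteq> A" "card Z > 0"
    using Z(1) assms(1) by (auto simp: F_def card_gt_0_iff intro: finite_subset)
  have rX: "real (card (Z + B)) = r Z * card Z" using finZ by (simp add: r_def)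
  have "r Z \<le> r A" using Z F by blast
  also have "\<dots> \<le> \<rho>" using le assms by (simp add: r_def pos_divide_le_eq card_gt_0_iff)
  finally have r\<rho>: "r Z \<le> \<rho>" .
  have r0: "0 \<le> r Z" by (simp add: r_def)
  have min: "card (Z + B) * card Z' \<le> card (Z' + B) * card Z" if "Z' \<subseteq> Z" for Z'
  proof (cases "Z' = {}")
    case False
    then have "Z' \<in> F" "card Z' > 0" using that finZ
      by (auto simp: F_def card_gt_0_iff intro: finite_subset)
    then have "real (card (Z + B) * card Z') \<le> real (card (Z' + B) * card Z)"
      using Z(2)[of Z'] finZ by (simp add: r_def field_simps)
    then show ?thesis by linarith
  qed simp
  have "real (card (Z + sum_list Bs)) \<le> r Z ^ length Bs * card Z" if "\<forall>S\<in>set Bs. S \<subseteq> B" for Bs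
    using that
  proof (induction Bs)
    case (Cons S Bs)
    have finB: "finite (sum_list Bs)"
      by (rule finite_sum_list_sets) (use Cons.prems assms(2) in \<open>auto intro: finite_subset\<close>)
    have "card (Z + sum_list (S # Bs)) \<le> card (Z + B + sum_list Bs)"
    proof (rule card_mono)
      show "finite (Z + B + sum_list Bs)" using finB finZ(1) assms by (simp add: finite_set_plus)
      have "Z + (S + sum_list Bs) \<subseteq> Z + (B + sum_list Bs)"
        by (intro set_plus_mono2) (use Cons.prems in auto)
      then show "Z + sum_list (S # Bs) \<subseteq> Z + B + sum_list Bs" by (simp add: add.assoc)
    qed
    then have "card (Z + sum_list (S # Bs)) * card Z \<le> card (Z + B + sum_list Bs) * card Z"
      by (rule mult_right_mono) simp
    then have "real (card (Z + sum_list (S # Bs))) * card Z \<le> real (card (Z + B + sum_list Bs) * card Z)"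
      by (simp only: of_nat_mult[symmetric] of_nat_le_iff)
    also have "\<dots> \<le> real (card (Z + B) * card (Z + sum_list Bs))"
      using petridis[OF finZ(1) assms(2) finB min] by linarith
    also have "\<dots> \<le> (r Z * card Z) * (r Z ^ length Bs * card Z)"
      using Cons.IH Cons.prems rX r0 by (simp add: mult_left_mono)
    finally show ?case using finZ(4) by (simp add: algebra_simps)
  qed simp
  moreover have "r Z ^ n * card Z \<le> \<rho> ^ n * card Z" for n
    using r\<rho> r0 by (simp add: mult_right_mono power_mono)
  ultimately show ?thesis using finZ by (meson order_trans)
qed

text \<open>Fix one representation \<open>d = u d - v d\<close> of every difference. The pair
  \<open>(x + u d, x + v d)\<close> determines \<open>d\<close> by subtraction, and then
  \<open>x\<close>.\<close>

lemma ruzsa_triangle: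
  fixes Z U V :: "'a::ab_group_add set"
  assumes "finite Z" "finite U" "finite V"
  shows "card Z * card (U + uminus ` V) \<le> card (Z + U) * card (Z + V)"
proof -
  have "\<forall>d\<in>U + uminus ` V. \<exists>u v. u \<in> U \<and> v \<in> V \<and> d = u - v"
  proof
    fix d assume "d \<in> U + uminus ` V"
    then obtain u v' where "u \<in> U" "v' \<in> uminus ` V" "d = u + v'" by (rule set_plus_elim)
    then show "\<exists>u v. u \<in> U \<and> v \<in> V \<and> d = u - v" by auto
  qed
  then obtain u v where uv: "\<And>d. d \<in> U + uminus ` V \<Longrightarrow> u d \<in> U"
      "\<And>d. d \<in> U + uminus ` V \<Longrightarrow> v d \<in> V"
      and d: "\<And>d. d \<in> U + uminus ` V \<Longrightarrow> d = u d - v d"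
    by metis
  let ?f = "\<lambda>(x, d). (x + u d, x + v d)"
  have "inj_on ?f (Z \<times> (U + uminus ` V))"
  proof (rule inj_onI, clarify)
    fix x d x' d' assume *: "d \<in> U + uminus ` V" "d' \<in> U + uminus ` V"
      "x + u d = x' + u d'" "x + v d = x' + v d'"
    then have "(x + u d) - (x + v d) = (x' + u d') - (x' + v d')" by simp
    then have "d = d'" using d[OF *(1)] d[OF *(2)] by simp
    then show "x = x' \<and> d = d'" using * by simp
  qed
  moreover have "?f ` (Z \<times> (U + uminus ` V)) \<subseteq> (Z + U) \<times> (Z + V)"
    using uv by (clarsimp simp: set_plus_intro)
  ultimately have "card (Z \<times> (U + uminus ` V)) \<le> card ((Z + U) \<times> (Z + V))"
    using assms by (intro card_inj_on_le) (simp_all add: finite_set_plus)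
  then show ?thesis by (simp add: card_cartesian_product)
qed

text \<open>\<open>Z\<close> is a maximal set of points of \<open>A\<close> with disjoint translates
  of \<open>B\<close>. By maximality the translate at any other point meets one of these, which
  places the point in Z + B - B.\<close>

lemma ruzsa_covering:
  fixes A B :: "'a::ab_group_add set"
  assumes "finite A" "finite B" "B \<noteq> {}"
  shows "\<exists>Z\<subseteq>A. card Z * card B \<le> card (A + B) \<and> A \<subseteq> Z + (B + uminus ` B)"
proof -
  define F where "F = {Z. Z \<subseteq> A \<and> disjoint_family_on (\<lambda>x. (+) x ` B) Z}"
  have "F \<subseteq> Pow A" "{} \<in> F" by (auto simp: F_def disjoint_family_on_def)
  moreover from this have "finite F" using assms(1) by (simp add: finite_subset)
  ultimately obtain Z where Z: "Z \<in> F" "\<forall>Y\<in>F. Z \<subseteq> Y \<longrightarrow> Z = Y"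
    using finite_has_maximal2[of F "{}"] by metis
  have ZA: "Z \<subseteq> A" and disj: "disjoint_family_on (\<lambda>x. (+) x ` B) Z" using Z(1) by (simp_all add: F_def)
  have "finite Z" using ZA assms(1) by (rule finite_subset)
  then have "card Z * card B = card (\<Union>x\<in>Z. (+) x ` B)"
    using disj assms by (subst card_UN_disjoint) (simp_all add: disjoint_family_on_def card_translate)
  also have "\<dots> \<le> card (A + B)"
  proof (rule card_mono)
    show "finite (A + B)" using assms by (simp add: finite_set_plus)
    show "(\<Union>x\<in>Z. (+) x ` B) \<subseteq> A + B" using ZA by (auto intro: set_plus_intro)
  qed
  finally have 1: "card Z * card B \<le> card (A + B)" .
  have "a \<in> Z + (B + uminus ` B)" if a: "a \<in> A" for a
  proof (cases "\<exists>x\<in>Z. (+) a ` B \<inter> (+) x ` B \<noteq> {}")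
    case True
    then obtain x z where x: "x \<in> Z" and z: "z \<in> (+) a ` B" "z \<in> (+) x ` B" by blast
    from z obtain b b' where b: "b \<in> B" "b' \<in> B" "a + b = x + b'" by (elim imageE) simp
    then have "a = x + (b' + - b)" by (simp add: algebra_simps)
    with set_plus_intro[OF x set_plus_intro[OF b(2) imageI[OF b(1), of uminus]]]
    show ?thesis by simp
  next
    case False
    then have "insert a Z \<in> F" using ZA disj a
      unfolding F_def disjoint_family_on_def by (simp add: Int_commute)
    with Z(2) have "a \<in> Z" by blast
    with False have "(+) a ` B = {}" by auto
    then show ?thesis using assms by simp
  qed
  then show ?thesis using 1 ZA by blast
qed

section \<open>Sums of dilates\<close>

text \<open>A list of multipliers instead of a set, since repetition counts:
  \<open>dil [1, 1, -1, -1] A\<close> is 2A - 2A.\<close>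

definition dil :: "complex list \<Rightarrow> complex set \<Rightarrow> complex set" where
  "dil mus A = sum_list (map (\<lambda>\<mu>. (*) \<mu> ` A) mus)"

lemma dil_Nil [simp]: "dil [] A = {0}" by (simp add: dil_def)

lemma dil_Cons [simp]: "dil (\<mu> # mus) A = (*) \<mu> ` A + dil mus A" by (simp add: dil_def)

lemma dil_append: "dil (mus @ nus) A = dil mus A + dil nus A"
  by (simp add: dil_def)

lemma finite_dil: "finite A \<Longrightarrow> finite (dil mus A)"
  unfolding dil_def by (rule finite_sum_list_sets) auto

lemma dil_nonempty: "A \<noteq> {} \<Longrightarrow> dil mus A \<noteq> {}"
  by (induction mus) (auto simp: set_plus_def)

lemma dil_mono: "A' \<subseteq> A \<Longrightarrow> dil mus A' \<subseteq> dil mus A"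
proof (induction mus)
  case (Cons \<mu> mus)
  then have "(*) \<mu> ` A' + dil mus A' \<subseteq> (*) \<mu> ` A + dil mus A"
    by (intro set_plus_mono2 image_mono)
  then show ?case by simp
qed simp

lemma image_set_plus:
  assumes "\<And>x y. f (x + y) = f x + f y"
  shows "f ` (S + T) = f ` S + f ` T"
proof (intro equalityI subsetI)
  fix z assume "z \<in> f ` S + f ` T"
  then obtain s t where "s \<in> S" "t \<in> T" "z = f s + f t" by (auto elim: set_plus_elim)
  then show "z \<in> f ` (S + T)" by (simp add: assms[symmetric] set_plus_intro)
next
  fix z assume "z \<in> f ` (S + T)"
  then obtain x where "x \<in> S + T" "z = f x" by blast
  then obtain s t where "s \<in> S" "t \<in> T" "z = f (s + t)" by (auto elim: set_plus_elim)
  then show "z \<in> f ` S + f ` T" by (simp add: assms set_plus_intro)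
qed

lemma uminus_dil: "uminus ` dil mus A = dil (map uminus mus) A"
proof (induction mus)
  case (Cons \<mu> mus)
  then show ?case by (simp add: image_set_plus[of uminus] image_image)
qed simp

lemma mult_dil: "(*) c ` dil mus A = dil (map ((*) c) mus) A"
proof (induction mus)
  case (Cons \<mu> mus)
  then show ?case by (simp add: image_set_plus[of "(*) c"] distrib_left image_image mult.assoc)
qed simp

lemma card_times_image: "\<mu> \<noteq> 0 \<Longrightarrow> card ((*) (\<mu>::complex) ` A) = card A"
  by (rule card_image) (simp add: inj_on_def)

text \<open>The tame multipliers will turn out to form a field; \<open>c\<close> may depend on \<open>\<mu>\<close> but not on \<open>A\<close>.\<close>

definition tame :: "complex set set \<Rightarrow> complex \<Rightarrow> bool" where
  "tame \<A> \<mu> \<longleftrightarrow> (\<exists>c::real. \<forall>A\<in>\<A>. real (card (A + (*) \<mu> ` A)) \<le> c * card A)"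

text \<open>The family will consist of all sets that satisfy the hypothesis of the theorem for a
  given \<open>C\<close>. Working with families makes uniformity of the constants in
  \<open>A\<close> part of the notion of tameness.\<close>

locale finite_family =
  fixes \<A> :: "complex set set"
  assumes fin: "A \<in> \<A> \<Longrightarrow> finite A" and ne: "A \<in> \<A> \<Longrightarrow> A \<noteq> {}"
begin

lemma tame_0: "tame \<A> 0"
proof -
  have "A + (*) 0 ` A = A" if "A \<in> \<A>" for A
  proof -
    have "(*) 0 ` A = {0}" using ne[OF that] by auto
    then show ?thesis by simp
  qed
  then show ?thesis unfolding tame_def by (intro exI[of _ 1]) simp
qed

text \<open>\<open>plunnecke\<close> admits a single set \<open>B\<close>. The union of the dilates
  serves for all multipliers at once, since its sum with \<open>A\<close> is no larger than the sums
  of \<open>A\<close> with the separate dilates together.\<close>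

lemma common_bound:
  assumes "\<forall>\<mu>\<in>set mus. tame \<A> \<mu>"
  shows "\<exists>\<rho>::real. \<forall>A\<in>\<A>. \<exists>Z\<subseteq>A. Z \<noteq> {} \<and> (\<forall>nus. set nus \<subseteq> set mus \<longrightarrow>
           real (card (Z + dil nus A)) \<le> \<rho> ^ length nus * card Z)"
proof -
  have "\<exists>\<rho>::real. \<forall>A\<in>\<A>. real (card (A + (\<Union>\<mu>\<in>set mus. (*) \<mu> ` A))) \<le> \<rho> * card A"
    using assms
  proof (induction mus)
    case Nil
    have "A + {} = {}" for A :: "complex set" by (auto simp: set_plus_def)
    then show ?case by (intro exI[of _ 0]) simp
  next
    case (Cons \<mu> mus)
    then have "\<exists>\<rho>::real. \<forall>A\<in>\<A>. real (card (A + (\<Union>\<mu>\<in>set mus. (*) \<mu> ` A))) \<le> \<rho> * card A"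
      by simp
    then obtain \<rho> :: real where
      \<rho>: "\<And>A. A \<in> \<A> \<Longrightarrow> real (card (A + (\<Union>\<mu>\<in>set mus. (*) \<mu> ` A))) \<le> \<rho> * card A"
      by blast
    obtain c :: real where c: "\<And>A. A \<in> \<A> \<Longrightarrow> real (card (A + (*) \<mu> ` A)) \<le> c * card A"
      using Cons.prems by (auto simp: tame_def)
    have "real (card (A + (\<Union>\<mu>\<in>set (\<mu> # mus). (*) \<mu> ` A))) \<le> (c + \<rho>) * card A" if A: "A \<in> \<A>" for A
    proof -
      have "A + (\<Union>\<mu>\<in>set (\<mu> # mus). (*) \<mu> ` A) = (A + (*) \<mu> ` A) \<union> (A + (\<Union>\<mu>\<in>set mus. (*) \<mu> ` A))"
        unfolding set_plus_def list.set UN_insert by blast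
      then have "card (A + (\<Union>\<mu>\<in>set (\<mu> # mus). (*) \<mu> ` A))
          \<le> card (A + (*) \<mu> ` A) + card (A + (\<Union>\<mu>\<in>set mus. (*) \<mu> ` A))"
        by (simp add: card_Un_le)
      with \<rho>[OF A] c[OF A] show ?thesis by (simp add: algebra_simps)
    qed
    then show ?case by blast
  qed
  then obtain \<rho> :: real where \<rho>: "\<And>A. A \<in> \<A> \<Longrightarrow> real (card (A + (\<Union>\<mu>\<in>set mus. (*) \<mu> ` A))) \<le> \<rho> * card A"
    by blast
  have "\<exists>Z\<subseteq>A. Z \<noteq> {} \<and> (\<forall>nus. set nus \<subseteq> set mus \<longrightarrow>
           real (card (Z + dil nus A)) \<le> \<rho> ^ length nus * card Z)" if A: "A \<in> \<A>" for A
  proof -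
    obtain Z where Z: "Z \<subseteq> A" "Z \<noteq> {}" and bd: "\<And>Bs. (\<forall>S\<in>set Bs. S \<subseteq> (\<Union>\<mu>\<in>set mus. (*) \<mu> ` A)) \<Longrightarrow>
        real (card (Z + sum_list Bs)) \<le> \<rho> ^ length Bs * card Z"
      using plunnecke[of A "\<Union>\<mu>\<in>set mus. (*) \<mu> ` A" \<rho>] \<rho>[OF A] fin[OF A] ne[OF A] by auto
    have "real (card (Z + dil nus A)) \<le> \<rho> ^ length nus * card Z" if "set nus \<subseteq> set mus" for nus
      using bd[of "map (\<lambda>\<mu>. (*) \<mu> ` A) nus"] that by (auto simp: dil_def)
    with Z show ?thesis by blast
  qed
  then show ?thesis by blast
qed

lemma dil_bound:
  assumes "\<forall>\<mu>\<in>set mus. tame \<A> \<mu>"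
  shows "\<exists>c::real. \<forall>A\<in>\<A>. real (card (dil mus A)) \<le> c * card A"
proof -
  obtain \<rho> :: real where \<rho>: "\<And>A. A \<in> \<A> \<Longrightarrow> \<exists>Z\<subseteq>A. Z \<noteq> {} \<and> (\<forall>nus. set nus \<subseteq> set mus \<longrightarrow>
           real (card (Z + dil nus A)) \<le> \<rho> ^ length nus * card Z)"
    using common_bound[OF assms] by blast
  \<comment> \<open>The absolute value is taken because \<open>common_bound\<close> leaves the sign
    of \<open>\<rho>\<close> open.\<close>
  have "real (card (dil mus A)) \<le> \<bar>\<rho> ^ length mus\<bar> * card A" if A: "A \<in> \<A>" for A
  proof -
    obtain Z where Z: "Z \<subseteq> A" "Z \<noteq> {}" "real (card (Z + dil mus A)) \<le> \<rho> ^ length mus * card Z"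
      using \<rho>[OF A] by blast
    obtain z where z: "z \<in> Z" using Z by blast
    have finZ: "finite Z" using Z fin[OF A] by (blast intro: finite_subset)
    have "card (dil mus A) = card ((+) z ` dil mus A)" by (simp add: card_translate)
    also have "\<dots> \<le> card (Z + dil mus A)"
      using z finZ fin[OF A] by (intro card_mono finite_set_plus finite_dil) (auto intro: set_plus_intro)
    finally have "real (card (dil mus A)) \<le> \<rho> ^ length mus * card Z" using Z by linarith
    also have "\<dots> \<le> \<bar>\<rho> ^ length mus\<bar> * card Z" by (intro mult_right_mono) auto
    also have "\<dots> \<le> \<bar>\<rho> ^ length mus\<bar> * card A"
      using card_mono[OF fin[OF A] Z(1)] by (intro mult_left_mono) auto
    finally show ?thesis .
  qed
  then show ?thesis by blast
qed

lemma card_dil_mono: "A \<in> \<A> \<Longrightarrow> S \<subseteq> dil mus A \<Longrightarrow> card S \<le> card (dil mus A)"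
  by (simp add: card_mono fin finite_dil)

lemma tame_subset_dil:
  assumes "\<forall>\<nu>\<in>set mus. tame \<A> \<nu>" and "\<And>A. A \<in> \<A> \<Longrightarrow> A + (*) \<mu> ` A \<subseteq> dil mus A"
  shows "tame \<A> \<mu>"
proof -
  obtain c :: real where c: "\<And>A. A \<in> \<A> \<Longrightarrow> real (card (dil mus A)) \<le> c * card A"
    using dil_bound[OF assms(1)] by blast
  have "real (card (A + (*) \<mu> ` A)) \<le> c * card A" if "A \<in> \<A>" for A
    using c[OF that] card_dil_mono[OF that assms(2)[OF that]] by linarith
  then show ?thesis by (auto simp: tame_def)
qed

text \<open>\<open>dil [\<mu>, \<mu>] A\<close> is the dilate by \<open>\<mu>\<close> of
  \<open>A + A\<close>. Multipliers that are all zero would give no information on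
  \<open>A + A\<close>.\<close>

lemma tame_1:
  assumes "tame \<A> \<mu>" "\<mu> \<noteq> 0" shows "tame \<A> 1"
proof -
  obtain c :: real where c: "\<And>A. A \<in> \<A> \<Longrightarrow> real (card (dil [\<mu>, \<mu>] A)) \<le> c * card A"
    using dil_bound[of "[\<mu>, \<mu>]"] assms by auto
  have "real (card (A + (*) 1 ` A)) \<le> c * card A" if "A \<in> \<A>" for A
  proof -
    have "dil [\<mu>, \<mu>] A = (*) \<mu> ` dil [1, 1] A" by (simp only: mult_dil) simp
    also have "card \<dots> = card (dil [1, 1] A)" using assms(2) by (rule card_times_image)
    finally show ?thesis using c[OF that] by simp
  qed
  then show ?thesis by (auto simp: tame_def)
qed

lemma tame_inverse:
  assumes "tame \<A> \<mu>" shows "tame \<A> (inverse \<mu>)"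
proof (cases "\<mu> = 0")
  case False
  have "card (A + (*) (inverse \<mu>) ` A) = card (A + (*) \<mu> ` A)" for A
  proof -
    have "A + (*) \<mu> ` A = dil [\<mu>, 1] A" by (simp add: add.commute)
    also have "\<dots> = (*) \<mu> ` dil [1, inverse \<mu>] A" using False by (simp only: mult_dil) simp
    also have "dil [1, inverse \<mu>] A = A + (*) (inverse \<mu>) ` A" by simp
    finally show ?thesis using False by (simp add: card_times_image)
  qed
  with assms show ?thesis by (simp add: tame_def)
qed (simp add: tame_0)

lemma tame_add:
  assumes "tame \<A> 1" "tame \<A> \<mu>" "tame \<A> \<nu>" shows "tame \<A> (\<mu> + \<nu>)"
proof (rule tame_subset_dil[of "[1, \<mu>, \<nu>]"])
  fix A
  have "(*) (\<mu> + \<nu>) ` A \<subseteq> (*) \<mu> ` A + (*) \<nu> ` A"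
    by (auto simp: distrib_right intro!: set_plus_intro)
  then show "A + (*) (\<mu> + \<nu>) ` A \<subseteq> dil [1, \<mu>, \<nu>] A"
    using set_plus_mono2[of A A] by simp
qed (use assms in simp)

text \<open>The triangle inequality turns a sum into a difference: Z + A and Z + \<mu>A are both of
  size at most \<rho>|Z|, for one and the same \<open>Z\<close>.\<close>

lemma tame_uminus:
  assumes "tame \<A> 1" "tame \<A> \<mu>" shows "tame \<A> (- \<mu>)"
proof -
  obtain \<rho> :: real where \<rho>: "\<And>A. A \<in> \<A> \<Longrightarrow> \<exists>Z\<subseteq>A. Z \<noteq> {} \<and> (\<forall>nus. set nus \<subseteq> set [1, \<mu>] \<longrightarrow>
           real (card (Z + dil nus A)) \<le> \<rho> ^ length nus * card Z)"
    using common_bound[of "[1, \<mu>]"] assms by auto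
  have "real (card (A + (*) (- \<mu>) ` A)) \<le> \<rho>\<^sup>2 * card A" if A: "A \<in> \<A>" for A
  proof -
    obtain Z where Z: "Z \<subseteq> A" "Z \<noteq> {}" and bd: "\<And>nus. set nus \<subseteq> set [1, \<mu>] \<Longrightarrow>
           real (card (Z + dil nus A)) \<le> \<rho> ^ length nus * card Z"
      using \<rho>[OF A] by blast
    have finZ: "finite Z" using Z fin[OF A] by (blast intro: finite_subset)
    have "card Z * card (A + uminus ` (*) \<mu> ` A) \<le> card (Z + A) * card (Z + (*) \<mu> ` A)"
      using finZ fin[OF A] by (intro ruzsa_triangle) auto
    then have "real (card Z) * card (A + uminus ` (*) \<mu> ` A) \<le> real (card (Z + A)) * card (Z + (*) \<mu> ` A)"
      by (simp only: of_nat_mult[symmetric] of_nat_le_iff)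
    also have "\<dots> \<le> (\<rho> * card Z) * (\<rho> * card Z)"
    proof (rule mult_mono)
      show 1: "real (card (Z + A)) \<le> \<rho> * card Z" using bd[of "[1]"] by simp
      show "real (card (Z + (*) \<mu> ` A)) \<le> \<rho> * card Z" using bd[of "[\<mu>]"] by simp
      show "0 \<le> \<rho> * card Z" using 1 by linarith
    qed simp
    finally have "real (card Z) * card (A + uminus ` (*) \<mu> ` A) \<le> real (card Z) * (\<rho>\<^sup>2 * card Z)"
      by (simp add: power2_eq_square algebra_simps)
    then have "real (card (A + uminus ` (*) \<mu> ` A)) \<le> \<rho>\<^sup>2 * card Z"
      using Z finZ by (simp add: card_gt_0_iff)
    also have "\<dots> \<le> \<rho>\<^sup>2 * card A"
      using card_mono[OF fin[OF A] Z(1)] by (intro mult_left_mono) auto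
    finally show ?thesis by (simp add: image_image)
  qed
  then show ?thesis by (auto simp: tame_def)
qed

text \<open>Triangle inequality through the middle set \<nu>A: both A + \<nu>A and \<nu>A -
  \<mu>\<nu>A are small, the second being the dilate by \<nu> of A - \<mu>A. Hence the detour over
  \<open>tame_uminus\<close>.\<close>

lemma tame_mult:
  assumes "tame \<A> 1" "tame \<A> \<mu>" "tame \<A> \<nu>" shows "tame \<A> (\<mu> * \<nu>)"
proof (cases "\<nu> = 0")
  case False
  obtain a b :: real where a: "\<And>A. A \<in> \<A> \<Longrightarrow> real (card (A + (*) \<nu> ` A)) \<le> a * card A"
    and b: "\<And>A. A \<in> \<A> \<Longrightarrow> real (card (A + (*) (- \<mu>) ` A)) \<le> b * card A"
    using assms(3) tame_uminus[OF assms(1,2)] by (auto simp: tame_def)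
  have "real (card (A + (*) (\<mu> * \<nu>) ` A)) \<le> a * b * card A" if A: "A \<in> \<A>" for A
  proof -
    have cA: "card A > 0" using fin[OF A] ne[OF A] by (simp add: card_gt_0_iff)
    have "uminus ` (*) (- (\<mu> * \<nu>)) ` A = (*) (\<mu> * \<nu>) ` A"
      by (simp add: image_image)
    moreover have "card (dil [\<nu>, - (\<mu> * \<nu>)] A) = card (dil [1, - \<mu>] A)"
    proof -
      have "dil [\<nu>, - (\<mu> * \<nu>)] A = (*) \<nu> ` dil [1, - \<mu>] A" by (simp only: mult_dil) (simp add: mult.commute)
      then show ?thesis using False by (simp add: card_times_image)
    qed
    moreover have "card ((*) \<nu> ` A) * card (A + uminus ` (*) (- (\<mu> * \<nu>)) ` A)
        \<le> card ((*) \<nu> ` A + A) * card ((*) \<nu> ` A + (*) (- (\<mu> * \<nu>)) ` A)"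
      using fin[OF A] by (intro ruzsa_triangle) auto
    ultimately have "card A * card (A + (*) (\<mu> * \<nu>) ` A) \<le> card (A + (*) \<nu> ` A) * card (A + (*) (- \<mu>) ` A)"
      using False by (simp add: card_times_image add.commute)
    then have "real (card A) * card (A + (*) (\<mu> * \<nu>) ` A) \<le> real (card (A + (*) \<nu> ` A)) * card (A + (*) (- \<mu>) ` A)"
      by (simp only: of_nat_mult[symmetric] of_nat_le_iff)
    also have "\<dots> \<le> (a * card A) * (b * card A)"
    proof (rule mult_mono)
      show 1: "real (card (A + (*) \<nu> ` A)) \<le> a * card A" using a[OF A] .
      show "real (card (A + (*) (- \<mu>) ` A)) \<le> b * card A" using b[OF A] .
      show "0 \<le> a * card A" using 1 by linarith
    qed simp
    finally have "real (card A) * card (A + (*) (\<mu> * \<nu>) ` A) \<le> real (card A) * (a * b * card A)"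
      by (simp add: algebra_simps)
    then show ?thesis using cA by simp
  qed
  then show ?thesis by (auto simp: tame_def)
qed (simp add: tame_0)

end

section \<open>Models in cyclic groups\<close>

text \<open>Induction on the finite set. If \<open>h\<close> annihilates the new point
  \<open>z\<close>, add a rational multiple of a functional \<open>g\<close> with
  \<open>g z = 1\<close>; only finitely many multiples spoil another point. The purpose is to
  replace complex numbers by rational ones without creating relations.\<close>

lemma rat_functional:
  fixes S :: "complex set"
  assumes "finite S"
  shows "\<exists>h :: complex \<Rightarrow> rat. (\<forall>x y. h (x + y) = h x + h y) \<and> (\<forall>z\<in>S. z \<noteq> 0 \<longrightarrow> h z \<noteq> 0)"
  using assms
proof (induction S rule: finite_induct)
  case empty
  show ?case by (intro exI[of _ "\<lambda>_. 0"]) simp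
next
  case (insert z S)
  then obtain h :: "complex \<Rightarrow> rat" where h: "\<And>x y. h (x + y) = h x + h y" "\<And>z. z \<in> S \<Longrightarrow> z \<noteq> 0 \<Longrightarrow> h z \<noteq> 0"
    by blast
  interpret Q: vector_space rat_scale by (rule vector_space_rat_scale)
  interpret Q1: vector_space "(*) :: rat \<Rightarrow> rat \<Rightarrow> rat" by standard (simp_all add: algebra_simps)
  interpret P: vector_space_pair rat_scale "(*) :: rat \<Rightarrow> rat \<Rightarrow> rat" by standard
  show ?case
  proof (cases "z = 0 \<or> h z \<noteq> 0")
    case True
    with h show ?thesis by (intro exI[of _ h]) auto
  next
    case False
    then have "Q.independent {z}" by simp
    then obtain g where g: "Vector_Spaces.linear rat_scale (*) g" "g z = (1::rat)"
      using P.linear_independent_extend[of "{z}" "\<lambda>_. 1"] by auto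
    interpret g: Vector_Spaces.linear rat_scale "(*)" g by fact
    obtain t where t: "t \<notin> insert 0 ((\<lambda>x. - h x / g x) ` S)"
      using insert.hyps ex_new_if_finite[OF infinite_UNIV_char_0] by (metis finite_imageI finite_insert)
    have "h x + t * g x \<noteq> 0" if x: "x \<in> insert z S" "x \<noteq> 0" for x
    proof (cases "x = z")
      case True
      with False g t show ?thesis by simp
    next
      case ne: False
      show ?thesis
      proof (cases "g x = 0")
        case True
        with h(2)[of x] ne x show ?thesis by simp
      next
        case gx: False
        have "x \<in> S" using x ne by simp
        then have "t \<noteq> - h x / g x" using t by blast
        then have "t * g x \<noteq> - h x" using gx by (metis nonzero_mult_div_cancel_right)
        then show ?thesis by (simp add: eq_neg_iff_add_eq_0 add.commute)
      qed
    qed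
    then show ?thesis
      by (intro exI[of _ "\<lambda>x. h x + t * g x"]) (simp add: h g.add algebra_simps)
  qed
qed

lemma common_denominator:
  fixes f :: "'a \<Rightarrow> rat"
  assumes "finite A"
  shows "\<exists>m::nat. m > 0 \<and> (\<forall>a\<in>A. \<exists>k::int. of_nat m * f a = of_int k)"
  using assms
proof (induction A rule: finite_induct)
  case (insert a A)
  then obtain m where m: "m > 0" "\<And>a. a \<in> A \<Longrightarrow> \<exists>k::int. of_nat m * f a = of_int k" by blast
  obtain p q where pq: "quotient_of (f a) = (p, q)" by fastforce
  then have q: "q > 0" "f a = of_int p / of_int q"
    by (auto intro: quotient_of_denom_pos quotient_of_div)
  have "\<exists>k::int. of_nat (m * nat q) * f b = of_int k" if b: "b \<in> insert a A" for b
  proof (cases "b = a")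
    case True
    have "of_nat (m * nat q) * f a = of_int (int m * p)"
      using q by simp
    with True show ?thesis by blast
  next
    case False
    then obtain k :: int where "of_nat m * f b = of_int k" using m(2)[of b] b False by auto
    then have "of_nat (m * nat q) * f b = of_int (q * k)"
      using q by (simp add: algebra_simps)
    then show ?thesis by blast
  qed
  with m q show ?case by (intro exI[of _ "m * nat q"]) simp
qed (auto intro: exI[of _ 1])

lemma card_multiples_le:
  fixes N q :: nat
  assumes "N > 0"
  shows "card {m\<in>{1..<int q}. int N dvd m} * N \<le> q - 1"
proof -
  have "{m\<in>{1..<int q}. int N dvd m} \<subseteq> (\<lambda>t. int N * int t) ` {1..(q - 1) div N}"
  proof
    fix m assume m: "m \<in> {m\<in>{1..<int q}. int N dvd m}"
    then obtain t where t: "m = int N * t" by auto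
    with m have "int N * t > 0" by simp
    then have "t > 0" by (simp add: zero_less_mult_iff)
    then have "m = int (N * nat t)" using t by simp
    with m have "int (N * nat t) < int q" by simp
    then have "N * nat t \<le> q - 1" by linarith
    then have "nat t \<le> (q - 1) div N" using assms by (simp add: less_eq_div_iff_mult_less_eq mult.commute)
    with t \<open>t > 0\<close> show "m \<in> (\<lambda>t. int N * int t) ` {1..(q - 1) div N}"
      by (intro image_eqI[of _ _ "nat t"]) auto
  qed
  then have "card {m\<in>{1..<int q}. int N dvd m} \<le> card {1..(q - 1) div N}"
    by (rule surj_card_le[rotated]) simp
  then have "card {m\<in>{1..<int q}. int N dvd m} * N \<le> (q - 1) div N * N" by simp
  also have "\<dots> \<le> q - 1" by (rule div_times_less_eq_dividend)
  finally show ?thesis .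
qed

text \<open>A random dilate is reduced modulo a large prime \<open>q\<close> and restricted to an interval of length
  \<open>q / s\<close>, where no wrap-around occurs, before it is reduced modulo \<open>N\<close>.\<close>

lemma ruzsa_model:
  fixes A :: "complex set" and s N :: nat
  defines "D \<equiv> {sum_list xs - sum_list ys | xs ys. set xs \<subseteq> A \<and> set ys \<subseteq> A \<and> length xs = s \<and> length ys = s}"
  assumes A: "finite A" "A \<noteq> {}" and s: "s > 0" and D: "finite D" "card D \<le> N"
  shows "\<exists>A' g. A' \<subseteq> A \<and> card A \<le> s * card A' \<and>
    (\<forall>xs ys. set xs \<subseteq> A' \<longrightarrow> set ys \<subseteq> A' \<longrightarrow> length xs = s \<longrightarrow> length ys = s \<longrightarrow>
       (int N dvd sum_list (map g xs) - sum_list (map g ys) \<longleftrightarrow> sum_list xs = sum_list ys))"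
proof -
  obtain a0 where a0: "a0 \<in> A" using A by blast
  have D0: "0 \<in> D" unfolding D_def
    using a0 by (intro CollectI exI[of _ "replicate s a0"]) auto
  then have N: "N > 0" using D by (metis card_gt_0_iff empty_iff gr0I le_0_eq)
  obtain h0 :: "complex \<Rightarrow> rat" where h0: "\<And>x y. h0 (x + y) = h0 x + h0 y" "\<And>z. z \<in> D \<Longrightarrow> z \<noteq> 0 \<Longrightarrow> h0 z \<noteq> 0"
    using rat_functional[OF D(1)] by blast
  obtain m k where m: "m > 0" and k: "\<And>a. a \<in> A \<Longrightarrow> of_nat m * h0 a = of_int (k a)"
    using common_denominator[OF A(1), of h0] by metis
  define h where "h x = of_nat m * h0 x" for x
  have h: "h (x + y) = h x + h y" for x y by (simp add: h_def h0 distrib_left)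
  have hk: "h a = of_int (k a)" if "a \<in> A" for a using k[OF that] by (simp add: h_def)
  have h_0: "h 0 = 0" using h[of 0 0] by simp
  have h_diff: "h (x - y) = h x - h y" for x y using h[of "x - y" y] by simp
  have h_nz: "h z \<noteq> 0" if "z \<in> D" "z \<noteq> 0" for z using that h0 m by (simp add: h_def)
  have h_sum: "h (sum_list xs) = of_int (sum_list (map k xs))" if "set xs \<subseteq> A" for xs
    using that by (induction xs) (simp_all add: h h_0 hk)
  \<comment> \<open>The floor merely turns integral values into integers: on \<open>D\<close> the
    functional \<open>h\<close> is integral by the choice of the denominator
    \<open>m\<close>.\<close>
  define H where "H z = \<lfloor>h z\<rfloor>" for z
  have H_D: "H (sum_list xs - sum_list ys) = sum_list (map k xs) - sum_list (map k ys)"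
    if "set xs \<subseteq> A" "set ys \<subseteq> A" for xs ys
    using that by (simp add: H_def h_diff h_sum flip: of_int_diff)
  have H_nz: "H z \<noteq> 0" if "z \<in> D" "z \<noteq> 0" for z
  proof -
    obtain xs ys where *: "z = sum_list xs - sum_list ys" "set xs \<subseteq> A" "set ys \<subseteq> A"
      using \<open>z \<in> D\<close> by (auto simp: D_def)
    then have "h z = of_int (H z)" by (simp add: H_D h_diff h_sum)
    with h_nz[OF that] show ?thesis by auto
  qed
  obtain q where q: "prime q" "q > nat (Max ((\<lambda>z. \<bar>H z\<bar>) ` D))"
    using bigger_prime by blast
  have qH: "\<bar>H z\<bar> < int q" if "z \<in> D" for z
    using q(2) Max_ge[OF finite_imageI[OF D(1)] imageI[OF that], of "\<lambda>z. \<bar>H z\<bar>"] by linarith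
  have q1: "q > 1" using q(1) by (rule prime_gt_1_nat)
  have cop: "\<not> int q dvd H z" if "z \<in> D" "z \<noteq> 0" for z
    using H_nz[OF that] qH[OF that(1)] zdvd_not_zless[of "\<bar>H z\<bar>" "int q"] by auto
  \<comment> \<open>The multipliers \<open>l\<close> for which the residue of \<open>l * H z\<close>
    modulo \<open>q\<close> is divisible by \<open>N\<close>, so that reduction modulo
    \<open>N\<close> could create the relation \<open>z\<close>.\<close>
  define Bad where "Bad z = {l\<in>{1..<int q}. int N dvd (l * H z) mod int q}" for z
  have Bad_le: "card (Bad z) * N \<le> q - 1" if z: "z \<in> D" "z \<noteq> 0" for z
  proof -
    have pq: "prime (int q)" using q by simp
    have "inj_on (\<lambda>l. (l * H z) mod int q) (Bad z)"
    proof (rule inj_onI)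
      fix l l' assume l: "l \<in> Bad z" "l' \<in> Bad z" "(l * H z) mod int q = (l' * H z) mod int q"
      then have "int q dvd (l - l') * H z" by (simp add: mod_eq_dvd_iff algebra_simps)
      then have "int q dvd l - l'" using cop[OF z] pq by (simp add: prime_dvd_mult_iff)
      moreover have "\<bar>l - l'\<bar> < int q" using l by (auto simp: Bad_def)
      ultimately show "l = l'" using zdvd_not_zless[of "\<bar>l - l'\<bar>" "int q"] by auto
    qed
    moreover have "(\<lambda>l. (l * H z) mod int q) ` Bad z \<subseteq> {m\<in>{1..<int q}. int N dvd m}"
    proof safe
      fix l assume l: "l \<in> Bad z"
      then show "int N dvd (l * H z) mod int q" by (simp add: Bad_def)
      have "\<not> int q dvd l" using l by (auto simp: Bad_def dest: zdvd_imp_le)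
      then have "\<not> int q dvd l * H z" using cop[OF z] pq by (simp add: prime_dvd_mult_iff)
      then have "(l * H z) mod int q \<noteq> 0" by (simp add: dvd_eq_mod_eq_0)
      moreover have "(l * H z) mod int q \<ge> 0" "(l * H z) mod int q < int q" using q1 by simp_all
      ultimately show "(l * H z) mod int q \<in> {1..<int q}" by simp
    qed
    ultimately have "card (Bad z) \<le> card {m\<in>{1..<int q}. int N dvd m}"
      by (rule card_inj_on_le) (rule finite_subset[of _ "{1..<int q}"], auto)
    then have "card (Bad z) * N \<le> card {m\<in>{1..<int q}. int N dvd m} * N" by simp
    also have "\<dots> \<le> q - 1" using N by (rule card_multiples_le)
    finally show ?thesis .
  qed
  \<comment> \<open>Union bound: each non-zero \<open>z\<close> spoils at most (q - 1)/N
    multipliers, and there are fewer than \<open>N\<close> such \<open>z\<close> because 0 itself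
    belongs to \<open>D\<close>.\<close>
  have "card (\<Union>z\<in>D - {0}. Bad z) * N \<le> (\<Sum>z\<in>D - {0}. card (Bad z)) * N"
    using D by (intro mult_right_mono card_UN_le) auto
  also have "\<dots> = (\<Sum>z\<in>D - {0}. card (Bad z) * N)" by (rule sum_distrib_right)
  also have "\<dots> \<le> (\<Sum>z\<in>D - {0}. q - 1)" by (rule sum_mono, rule Bad_le) auto
  also have "\<dots> = (card D - 1) * (q - 1)" using D D0 by (simp add: card_Diff_singleton)
  also have "\<dots> < N * (q - 1)" using N D q1 by (intro mult_strict_right_mono) auto
  finally have "card (\<Union>z\<in>D - {0}. Bad z) < q - 1" using N by (simp add: mult.commute)
  moreover have "card {1..<int q} = q - 1" using q1 by simp
  moreover have "(\<Union>z\<in>D - {0}. Bad z) \<subseteq> {1..<int q}" by (auto simp: Bad_def)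
  ultimately have "\<exists>l. l \<in> {1..<int q} \<and> l \<notin> (\<Union>z\<in>D - {0}. Bad z)"
    by (metis (no_types, lifting) less_irrefl subsetI subset_antisym)
  then obtain l where l: "l \<in> {1..<int q}" "\<And>z. z \<in> D \<Longrightarrow> z \<noteq> 0 \<Longrightarrow> \<not> int N dvd (l * H z) mod int q"
    by (auto simp: Bad_def)
  define g where "g x = (l * k x) mod int q" for x
  have g: "0 \<le> g x" "g x < int q" for x using q1 by (simp_all add: g_def)
  \<comment> \<open>The number of the interval of length q/s that contains \<open>g x\<close>. By
    pigeonhole one interval receives at least a share 1/s of \<open>A\<close>.\<close>
  define t where "t x = int s * g x div int q" for x
  have t: "t x \<in> {0..<int s}" for x
  proof -
    have "int q * t x \<le> int s * g x"
      using mult_div_mod_eq[of "int q" "int s * g x"] pos_mod_sign[of "int q" "int s * g x"] q1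
      unfolding t_def by linarith
    also have "\<dots> < int q * int s" using g s by simp
    finally have "t x < int s" using q1 by simp
    then show ?thesis using g s q1 by (simp add: t_def pos_imp_zdiv_nonneg_iff)
  qed
  have "\<exists>c\<in>{0..<int s}. card A \<le> s * card {x\<in>A. t x = c}"
  proof (rule ccontr)
    assume *: "\<not> ?thesis"
    have "A = (\<Union>c\<in>{0..<int s}. {x\<in>A. t x = c})" using t by auto
    then have "card A \<le> (\<Sum>c\<in>{0..<int s}. card {x\<in>A. t x = c})"
      by (metis card_UN_le finite_atLeastLessThan_int)
    then have "s * card A \<le> (\<Sum>c\<in>{0..<int s}. s * card {x\<in>A. t x = c})"
      by (simp add: sum_distrib_left[symmetric])
    also have "\<dots> < (\<Sum>c\<in>{0..<int s}. card A)"
      using * s by (intro sum_strict_mono) (auto simp: not_le)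
    finally show False by simp
  qed
  then obtain c where c: "card A \<le> s * card {x\<in>A. t x = c}" by blast
  define A' where "A' = {x\<in>A. t x = c}"
  have close: "int s * (g x - g y) < int q" if "x \<in> A'" "y \<in> A'" for x y
  proof -
    have e: "int s * g x div int q = int s * g y div int q" using that by (simp add: A'_def t_def)
    have "int s * g x = int q * (int s * g y div int q) + int s * g x mod int q"
      unfolding e[symmetric] by simp
    moreover have "int s * g y = int q * (int s * g y div int q) + int s * g y mod int q" by simp
    moreover have "int s * g x mod int q < int q" "int s * g y mod int q \<ge> 0" using q1 by simp_all
    ultimately show ?thesis unfolding right_diff_distrib by linarith
  qed
  have sum_less: "int s * (sum_list (map g xs) - sum_list (map g ys)) \<le> int (length xs) * (int q - 1)"
    if "length xs = length ys" "set xs \<subseteq> A'" "set ys \<subseteq> A'" for xs ys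
    using that
  proof (induction xs ys rule: list_induct2)
    case (Cons x xs y ys)
    with close[of x y] show ?case by (simp add: algebra_simps)
  qed simp
  have lt: "sum_list (map g xs) - sum_list (map g ys) < int q"
    if "set xs \<subseteq> A'" "set ys \<subseteq> A'" "length xs = s" "length ys = s" for xs ys
  proof -
    have "int s * (sum_list (map g xs) - sum_list (map g ys)) \<le> int s * (int q - 1)"
      using sum_less[of xs ys] that by simp
    then show ?thesis using s by simp
  qed
  have A'A: "A' \<subseteq> A" by (auto simp: A'_def)
  have cong_list: "int q dvd sum_list (map g xs) - l * sum_list (map k xs)" for xs
  proof (induction xs)
    case (Cons x xs)
    have "int q dvd g x - l * k x" by (simp add: g_def mod_eq_dvd_iff[symmetric])
    from dvd_add[OF this Cons] show ?case by (simp add: algebra_simps)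
  qed simp
  \<comment> \<open>The assumption \<open>pos\<close> puts the difference of the sums in [0, q),
    where it equals its residue modulo \<open>q\<close>; that is the residue of
    \<open>l * H z\<close>, which by the choice of \<open>l\<close> is not divisible by
    \<open>N\<close>.\<close>
  have key: "sum_list xs = sum_list ys"
    if xy: "set xs \<subseteq> A'" "set ys \<subseteq> A'" "length xs = s" "length ys = s"
      and dv: "int N dvd sum_list (map g xs) - sum_list (map g ys)"
      and pos: "sum_list (map g ys) \<le> sum_list (map g xs)" for xs ys
  proof (rule ccontr)
    assume ne: "sum_list xs \<noteq> sum_list ys"
    define z where "z = sum_list xs - sum_list ys"
    have "z \<in> D" unfolding z_def D_def using xy A'A by blast
    moreover have "z \<noteq> 0" using ne by (simp add: z_def)
    ultimately have z: "z \<in> D" "z \<noteq> 0" .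
    have Hz: "H z = sum_list (map k xs) - sum_list (map k ys)"
      unfolding z_def using xy A'A by (intro H_D) auto
    have "int q dvd (sum_list (map g xs) - sum_list (map g ys)) - l * H z"
      unfolding Hz using dvd_diff[OF cong_list[of xs] cong_list[of ys]] by (simp add: algebra_simps)
    then have "(sum_list (map g xs) - sum_list (map g ys)) mod int q = (l * H z) mod int q"
      by (simp add: mod_eq_dvd_iff)
    then have "(l * H z) mod int q = sum_list (map g xs) - sum_list (map g ys)"
      using lt[OF xy] pos by simp
    then show False using l(2)[OF z] dv by simp
  qed
  have "int N dvd sum_list (map g xs) - sum_list (map g ys) \<longleftrightarrow> sum_list xs = sum_list ys"
    if xy: "set xs \<subseteq> A'" "set ys \<subseteq> A'" "length xs = s" "length ys = s" for xs ys
  proof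
    assume dv: "int N dvd sum_list (map g xs) - sum_list (map g ys)"
    then have dv': "int N dvd sum_list (map g ys) - sum_list (map g xs)"
      by (simp add: dvd_diff_commute)
    show "sum_list xs = sum_list ys"
      using key[OF xy dv] key[OF xy(2,1,4,3) dv'] by (metis linear)
  next
    assume "sum_list xs = sum_list ys"
    then have "H (sum_list xs - sum_list ys) = 0" by (simp add: H_def h_0)
    then have "sum_list (map k xs) = sum_list (map k ys)" using H_D[of xs ys] xy A'A by auto
    then have "int q dvd sum_list (map g xs) - sum_list (map g ys)"
      using dvd_diff[OF cong_list[of xs] cong_list[of ys]] by simp
    moreover have "\<bar>sum_list (map g xs) - sum_list (map g ys)\<bar> < int q"
      using lt[OF xy] lt[OF xy(2,1,4,3)] by linarith
    ultimately have "sum_list (map g xs) - sum_list (map g ys) = 0"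
      using zdvd_not_zless[of "\<bar>sum_list (map g xs) - sum_list (map g ys)\<bar>" "int q"] by auto
    then show "int N dvd sum_list (map g xs) - sum_list (map g ys)" by simp
  qed
  then show ?thesis using A'A c unfolding A'_def by blast
qed

section \<open>Bogolyubov's lemma\<close>

lemma sum_roots_of_unity:
  fixes N :: nat and t :: int
  assumes "N > 0"
  shows "(\<Sum>\<gamma><N. cis (2 * pi * (real \<gamma> * of_int t) / N)) = (if int N dvd t then of_nat N else 0)"
proof -
  define w where "w = cis (2 * pi * of_int t / N)"
  have w: "cis (2 * pi * (real \<gamma> * of_int t) / N) = w ^ \<gamma>" for \<gamma>
  proof -
    have "2 * pi * (real \<gamma> * of_int t) / N = real \<gamma> * (2 * pi * of_int t / N)" by simp
    then show ?thesis by (simp only: w_def Complex.DeMoivre)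
  qed
  show ?thesis
  proof (cases "int N dvd t")
    case True
    then obtain k where "t = int N * k" by auto
    then have "2 * pi * of_int t / N = 2 * pi * of_int k" using assms by simp
    then have "w = 1" by (simp only: w_def) (rule cis_multiple_2pi, rule Ints_of_int)
    with True show ?thesis by (simp add: w)
  next
    case False
    have "real N * (2 * pi * of_int t / N) = 2 * pi * of_int t" using assms by simp
    then have wN: "w ^ N = 1"
      by (simp only: w_def Complex.DeMoivre) (rule cis_multiple_2pi, rule Ints_of_int)
    have "w \<noteq> 1"
    proof
      assume "w = 1"
      then have "exp (\<i> * complex_of_real (2 * pi * of_int t / N)) = 1"
        by (simp only: w_def cis_conv_exp)
      then obtain n :: int where "2 * pi * of_int t / N = of_int (2 * n) * pi"
        by (auto simp: exp_eq_1)
      then have "of_int t = (of_int (n * int N) :: real)" using assms by (simp add: field_simps)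
      then have "t = n * int N" by (simp only: of_int_eq_iff)
      with False show False by simp
    qed
    then have "(\<Sum>\<gamma><N. w ^ \<gamma>) = 0" using wN by (simp add: sum_gp_strict)
    with False show ?thesis by (simp add: w)
  qed
qed

text \<open>If \<open>x\<close> were not represented, the fourth moment twisted by \<open>x\<close> would vanish; but the
  frequencies of \<open>\<Gamma>\<close> contribute at least the fourth power of \<open>card A\<close>, the others at most half of it.\<close>

lemma bogolyubov:
  fixes A :: "'a set" and g :: "'a \<Rightarrow> int" and N :: nat
  assumes A: "finite A" "A \<noteq> {}" and N: "N > 0"
    and inj: "\<And>a b. a \<in> A \<Longrightarrow> b \<in> A \<Longrightarrow> int N dvd g a - g b \<Longrightarrow> a = b"
  shows "\<exists>\<Gamma>\<subseteq>{..<N}. card \<Gamma> * (card A)\<^sup>2 \<le> 2 * N\<^sup>2 \<and>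
    (\<forall>x::int. (\<forall>\<gamma>\<in>\<Gamma>. 0 \<le> cos (2 * pi * (real \<gamma> * of_int x) / N)) \<longrightarrow>
       (\<exists>a\<in>A. \<exists>b\<in>A. \<exists>c\<in>A. \<exists>d\<in>A. int N dvd g a + g b - g c - g d - x))"
proof -
  define n where "n = real (card A)"
  have n: "n > 0" using A by (simp add: n_def card_gt_0_iff)
  define e where "e t = cis (2 * pi * t / N)" for t :: real
  have e_add: "e (s + t) = e s * e t" for s t
    by (simp add: e_def cis_mult add_divide_distrib distrib_left)
  have e_cnj: "cnj (e t) = e (- t)" for t by (simp add: e_def cis_cnj)
  have orth: "(\<Sum>\<gamma><N. e (real \<gamma> * of_int t)) = (if int N dvd t then of_nat N else 0)" for t :: int
    using sum_roots_of_unity[OF N, of t] by (simp add: e_def)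
  define f where "f \<gamma> = (\<Sum>a\<in>A. e (real \<gamma> * of_int (g a)))" for \<gamma> :: nat
  define F where "F \<gamma> = (cmod (f \<gamma>))\<^sup>2" for \<gamma>
  have F0: "F \<gamma> \<ge> 0" for \<gamma> by (simp add: F_def)
  have F: "complex_of_real (F \<gamma>) = (\<Sum>a\<in>A. \<Sum>b\<in>A. e (real \<gamma> * of_int (g a - g b)))" for \<gamma>
  proof -
    have "complex_of_real (F \<gamma>) = f \<gamma> * cnj (f \<gamma>)" by (simp only: F_def complex_norm_square)
    also have "\<dots> = (\<Sum>a\<in>A. \<Sum>b\<in>A. e (real \<gamma> * of_int (g a)) * e (- (real \<gamma> * of_int (g b))))"
      by (simp add: f_def e_cnj sum_product)
    finally show ?thesis by (simp add: e_add[symmetric] algebra_simps)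
  qed
  have parseval: "(\<Sum>\<gamma><N. F \<gamma>) = N * n"
  proof -
    have "complex_of_real (\<Sum>\<gamma><N. F \<gamma>) = (\<Sum>\<gamma><N. \<Sum>a\<in>A. \<Sum>b\<in>A. e (real \<gamma> * of_int (g a - g b)))"
      by (simp only: of_real_sum F)
    also have "\<dots> = (\<Sum>a\<in>A. \<Sum>b\<in>A. \<Sum>\<gamma><N. e (real \<gamma> * of_int (g a - g b)))"
      by (subst sum.swap, intro sum.cong refl, rule sum.swap)
    also have "\<dots> = (\<Sum>a\<in>A. \<Sum>b\<in>A. if a = b then of_nat N else 0)"
    proof (intro sum.cong refl)
      fix a b assume "a \<in> A" "b \<in> A"
      then have "int N dvd g a - g b \<longleftrightarrow> a = b" using inj by auto
      then show "(\<Sum>\<gamma><N. e (real \<gamma> * of_int (g a - g b))) = (if a = b then of_nat N else 0)"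
        by (simp only: orth)
    qed
    also have "\<dots> = complex_of_real (N * n)" using A by (simp add: n_def)
    finally show ?thesis by (simp only: of_real_eq_iff)
  qed
  have F_0: "F 0 = n\<^sup>2" by (simp add: F_def f_def e_def n_def norm_of_nat)
  have nN: "n \<le> N"
  proof -
    have "n * n \<le> N * n" using member_le_sum[of 0 "{..<N}" F] N F0
      by (simp add: parseval F_0 power2_eq_square)
    then show ?thesis using n by simp
  qed
  \<comment> \<open>The threshold n^3/(2N) serves twice: with Parseval it bounds the number of large
    frequencies by 2N^2/n^2, and the fourth moment over the small ones by n^4/2.\<close>
  define \<Gamma> where "\<Gamma> = {\<gamma>\<in>{..<N}. n ^ 3 \<le> 2 * N * F \<gamma>}"
  have sub: "\<Gamma> \<subseteq> {..<N}" and fin\<Gamma>: "finite \<Gamma>" by (auto simp: \<Gamma>_def)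
  have "card \<Gamma> * n ^ 3 = (\<Sum>\<gamma>\<in>\<Gamma>. n ^ 3)" by simp
  also have "\<dots> \<le> (\<Sum>\<gamma>\<in>\<Gamma>. 2 * N * F \<gamma>)" by (rule sum_mono) (simp add: \<Gamma>_def)
  also have "\<dots> \<le> (\<Sum>\<gamma><N. 2 * N * F \<gamma>)" using sub F0 by (intro sum_mono2) auto
  also have "\<dots> = 2 * N * (N * n)" by (simp only: sum_distrib_left[symmetric] parseval)
  finally have "n * (card \<Gamma> * n\<^sup>2) \<le> n * (2 * N\<^sup>2)"
    by (simp add: power3_eq_cube power2_eq_square algebra_simps)
  then have "real (card \<Gamma> * (card A)\<^sup>2) \<le> real (2 * N\<^sup>2)" using n by (simp add: n_def)
  then have card: "card \<Gamma> * (card A)\<^sup>2 \<le> 2 * N\<^sup>2" by (simp only: of_nat_le_iff)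
  have mem0: "0 \<in> \<Gamma>"
  proof -
    have "n * n\<^sup>2 \<le> (2 * N) * n\<^sup>2" using nN N by (intro mult_right_mono) auto
    then show ?thesis using N by (simp add: \<Gamma>_def F_0 power3_eq_cube power2_eq_square)
  qed
  have "\<exists>a\<in>A. \<exists>b\<in>A. \<exists>c\<in>A. \<exists>d\<in>A. int N dvd g a + g b - g c - g d - x"
    if x: "\<forall>\<gamma>\<in>\<Gamma>. 0 \<le> cos (2 * pi * (real \<gamma> * of_int x) / N)" for x :: int
  proof (rule ccontr)
    assume no: "\<not> ?thesis"
    \<comment> \<open>Each \<open>F \<gamma>\<close> is a sum over differences, so by orthogonality
      the twisted fourth moment is \<open>N\<close> times the number of quadruples with
      \<open>g a + g b - g c - g d\<close> congruent to \<open>x\<close>.\<close>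
    have FF: "complex_of_real (F \<gamma>) * complex_of_real (F \<gamma>) * e (- (real \<gamma> * of_int x)) =
       (\<Sum>p\<in>A\<times>A. \<Sum>q\<in>A\<times>A. e (real \<gamma> * of_int (g (fst p) + g (fst q) - g (snd p) - g (snd q) - x)))" for \<gamma>
    proof -
      have 1: "complex_of_real (F \<gamma>) = (\<Sum>p\<in>A\<times>A. e (real \<gamma> * of_int (g (fst p) - g (snd p))))"
        by (simp add: F sum.cartesian_product case_prod_unfold)
      have 2: "e (real \<gamma> * of_int (g (fst p) - g (snd p))) * e (real \<gamma> * of_int (g (fst q) - g (snd q))) * e (- (real \<gamma> * of_int x))
          = e (real \<gamma> * of_int (g (fst p) + g (fst q) - g (snd p) - g (snd q) - x))" for p q :: "'a \<times> 'a"
        unfolding e_add[symmetric] by (rule arg_cong[of _ _ e]) (simp add: algebra_simps)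
      show ?thesis unfolding 1
        by (subst sum_product) (simp only: sum_distrib_right 2)
    qed
    have "(\<Sum>\<gamma><N. complex_of_real (F \<gamma>) * complex_of_real (F \<gamma>) * e (- (real \<gamma> * of_int x))) =
       (\<Sum>p\<in>A\<times>A. \<Sum>q\<in>A\<times>A. \<Sum>\<gamma><N. e (real \<gamma> * of_int (g (fst p) + g (fst q) - g (snd p) - g (snd q) - x)))"
      unfolding FF by (subst sum.swap, intro sum.cong refl, rule sum.swap)
    also have "\<dots> = (\<Sum>p\<in>A\<times>A. \<Sum>q\<in>A\<times>A. 0)"
      unfolding orth using no by (intro sum.cong refl) (auto simp: algebra_simps)
    finally have "Re (\<Sum>\<gamma><N. complex_of_real (F \<gamma>) * complex_of_real (F \<gamma>) * e (- (real \<gamma> * of_int x))) = 0"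
      by simp
    moreover have "Re (complex_of_real (F \<gamma>) * complex_of_real (F \<gamma>) * e (- (real \<gamma> * of_int x)))
        = (F \<gamma>)\<^sup>2 * cos (2 * pi * (real \<gamma> * of_int x) / N)" for \<gamma>
      by (simp add: e_def power2_eq_square)
    ultimately have zero: "(\<Sum>\<gamma><N. (F \<gamma>)\<^sup>2 * cos (2 * pi * (real \<gamma> * of_int x) / N)) = 0"
      by (simp add: Re_sum)
    let ?c = "\<lambda>\<gamma>. cos (2 * pi * (real \<gamma> * of_int x) / N)"
    \<comment> \<open>The frequency 0 alone contributes n^4, and by the hypothesis on
      \<open>x\<close> no other member of \<Gamma> contributes a negative amount.\<close>
    have "n ^ 4 = (F 0)\<^sup>2 * ?c 0" by (simp add: F_0 flip: power_mult)
    also have "\<dots> \<le> (\<Sum>\<gamma>\<in>\<Gamma>. (F \<gamma>)\<^sup>2 * ?c \<gamma>)"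
      by (rule member_le_sum) (use x mem0 fin\<Gamma> in auto)
    finally have 1: "n ^ 4 \<le> (\<Sum>\<gamma>\<in>\<Gamma>. (F \<gamma>)\<^sup>2 * ?c \<gamma>)" .
    have "- (n ^ 3 / (2 * N) * F \<gamma>) \<le> (F \<gamma>)\<^sup>2 * ?c \<gamma>" if \<gamma>: "\<gamma> \<in> {..<N} - \<Gamma>" for \<gamma>
    proof -
      have "2 * N * F \<gamma> \<le> n ^ 3" using \<gamma> by (auto simp: \<Gamma>_def)
      then have "F \<gamma> \<le> n ^ 3 / (2 * N)" using N by (simp add: field_simps)
      then have "F \<gamma> * F \<gamma> \<le> n ^ 3 / (2 * N) * F \<gamma>" using F0 by (rule mult_right_mono)
      moreover have "(F \<gamma>)\<^sup>2 * (- 1) \<le> (F \<gamma>)\<^sup>2 * ?c \<gamma>" by (intro mult_left_mono) auto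
      ultimately show ?thesis by (simp add: power2_eq_square)
    qed
    then have "(\<Sum>\<gamma>\<in>{..<N} - \<Gamma>. - (n ^ 3 / (2 * N) * F \<gamma>)) \<le> (\<Sum>\<gamma>\<in>{..<N} - \<Gamma>. (F \<gamma>)\<^sup>2 * ?c \<gamma>)"
      by (rule sum_mono)
    moreover have "(\<Sum>\<gamma>\<in>{..<N} - \<Gamma>. n ^ 3 / (2 * N) * F \<gamma>) \<le> (\<Sum>\<gamma><N. n ^ 3 / (2 * N) * F \<gamma>)"
      using F0 n by (intro sum_mono2) auto
    moreover have "(\<Sum>\<gamma><N. n ^ 3 / (2 * N) * F \<gamma>) = n ^ 4 / 2"
      using N by (simp only: sum_distrib_left[symmetric] parseval) (simp add: power_numeral_reduce)
    moreover have "(\<Sum>\<gamma><N. (F \<gamma>)\<^sup>2 * ?c \<gamma>) = (\<Sum>\<gamma>\<in>{..<N} - \<Gamma>. (F \<gamma>)\<^sup>2 * ?c \<gamma>) + (\<Sum>\<gamma>\<in>\<Gamma>. (F \<gamma>)\<^sup>2 * ?c \<gamma>)"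
      using sub by (intro sum.subset_diff) auto
    ultimately have "n ^ 4 \<le> n ^ 4 / 2" using 1 zero unfolding sum_negf by linarith
    then show False using n by simp
  qed
  with sub card show ?thesis by blast
qed

section \<open>Reduced bases of lattices over orders\<close>

lemma dirichlet_grid:
  fixes t :: "nat \<Rightarrow> nat \<Rightarrow> real" and r d T :: nat
  assumes "T > 0"
  obtains m :: nat and a :: "nat \<Rightarrow> nat \<Rightarrow> int"
  where "0 < m" "m \<le> T ^ (r * d)"
    "\<And>j i. j < r \<Longrightarrow> i \<in> {1..d} \<Longrightarrow> \<bar>real m * t j i - of_int (a j i)\<bar> < 1 / T"
proof -
  obtain q p where q: "0 < q" "q \<le> int (T ^ (r * d))"
    and p: "\<And>k. k < r * d \<Longrightarrow> \<bar>of_int q * t (k div d) (k mod d + 1) - of_int (p k)\<bar> < 1 / T"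
    using Dirichlet_approx_simult[OF assms, of "r * d" "\<lambda>k. t (k div d) (k mod d + 1)"] by metis
  show thesis
  \<comment> \<open>The pair of \<open>j\<close> and \<open>i\<close> is packed into one index
    \<open>j * d + (i - 1)\<close>; the shift is there because basis indices start at 1.\<close>
  proof (rule that[of "nat q" "\<lambda>j i. p (j * d + (i - 1))"])
    fix j i assume ji: "j < r" "i \<in> {1..d}"
    then have "j * d + (i - 1) < (j + 1) * d" by auto
    also have "\<dots> \<le> r * d" using ji by (intro mult_right_mono) auto
    finally have lt: "j * d + (i - 1) < r * d" .
    obtain i' where "i = Suc i'" "i' < d" using ji by (cases i) auto
    then have eqs: "(j * d + (i - 1)) div d = j" "(j * d + (i - 1)) mod d + 1 = i" by simp_all
    show "\<bar>real (nat q) * t j i - of_int (p (j * d + (i - 1)))\<bar> < 1 / T"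
      using p[OF lt] q(1) unfolding eqs by simp
  qed (use q in \<open>auto simp: nat_le_iff\<close>)
qed

definition int_comb :: "nat \<Rightarrow> (nat \<Rightarrow> complex) \<Rightarrow> (nat \<Rightarrow> int) \<Rightarrow> complex" where
  "int_comb d e a = (\<Sum>i=1..d. of_int (a i) * e i)"

lemma int_comb_add: "int_comb d e (\<lambda>i. a i + b i) = int_comb d e a + int_comb d e b"
  and int_comb_diff: "int_comb d e (\<lambda>i. a i - b i) = int_comb d e a - int_comb d e b"
  and int_comb_mult: "int_comb d e (\<lambda>i. k * a i) = of_int k * int_comb d e a"
  and int_comb_0: "int_comb d e (\<lambda>i. 0) = 0"
  by (simp_all add: int_comb_def sum.distrib sum_subtractf sum_negf sum_distrib_left algebra_simps)

lemma int_comb_sum: "int_comb d e (\<lambda>i. \<Sum>k\<in>S. a k i) = (\<Sum>k\<in>S. int_comb d e (a k))"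
  by (induction S rule: infinite_finite_induct) (simp_all add: int_comb_0 int_comb_add)

text \<open>An order in a number field, given by a \<open>\<int>\<close>-basis. Linear algebra over the field of fractions is
  done over the order, clearing denominators: by \<open>inverse\<close> it suffices to invert positive integers.\<close>

locale int_order =
  fixes d :: nat and e :: "nat \<Rightarrow> complex"
  assumes basis_mult: "i \<in> {1..d} \<Longrightarrow> j \<in> {1..d} \<Longrightarrow> e i * e j \<in> range (int_comb d e)"
    and one: "1 \<in> range (int_comb d e)"
    and inverse: "\<alpha> \<in> range (int_comb d e) \<Longrightarrow> \<alpha> \<noteq> 0 \<Longrightarrow>
      \<exists>\<beta>\<in>range (int_comb d e). \<exists>m::nat. m > 0 \<and> \<beta> * \<alpha> = of_nat m"
    and indep: "int_comb d e a = 0 \<Longrightarrow> i \<in> {1..d} \<Longrightarrow> a i = 0"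
begin

abbreviation "R \<equiv> range (int_comb d e)"

lemma R_add: "\<alpha> \<in> R \<Longrightarrow> \<beta> \<in> R \<Longrightarrow> \<alpha> + \<beta> \<in> R"
  by (elim rangeE) (simp only: int_comb_add[symmetric] rangeI)

lemma R_diff: "\<alpha> \<in> R \<Longrightarrow> \<beta> \<in> R \<Longrightarrow> \<alpha> - \<beta> \<in> R"
  by (elim rangeE) (simp only: int_comb_diff[symmetric] rangeI)

lemma R_0: "0 \<in> R"
  by (simp only: int_comb_0[of d e, symmetric] rangeI)

lemma R_int_mult: "\<alpha> \<in> R \<Longrightarrow> of_int k * \<alpha> \<in> R"
  by (elim rangeE) (simp only: int_comb_mult[symmetric] rangeI)

lemma R_int: "of_int k \<in> R"
  using R_int_mult[OF one, of k] by simp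

lemma R_nat: "of_nat k \<in> R"
  using R_int[of "int k"] by simp

lemma R_sum: "(\<And>i. i \<in> S \<Longrightarrow> f i \<in> R) \<Longrightarrow> sum f S \<in> R"
  by (induction S rule: infinite_finite_induct) (auto simp: R_0 R_add)

lemma R_basis: "i \<in> {1..d} \<Longrightarrow> e i \<in> R"
proof -
  assume "i \<in> {1..d}"
  then have "e i = int_comb d e (\<lambda>k. if k = i then 1 else 0)"
    by (simp add: int_comb_def if_distrib[of of_int] if_distrib[of "\<lambda>x. x * _"] cong: if_cong)
  then show ?thesis by blast
qed

lemma R_mult: "\<alpha> \<in> R \<Longrightarrow> \<beta> \<in> R \<Longrightarrow> \<alpha> * \<beta> \<in> R"
proof -
  assume "\<alpha> \<in> R" "\<beta> \<in> R"
  then obtain a b where ab: "\<alpha> = int_comb d e a" "\<beta> = int_comb d e b" by blast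
  have "\<alpha> * \<beta> = (\<Sum>i=1..d. \<Sum>j=1..d. of_int (a i * b j) * (e i * e j))"
    unfolding ab int_comb_def sum_product by (simp add: algebra_simps)
  also have "\<dots> \<in> R" by (intro R_sum R_int_mult basis_mult)
  finally show ?thesis .
qed

end

text \<open>\<open>N_min\<close> takes the place of discreteness: in a quotient the balls may be
  infinite, because killed vectors have seminorm 0, yet shortest vectors exist. \<open>s\<close> is
  the scale up to which minima are collected, \<open>G\<close> bounds the rank through rational
  spanning, and \<open>c\<close> measures the distortion by a basis element.\<close>

locale seminormed_lattice = int_order d e + vector_space sc
  for d e and sc :: "complex \<Rightarrow> 'v::ab_group_add \<Rightarrow> 'v" +
  fixes \<Lambda> :: "'v set" and N :: "'v \<Rightarrow> real" and c s :: real and G :: "'v set"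
  assumes zero_mem: "0 \<in> \<Lambda>"
    and add_mem: "x \<in> \<Lambda> \<Longrightarrow> y \<in> \<Lambda> \<Longrightarrow> x + y \<in> \<Lambda>"
    and sc_mem: "\<alpha> \<in> R \<Longrightarrow> x \<in> \<Lambda> \<Longrightarrow> sc \<alpha> x \<in> \<Lambda>"
    and N_add: "x \<in> \<Lambda> \<Longrightarrow> y \<in> \<Lambda> \<Longrightarrow> N (x + y) \<le> N x + N y"
    and N_int: "x \<in> \<Lambda> \<Longrightarrow> N (sc (of_int k) x) = real_of_int \<bar>k\<bar> * N x"
    and N_basis: "x \<in> \<Lambda> \<Longrightarrow> i \<in> {1..d} \<Longrightarrow> N (sc (e i) x) \<le> c * N x"
    and c_nonneg: "0 \<le> c"
    and N_min: "Y \<subseteq> {x\<in>\<Lambda>. N x \<le> s} \<Longrightarrow> Y \<noteq> {} \<Longrightarrow> \<exists>x\<in>Y. \<forall>y\<in>Y. N x \<le> N y"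
    and finite_G: "finite G"
    and span_G: "x \<in> \<Lambda> \<Longrightarrow> \<exists>q :: 'v \<Rightarrow> rat. x = (\<Sum>g\<in>G. sc (of_rat (q g)) g)"
begin

lemma minus_mem: "x \<in> \<Lambda> \<Longrightarrow> - x \<in> \<Lambda>"
  using sc_mem[OF R_int[of "-1"], of x] by simp

lemma diff_mem: "x \<in> \<Lambda> \<Longrightarrow> y \<in> \<Lambda> \<Longrightarrow> x - y \<in> \<Lambda>"
  using add_mem[OF _ minus_mem, of x y] by simp

lemma sum_mem: "(\<And>i. i \<in> S \<Longrightarrow> f i \<in> \<Lambda>) \<Longrightarrow> sum f S \<in> \<Lambda>"
  by (induction S rule: infinite_finite_induct) (auto simp: zero_mem add_mem)

lemma N_0: "N 0 = 0"
  using N_int[OF zero_mem, of 0] by simp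

lemma N_minus: "x \<in> \<Lambda> \<Longrightarrow> N (- x) = N x"
  using N_int[of x "-1"] by simp

lemma N_diff: "x \<in> \<Lambda> \<Longrightarrow> y \<in> \<Lambda> \<Longrightarrow> N (x - y) \<le> N x + N y"
  using N_add[OF _ minus_mem, of x y] by (simp add: N_minus)

lemma N_nonneg: "x \<in> \<Lambda> \<Longrightarrow> 0 \<le> N x"
  using N_diff[of x x] by (simp add: N_0)

lemma N_nat: "x \<in> \<Lambda> \<Longrightarrow> N (sc (of_nat k) x) = real k * N x"
  using N_int[of x "int k"] by simp

lemma N_sum: "(\<And>i. i \<in> S \<Longrightarrow> f i \<in> \<Lambda>) \<Longrightarrow> N (sum f S) \<le> (\<Sum>i\<in>S. N (f i))"
proof (induction S rule: infinite_finite_induct)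
  case (insert i S)
  then have "N (f i + sum f S) \<le> N (f i) + N (sum f S)" by (intro N_add sum_mem) auto
  with insert show ?case by fastforce
qed (simp_all add: N_0)

lemma N_int_comb:
  assumes "x \<in> \<Lambda>" "\<And>i. i \<in> {1..d} \<Longrightarrow> real_of_int \<bar>a i\<bar> \<le> B"
  shows "N (sc (int_comb d e a) x) \<le> d * c * B * N x"
proof -
  have mem: "sc (e i) x \<in> \<Lambda>" if "i \<in> {1..d}" for i using that assms by (intro sc_mem R_basis)
  have "sc (int_comb d e a) x = (\<Sum>i=1..d. sc (of_int (a i)) (sc (e i) x))"
    by (simp add: int_comb_def scale_sum_left)
  also have "N \<dots> \<le> (\<Sum>i=1..d. N (sc (of_int (a i)) (sc (e i) x)))"
    by (rule N_sum) (rule sc_mem[OF R_int mem])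
  also have "\<dots> \<le> (\<Sum>i=1..d. B * (c * N x))"
  proof (rule sum_mono)
    fix i assume i: "i \<in> {1..d}"
    have "0 \<le> B" using assms(2)[OF i] by linarith
    then show "N (sc (of_int (a i)) (sc (e i) x)) \<le> B * (c * N x)"
      unfolding N_int[OF mem[OF i]] using assms i N_basis N_nonneg mem
      by (intro mult_mono) auto
  qed
  also have "\<dots> = d * c * B * N x" by simp
  finally show ?thesis .
qed

lemma N_sc_zero: "\<alpha> \<in> R \<Longrightarrow> x \<in> \<Lambda> \<Longrightarrow> N x = 0 \<Longrightarrow> N (sc \<alpha> x) = 0"
proof -
  assume *: "\<alpha> \<in> R" "x \<in> \<Lambda>" "N x = 0"
  then obtain a where a: "\<alpha> = int_comb d e a" by blast
  have "N (sc (int_comb d e a) x) \<le> d * c * real_of_int (\<Sum>i=1..d. \<bar>a i\<bar>) * N x"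
    by (rule N_int_comb) (use * in \<open>auto simp del: of_int_abs of_int_sum intro!: member_le_sum\<close>)
  then show ?thesis using * a N_nonneg[OF sc_mem[OF *(1,2)]] by simp
qed

lemma N_zero_add: "x \<in> \<Lambda> \<Longrightarrow> y \<in> \<Lambda> \<Longrightarrow> N x = 0 \<Longrightarrow> N y = 0 \<Longrightarrow> N (x + y) = 0"
  using N_add[of x y] N_nonneg[of "x + y"] add_mem by fastforce

lemma N_le_if_diff_zero: "x \<in> \<Lambda> \<Longrightarrow> y \<in> \<Lambda> \<Longrightarrow> N (x - y) = 0 \<Longrightarrow> N x \<le> N y"
  using N_add[OF diff_mem[of x y], of y] by simp

definition comb :: "(nat \<Rightarrow> complex) \<Rightarrow> (nat \<Rightarrow> 'v) \<Rightarrow> nat \<Rightarrow> 'v" where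
  "comb \<beta> u r = (\<Sum>j<r. sc (\<beta> j) (u j))"

lemma comb_Suc: "comb \<beta> u (Suc r) = comb \<beta> u r + sc (\<beta> r) (u r)"
  by (simp add: comb_def)

lemma comb_add: "comb (\<lambda>j. \<beta> j + \<gamma> j) u r = comb \<beta> u r + comb \<gamma> u r"
  and comb_diff: "comb (\<lambda>j. \<beta> j - \<gamma> j) u r = comb \<beta> u r - comb \<gamma> u r"
  and comb_sc: "comb (\<lambda>j. \<alpha> * \<beta> j) u r = sc \<alpha> (comb \<beta> u r)"
  by (simp_all add: comb_def scale_left_distrib scale_left_diff_distrib sum.distrib sum_subtractf scale_sum_right)

lemma comb_mem: "(\<And>j. j < r \<Longrightarrow> \<beta> j \<in> R) \<Longrightarrow> (\<And>j. j < r \<Longrightarrow> u j \<in> \<Lambda>) \<Longrightarrow> comb \<beta> u r \<in> \<Lambda>"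
  unfolding comb_def by (intro sum_mem sc_mem) auto

lemma N_comb:
  assumes "\<And>j. j < r \<Longrightarrow> u j \<in> \<Lambda>" "\<And>j. j < r \<Longrightarrow> N (u j) \<le> M"
    and "\<And>j i. j < r \<Longrightarrow> i \<in> {1..d} \<Longrightarrow> real_of_int \<bar>a j i\<bar> \<le> B" "0 \<le> B"
  shows "N (comb (\<lambda>j. int_comb d e (a j)) u r) \<le> r * (d * c * B * M)"
proof -
  have "N (comb (\<lambda>j. int_comb d e (a j)) u r) \<le> (\<Sum>j<r. N (sc (int_comb d e (a j)) (u j)))"
    unfolding comb_def using assms by (intro N_sum sc_mem) auto
  also have "\<dots> \<le> (\<Sum>j<r. d * c * B * M)"
  proof (rule sum_mono)
    fix j assume j: "j \<in> {..<r}"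
    have "N (sc (int_comb d e (a j)) (u j)) \<le> d * c * B * N (u j)"
      using assms j by (intro N_int_comb) auto
    also have "\<dots> \<le> d * c * B * M" using assms j c_nonneg by (intro mult_left_mono) auto
    finally show "N (sc (int_comb d e (a j)) (u j)) \<le> d * c * B * M" .
  qed
  finally show ?thesis by simp
qed

text \<open>The span of the first \<open>r\<close> vectors over the field of fractions, up to
  vectors of seminorm 0 and within \<open>\<Lambda>\<close>. Positive integers suffice as
  denominators since, by \<open>inverse\<close>, every non-zero element of the order divides one of
  them.\<close>

definition Dep :: "nat \<Rightarrow> (nat \<Rightarrow> 'v) \<Rightarrow> 'v set" where
  "Dep r u = {x\<in>\<Lambda>. \<exists>m::nat. m > 0 \<and> (\<exists>\<beta>. (\<forall>j<r. \<beta> j \<in> R) \<and> N (sc (of_nat m) x - comb \<beta> u r) = 0)}"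

text \<open>Successive minima, up to the scale \<open>s\<close>.\<close>

definition chain :: "nat \<Rightarrow> (nat \<Rightarrow> 'v) \<Rightarrow> bool" where
  "chain r u \<longleftrightarrow> (\<forall>j<r. u j \<in> \<Lambda> \<and> N (u j) \<le> s \<and> u j \<notin> Dep j u \<and> (\<forall>x\<in>\<Lambda>. N x < N (u j) \<longrightarrow> x \<in> Dep j u))"

lemma chainD:
  assumes "chain r u" "j < r"
  shows "u j \<in> \<Lambda>" "N (u j) \<le> s" "u j \<notin> Dep j u" "\<And>x. x \<in> \<Lambda> \<Longrightarrow> N x < N (u j) \<Longrightarrow> x \<in> Dep j u"
  using assms by (auto simp: chain_def)

lemma chain_mono: "chain r u \<Longrightarrow> r' \<le> r \<Longrightarrow> chain r' u"
  by (auto simp: chain_def)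

lemma Dep_mono:
  assumes "j \<le> r" shows "Dep j u \<subseteq> Dep r u"
proof
  fix x assume "x \<in> Dep j u"
  then obtain m \<beta> where *: "x \<in> \<Lambda>" "m > (0::nat)" "\<forall>k<j. \<beta> k \<in> R" "N (sc (of_nat m) x - comb \<beta> u j) = 0"
    by (auto simp: Dep_def)
  define \<gamma> where "\<gamma> k = (if k < j then \<beta> k else 0)" for k
  have "comb \<gamma> u r = comb \<beta> u j"
    unfolding comb_def by (rule sum.mono_neutral_cong_right) (use assms in \<open>auto simp: \<gamma>_def\<close>)
  with * show "x \<in> Dep r u"
    unfolding Dep_def by (intro CollectI conjI exI[of _ m] exI[of _ \<gamma>]) (auto simp: \<gamma>_def R_0)
qed

lemma mem_Dep: "j < r \<Longrightarrow> u j \<in> \<Lambda> \<Longrightarrow> u j \<in> Dep r u"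
proof -
  assume *: "j < r" "u j \<in> \<Lambda>"
  have "comb (\<lambda>k. if k = j then 1 else 0) u r = u j"
    using * by (simp add: comb_def if_distrib[of "\<lambda>x. sc x _"] cong: if_cong)
  with * show ?thesis unfolding Dep_def
    by (intro CollectI conjI exI[of _ 1] exI[of _ "\<lambda>k. if k = j then 1 else 0"]) (auto simp: R_0 one N_0)
qed

lemma zero_Dep:
  assumes "x \<in> \<Lambda>" "N x = 0" shows "x \<in> Dep r u"
  using assms unfolding Dep_def
  by (intro CollectI conjI exI[of _ 1] exI[of _ "\<lambda>_. 0"]) (auto simp: R_0 comb_def)

lemma chain_pos: "chain r u \<Longrightarrow> j < r \<Longrightarrow> 0 < N (u j)"
  using chainD[of r u j] N_nonneg[of "u j"] zero_Dep[of "u j" j u] by (metis less_eq_real_def)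

lemma chain_le: "chain r u \<Longrightarrow> j \<le> k \<Longrightarrow> k < r \<Longrightarrow> N (u j) \<le> N (u k)"
  using chainD[of r u j] chainD[of r u k] Dep_mono[of j k u] by (meson le_less_trans not_le subsetD)

text \<open>Multiplication by some \<open>\<gamma>\<close> that turns the top coefficient into a
  positive integer would exhibit \<open>u r\<close> itself as dependent on the earlier
  vectors.\<close>

lemma top_coefficient_not_Dep:
  assumes ch: "chain (Suc r) u" and \<alpha>: "\<And>j. j < Suc r \<Longrightarrow> \<alpha> j \<in> R" and nz: "\<alpha> r \<noteq> 0"
  shows "comb \<alpha> u (Suc r) \<notin> Dep r u"
proof
  have u: "u j \<in> \<Lambda>" if "j < Suc r" for j using chainD(1)[OF ch that] .
  assume "comb \<alpha> u (Suc r) \<in> Dep r u"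
  then obtain m \<beta> where m: "m > (0::nat)" and \<beta>: "\<forall>j<r. \<beta> j \<in> R"
    and 0: "N (sc (of_nat m) (comb \<alpha> u (Suc r)) - comb \<beta> u r) = 0"
    by (auto simp: Dep_def)
  obtain \<gamma> m' where \<gamma>: "\<gamma> \<in> R" and m': "m' > (0::nat)" "\<gamma> * \<alpha> r = of_nat m'"
    using inverse[of "\<alpha> r"] \<alpha> nz by auto
  define \<delta> where "\<delta> = (\<lambda>j. \<gamma> * (\<beta> j - of_nat m * \<alpha> j))"
  have mem: "sc (of_nat m) (comb \<alpha> u (Suc r)) - comb \<beta> u r \<in> \<Lambda>"
    using \<alpha> \<beta> u by (intro diff_mem sc_mem comb_mem R_nat) auto
  have "sc (of_nat (m * m')) (u r) - comb \<delta> u r = sc \<gamma> (sc (of_nat m) (comb \<alpha> u (Suc r)) - comb \<beta> u r)"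
  proof -
    have "comb \<delta> u r = sc \<gamma> (comb \<beta> u r - sc (of_nat m) (comb \<alpha> u r))"
      by (simp add: \<delta>_def comb_sc comb_diff)
    moreover have "sc (of_nat (m * m')) (u r) = sc \<gamma> (sc (of_nat m) (sc (\<alpha> r) (u r)))"
      by (simp add: m'(2)[symmetric] mult_ac)
    ultimately show ?thesis
      by (simp only: comb_Suc scale_right_distrib scale_right_diff_distrib) (simp add: algebra_simps)
  qed
  then have "N (sc (of_nat (m * m')) (u r) - comb \<delta> u r) = 0"
    using N_sc_zero[OF \<gamma> mem 0] by simp
  moreover have "\<forall>j<r. \<delta> j \<in> R" unfolding \<delta>_def using \<alpha> \<beta> \<gamma>
    by (auto intro!: R_mult R_diff R_nat)
  ultimately have "u r \<in> Dep r u"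
    unfolding Dep_def using u[of r] m m'(1)
    by (intro CollectI conjI exI[of _ "m * m'"] exI[of _ \<delta>]) simp_all
  with chainD(3)[OF ch, of r] show False by simp
qed

end

section \<open>Constants of the reduction theory\<close>

definition grid_size :: "real \<Rightarrow> nat \<Rightarrow> nat \<Rightarrow> nat" where
  "grid_size c d r = nat \<lceil>2 * d * c * r\<rceil> + 1"

text \<open>Dirichlet's bound for the common multiplier of \<open>r * d\<close> numbers at precision
  1 / \<open>grid_size\<close>. The grid is so fine that rounding costs at most half the length of
  the last vector, see \<open>approximation_error\<close>.\<close>

definition mult_bound :: "real \<Rightarrow> nat \<Rightarrow> nat \<Rightarrow> nat" where
  "mult_bound c d r = grid_size c d r ^ (r * d)"

text \<open>The top coefficient costs \<open>2 * mult_bound\<close>. Removing its term enlarges the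
  seminorm of the vector at most by the factor in parentheses, and the earlier coefficients follow
  recursively.\<close>

primrec coeff_const :: "real \<Rightarrow> nat \<Rightarrow> nat \<Rightarrow> real" where
  "coeff_const c d 0 = 0"
| "coeff_const c d (Suc r) = 2 * real (mult_bound c d (Suc r))
     + coeff_const c d r * (1 + 2 * real d * c * real (mult_bound c d (Suc r)))"

text \<open>Only the size of the multiplier in Dirichlet's theorem is known; the factorial is
  divisible by whichever one occurs.\<close>

primrec denom_const :: "real \<Rightarrow> nat \<Rightarrow> nat \<Rightarrow> nat" where
  "denom_const c d 0 = 1"
| "denom_const c d (Suc r) = denom_const c d r * fact (mult_bound c d (Suc r))"

lemma coeff_const_nonneg: "0 \<le> c \<Longrightarrow> 0 \<le> coeff_const c d r"
  by (induction r) simp_all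

lemma coeff_const_mono:
  assumes "0 \<le> c" shows "r \<le> r' \<Longrightarrow> coeff_const c d r \<le> coeff_const c d r'"
proof (induction r' rule: dec_induct)
  case (step n)
  have "coeff_const c d n * 1 \<le> coeff_const c d n * (1 + 2 * d * c * mult_bound c d (Suc n))"
    using assms by (intro mult_left_mono coeff_const_nonneg) auto
  with step show ?case by simp
qed simp

lemma denom_const_pos: "0 < denom_const c d r"
  by (induction r) simp_all

lemma denom_const_dvd: "r \<le> r' \<Longrightarrow> denom_const c d r dvd denom_const c d r'"
  by (induction r' rule: dec_induct) (auto intro: dvd_mult2)

lemma grid_size_pos: "0 < grid_size c d r"
  by (simp add: grid_size_def)

lemma grid_size_ge: "2 * real d * c * real r \<le> real (grid_size c d r)"
  unfolding grid_size_def by linarith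

lemma sgn_mult_complex: "of_int (sgn k) * of_int k = (of_nat (nat \<bar>k\<bar>) :: complex)"
proof -
  have "sgn k * k = \<bar>k\<bar>" by (simp add: abs_sgn mult.commute)
  then have "of_int (sgn k) * of_int k = (of_int \<bar>k\<bar> :: complex)" by (metis of_int_mult)
  then show ?thesis by simp
qed

context seminormed_lattice
begin

text \<open>Rounding coordinates by Dirichlet's theorem yields lattice vectors shorter than \<open>u r\<close>, which
  therefore depend on the earlier minima. This controls the size and the denominators of coordinates.\<close>

lemma approximation_error:
  assumes ch: "chain (Suc r) u" and T: "T = grid_size c d (Suc r)" and B: "0 \<le> B"
    and a: "\<And>j i. j < Suc r \<Longrightarrow> i \<in> {1..d} \<Longrightarrow> real_of_int \<bar>a j i\<bar> \<le> B / T"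
  shows "N (comb (\<lambda>j. int_comb d e (a j)) u (Suc r)) \<le> B * N (u r) / 2"
proof -
  have T0: "0 < T" using grid_size_pos T by simp
  have pos: "0 < N (u r)" using chain_pos[OF ch] by simp
  have "N (comb (\<lambda>j. int_comb d e (a j)) u (Suc r)) \<le> Suc r * (d * c * (B / T) * N (u r))"
    using chainD[OF ch] chain_le[OF ch] a B by (intro N_comb) (auto simp: less_Suc_eq_le)
  also have "\<dots> = (2 * d * c * Suc r) / T * (B * N (u r) / 2)" by simp
  also have "\<dots> \<le> 1 * (B * N (u r) / 2)"
    using grid_size_ge[of d c "Suc r"] T T0 pos B by (intro mult_right_mono) (auto simp: field_simps)
  finally show ?thesis by simp
qed

text \<open>Divide all coefficients by the largest top coordinate \<open>B\<close> and approximate.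
  The rounded combination \<open>y\<close> keeps a non-zero top coefficient, so \<open>N y\<close>
  is at least \<open>N (u r)\<close>, while \<open>B\<close> times \<open>y\<close> differs from
  \<open>m\<close> times \<open>z\<close> by at most half of \<open>B * N (u r)\<close>. Absorbing
  this half gives the factor 2.\<close>

lemma top_coefficient_bound:
  assumes ch: "chain (Suc r) u" and z: "z \<in> \<Lambda>"
    and 0: "N (z - comb (\<lambda>j. int_comb d e (b j)) u (Suc r)) = 0" and i: "i \<in> {1..d}"
  shows "real_of_int \<bar>b r i\<bar> * N (u r) \<le> 2 * mult_bound c d (Suc r) * N z"
proof -
  define B where "B = Max ((\<lambda>i. \<bar>b r i\<bar>) ` {1..d})"
  have B_ge: "\<bar>b r k\<bar> \<le> B" if "k \<in> {1..d}" for k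
    unfolding B_def using that by (intro Max_ge) auto
  have "B \<in> (\<lambda>i. \<bar>b r i\<bar>) ` {1..d}" unfolding B_def using i by (intro Max_in) auto
  then obtain i' where i': "i' \<in> {1..d}" "B = \<bar>b r i'\<bar>" by blast
  have u: "u j \<in> \<Lambda>" if "j < Suc r" for j using chainD(1)[OF ch that] .
  have pos: "0 < N (u r)" using chain_pos[OF ch] by simp
  have "real_of_int B * N (u r) \<le> 2 * mult_bound c d (Suc r) * N z"
  proof (cases "B = 0")
    case True
    then show ?thesis using N_nonneg[OF z] by simp
  next
    case False
    then have B: "B > 0" using B_ge[OF i] by linarith
    define T where "T = grid_size c d (Suc r)"
    have T0: "0 < T" using grid_size_pos T_def by simp
    obtain m a where m: "0 < m" "m \<le> T ^ (Suc r * d)"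
      and a: "\<And>j k. j < Suc r \<Longrightarrow> k \<in> {1..d} \<Longrightarrow>
        \<bar>real m * (of_int (b j k) / of_int B) - of_int (a j k)\<bar> < 1 / T"
      using dirichlet_grid[OF T0, of "Suc r" d "\<lambda>j k. of_int (b j k) / of_int B"] by blast
    have mM: "real m \<le> mult_bound c d (Suc r)"
      using m(2) by (simp add: mult_bound_def T_def del: of_nat_power flip: of_nat_le_iff)
    define \<alpha> where "\<alpha> = (\<lambda>j. int_comb d e (a j))"
    define \<beta> where "\<beta> = (\<lambda>j. int_comb d e (b j))"
    define y where "y = comb \<alpha> u (Suc r)"
    have R: "\<alpha> j \<in> R" "\<beta> j \<in> R" for j by (simp_all add: \<alpha>_def \<beta>_def)
    have y: "y \<in> \<Lambda>" unfolding y_def using R u by (intro comb_mem) auto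
    have err: "\<bar>B * a j k - int m * b j k\<bar> \<le> real_of_int B / T" if "j < Suc r" "k \<in> {1..d}" for j k
    proof -
      have "\<bar>B * a j k - int m * b j k\<bar> = \<bar>of_int B * (real m * (of_int (b j k) / of_int B) - of_int (a j k))\<bar>"
        using B by (simp add: right_diff_distrib abs_minus_commute)
      also have "\<dots> = of_int B * \<bar>real m * (of_int (b j k) / of_int B) - of_int (a j k)\<bar>"
        using B by (simp add: abs_mult)
      also have "\<dots> \<le> of_int B * (1 / T)"
        using a[OF that] B by (intro mult_left_mono) auto
      finally show ?thesis by simp
    qed
    have "real_of_int B * N y = N (sc (of_int B) y)" using N_int[OF y, of B] B by simp
    also have "sc (of_int B) y = sc (of_nat m) z + comb (\<lambda>j. int_comb d e (\<lambda>k. B * a j k - int m * b j k)) u (Suc r)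
        - sc (of_nat m) (z - comb \<beta> u (Suc r))"
      by (simp add: y_def \<alpha>_def \<beta>_def int_comb_diff int_comb_mult comb_diff comb_sc scale_right_diff_distrib)
    also have "N \<dots> \<le> (N (sc (of_nat m) z) + B * N (u r) / 2) + real m * 0"
    proof (rule order_trans[OF N_diff])
      show "sc (of_nat m) z + comb (\<lambda>j. int_comb d e (\<lambda>k. B * a j k - int m * b j k)) u (Suc r) \<in> \<Lambda>"
        using z u by (intro add_mem sc_mem comb_mem R_nat) auto
      have w: "z - comb \<beta> u (Suc r) \<in> \<Lambda>" using z u R by (intro diff_mem comb_mem) auto
      then show "sc (of_nat m) (z - comb \<beta> u (Suc r)) \<in> \<Lambda>" by (intro sc_mem R_nat)
      have "N (comb (\<lambda>j. int_comb d e (\<lambda>k. B * a j k - int m * b j k)) u (Suc r)) \<le> of_int B * N (u r) / 2"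
        using err B by (intro approximation_error[OF ch T_def]) auto
      moreover have "N (sc (of_nat m) (z - comb \<beta> u (Suc r))) = real m * 0"
        using 0 N_nat[OF w] by (simp add: \<beta>_def)
      ultimately show "N (sc (of_nat m) z + comb (\<lambda>j. int_comb d e (\<lambda>k. B * a j k - int m * b j k)) u (Suc r))
          + N (sc (of_nat m) (z - comb \<beta> u (Suc r))) \<le> (N (sc (of_nat m) z) + B * N (u r) / 2) + real m * 0"
        using N_add[of "sc (of_nat m) z" "comb (\<lambda>j. int_comb d e (\<lambda>k. B * a j k - int m * b j k)) u (Suc r)"]
          z u by (smt (verit) comb_mem rangeI sc_mem R_nat)
    qed
    finally have le: "real_of_int B * N y \<le> m * N z + B * N (u r) / 2"
      using N_nat[OF z] by simp
    \<comment> \<open>At the coordinate where the maximum \<open>B\<close> is attained, the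
      approximated number is \<open>m\<close> or \<open>- m\<close>, thus at distance at least 1
      from 0.\<close>
    have "a r i' \<noteq> 0"
    proof
      assume "a r i' = 0"
      then have "real m * (real_of_int \<bar>b r i'\<bar> / of_int B) < 1 / T"
        using a[of r i'] i' B by (simp add: abs_mult)
      then have "real m < 1 / T" using i'(2) B by simp
      also have "\<dots> \<le> 1" using T0 by simp
      finally show False using m by simp
    qed
    then have "\<alpha> r \<noteq> 0" unfolding \<alpha>_def using indep[of "a r" i'] i' by blast
    then have "y \<notin> Dep r u" unfolding y_def using R by (intro top_coefficient_not_Dep[OF ch]) auto
    then have "N (u r) \<le> N y" using chainD(4)[OF ch, of r y] y by force
    then have "real_of_int B * N (u r) \<le> of_int B * N y" using B by (intro mult_left_mono) auto
    with le have "real_of_int B * N (u r) \<le> 2 * (real m * N z)" by simp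
    also have "\<dots> \<le> 2 * (mult_bound c d (Suc r) * N z)"
      using mM N_nonneg[OF z] by (intro mult_left_mono mult_right_mono) auto
    finally show ?thesis by simp
  qed
  moreover have "real_of_int \<bar>b r i\<bar> * N (u r) \<le> real_of_int B * N (u r)"
    using B_ge[OF i] pos by (intro mult_right_mono) auto
  ultimately show ?thesis by linarith
qed

lemma coefficient_bound:
  assumes "chain r u" "z \<in> \<Lambda>" "N (z - comb (\<lambda>j. int_comb d e (b j)) u r) = 0" "j < r" "i \<in> {1..d}"
  shows "real_of_int \<bar>b j i\<bar> * N (u j) \<le> coeff_const c d r * N z"
  using assms
proof (induction r arbitrary: z j i)
  case (Suc r)
  note ch = \<open>chain (Suc r) u\<close>
  define M where "M = real (mult_bound c d (Suc r))"
  have top: "real_of_int \<bar>b r k\<bar> * N (u r) \<le> 2 * M * N z" if "k \<in> {1..d}" for k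
    using top_coefficient_bound[OF ch Suc.prems(2,3) that] by (simp add: M_def)
  have u: "u j \<in> \<Lambda>" if "j < Suc r" for j using chainD(1)[OF ch that] .
  have pos: "0 < N (u r)" using chain_pos[OF ch] by simp
  have z: "z \<in> \<Lambda>" "0 \<le> N z" using Suc.prems N_nonneg by auto
  have M: "0 \<le> M" by (simp add: M_def)
  have cc: "0 \<le> coeff_const c d r" by (simp add: coeff_const_nonneg c_nonneg)
  show ?case
  proof (cases "j = r")
    case True
    have "real_of_int \<bar>b r i\<bar> * N (u r) \<le> 2 * M * N z" using top[OF Suc.prems(5)] .
    also have "\<dots> \<le> coeff_const c d (Suc r) * N z"
      using z M cc c_nonneg unfolding coeff_const.simps M_def[symmetric]
      by (intro mult_right_mono) auto
    finally show ?thesis using True by simp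
  next
    case False
    then have j: "j < r" using Suc.prems by simp
    define w where "w = sc (int_comb d e (b r)) (u r)"
    have w: "w \<in> \<Lambda>" unfolding w_def using u by (intro sc_mem) auto
    have "N w \<le> d * c * (2 * M * N z / N (u r)) * N (u r)"
      unfolding w_def using u top pos by (intro N_int_comb) (auto simp: pos_le_divide_eq)
    then have Nw: "N w \<le> 2 * d * c * M * N z" using pos by simp
    have "N ((z - w) - comb (\<lambda>j. int_comb d e (b j)) u r) = 0"
      using Suc.prems(3) by (simp add: comb_Suc w_def algebra_simps)
    then have "real_of_int \<bar>b j i\<bar> * N (u j) \<le> coeff_const c d r * N (z - w)"
      using Suc.IH[OF chain_mono[OF ch] _ _ j Suc.prems(5)] diff_mem[OF z(1) w] by simp
    also have "\<dots> \<le> coeff_const c d r * ((1 + 2 * d * c * M) * N z)"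
      using N_diff[OF z(1) w] Nw cc by (intro mult_left_mono) (auto simp: algebra_simps)
    also have "\<dots> \<le> coeff_const c d (Suc r) * N z"
      unfolding coeff_const.simps M_def[symmetric] using z M by (simp add: algebra_simps)
    finally show ?thesis .
  qed
qed simp

text \<open>The true coordinates of \<open>x\<close> are \<open>b / m0\<close> with
  \<open>m0\<close> out of control. A bounded multiple \<open>m\<close> makes them nearly integral;
  subtracting the rounded combination leaves a vector \<open>y\<close> shorter than
  \<open>u r\<close>, hence dependent on the first \<open>r\<close> vectors, and the induction
  hypothesis applies to \<open>y\<close>.\<close>

lemma denominator_bound:
  assumes "chain r u" "x \<in> Dep r u"
  shows "\<exists>\<alpha>. (\<forall>j<r. \<alpha> j \<in> R) \<and> N (sc (of_nat (denom_const c d r)) x - comb \<alpha> u r) = 0"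
  using assms
proof (induction r arbitrary: x)
  case 0
  then obtain m where "m > (0::nat)" "x \<in> \<Lambda>" "N (sc (of_nat m) x) = 0" by (auto simp: Dep_def comb_def)
  then show ?case by (simp add: N_nat comb_def)
next
  case (Suc r)
  note ch = \<open>chain (Suc r) u\<close>
  have u: "u j \<in> \<Lambda>" if "j < Suc r" for j using chainD(1)[OF ch that] .
  have pos: "0 < N (u r)" using chain_pos[OF ch] by simp
  obtain m0 \<beta> where x: "x \<in> \<Lambda>" and m0: "m0 > (0::nat)" and \<beta>: "\<forall>j<Suc r. \<beta> j \<in> R"
    and 0: "N (sc (of_nat m0) x - comb \<beta> u (Suc r)) = 0"
    using Suc.prems(2) by (auto simp: Dep_def)
  have "\<forall>j. \<exists>b. j < Suc r \<longrightarrow> \<beta> j = int_comb d e b" using \<beta> by blast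
  then obtain b where b: "\<And>j. j < Suc r \<Longrightarrow> \<beta> j = int_comb d e (b j)" by metis
  define T where "T = grid_size c d (Suc r)"
  have T0: "0 < T" using grid_size_pos T_def by simp
  obtain m a where m: "0 < m" "m \<le> T ^ (Suc r * d)"
    and a: "\<And>j k. j < Suc r \<Longrightarrow> k \<in> {1..d} \<Longrightarrow>
        \<bar>real m * (of_int (b j k) / real m0) - of_int (a j k)\<bar> < 1 / T"
    using dirichlet_grid[OF T0, of "Suc r" d "\<lambda>j k. of_int (b j k) / real m0"] by blast
  define \<alpha> where "\<alpha> = (\<lambda>j. int_comb d e (a j))"
  have R: "\<alpha> j \<in> R" for j by (simp add: \<alpha>_def)
  define y where "y = sc (of_nat m) x - comb \<alpha> u (Suc r)"
  have y: "y \<in> \<Lambda>" unfolding y_def using R u x by (intro diff_mem sc_mem comb_mem R_nat) auto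
  have err: "\<bar>int m * b j k - int m0 * a j k\<bar> \<le> real m0 / T" if "j < Suc r" "k \<in> {1..d}" for j k
  proof -
    have "\<bar>int m * b j k - int m0 * a j k\<bar> = \<bar>real m0 * (real m * (of_int (b j k) / real m0) - of_int (a j k))\<bar>"
      using m0 by (simp add: right_diff_distrib)
    also have "\<dots> = real m0 * \<bar>real m * (of_int (b j k) / real m0) - of_int (a j k)\<bar>"
      by (simp add: abs_mult)
    also have "\<dots> \<le> real m0 * (1 / T)"
      using a[OF that] by (intro mult_left_mono) auto
    finally show ?thesis by simp
  qed
  define E where "E = comb (\<lambda>j. int_comb d e (\<lambda>k. int m * b j k - int m0 * a j k)) u (Suc r)"
  have E: "E \<in> \<Lambda>" unfolding E_def using u by (intro comb_mem) auto
  have NE: "N E \<le> m0 * N (u r) / 2"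
    unfolding E_def using err by (intro approximation_error[OF ch T_def]) auto
  have "comb \<beta> u (Suc r) = comb (\<lambda>j. int_comb d e (b j)) u (Suc r)"
    unfolding comb_def by (intro sum.cong refl) (use b in auto)
  then have "sc (of_nat m0) y - E = sc (of_nat m) (sc (of_nat m0) x - comb \<beta> u (Suc r))"
    by (simp add: y_def E_def \<alpha>_def int_comb_diff int_comb_mult comb_diff comb_sc scale_right_diff_distrib mult.commute)
  moreover have "sc (of_nat m0) x - comb \<beta> u (Suc r) \<in> \<Lambda>"
    using \<beta> u x by (intro diff_mem sc_mem comb_mem R_nat) auto
  ultimately have "N (sc (of_nat m0) y - E) = 0" using N_sc_zero[OF R_nat _ 0, of m] by simp
  then have "N (sc (of_nat m0) y) \<le> N E" using E y by (intro N_le_if_diff_zero sc_mem R_nat)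
  with NE have "m0 * N y \<le> m0 * (N (u r) / 2)" using N_nat[OF y] by simp
  then have "N y < N (u r)" using m0 pos by simp
  then have "y \<in> Dep r u" using chainD(4)[OF ch, of r y] y by simp
  then obtain \<gamma> where \<gamma>: "\<forall>j<r. \<gamma> j \<in> R" and 1: "N (sc (of_nat (denom_const c d r)) y - comb \<gamma> u r) = 0"
    using Suc.IH[OF chain_mono[OF ch]] by auto
  define K where "K = denom_const c d r"
  have "m dvd fact (T ^ (Suc r * d))" using m by (intro dvd_fact) auto
  then obtain f where f: "denom_const c d (Suc r) = K * (m * f)"
    by (auto simp: mult_bound_def T_def K_def elim!: dvdE)
  define \<gamma>' where "\<gamma>' j = (if j < r then \<gamma> j else 0)" for j
  have \<gamma>': "comb \<gamma>' u (Suc r) = comb \<gamma> u r"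
    unfolding comb_Suc by (simp add: comb_def \<gamma>'_def)
  define \<delta> where "\<delta> = (\<lambda>j. of_nat f * (\<gamma>' j + of_nat K * \<alpha> j))"
  have "sc (of_nat (denom_const c d (Suc r))) x - comb \<delta> u (Suc r) = sc (of_nat f) (sc (of_nat K) y - comb \<gamma> u r)"
    by (simp add: f y_def \<delta>_def comb_sc comb_add \<gamma>' scale_right_distrib scale_right_diff_distrib mult_ac
        del: denom_const.simps)
  moreover have "sc (of_nat K) y - comb \<gamma> u r \<in> \<Lambda>"
    using \<gamma> u y by (intro diff_mem sc_mem comb_mem R_nat) auto
  ultimately have "N (sc (of_nat (denom_const c d (Suc r))) x - comb \<delta> u (Suc r)) = 0"
    using N_sc_zero[OF R_nat, of _ f] 1 by (simp add: K_def)
  moreover have "\<forall>j<Suc r. \<delta> j \<in> R"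
    using \<gamma> R by (auto simp: \<delta>_def \<gamma>'_def intro!: R_mult R_add R_nat R_0)
  ultimately show ?case by blast
qed

text \<open>Vectors independent over the order are independent over the rationals: a rational
  relation, cleared of denominators and solved for its last vector, would make that vector dependent
  on the earlier ones. Applied to chains and, later, to kernel vectors.\<close>

lemma independent_length:
  assumes u: "\<And>j. j < r \<Longrightarrow> u j \<in> \<Lambda>" and ind: "\<And>j. j < r \<Longrightarrow> u j \<notin> Dep j u"
  shows "r \<le> card G"
proof -
  interpret Q: vector_space "\<lambda>q. sc (of_rat q)"
    by standard (simp_all add: of_rat_add of_rat_mult scale_left_distrib scale_right_distrib)
  have inj: "inj_on u {..<r}"
  proof (rule linorder_inj_onI)
    fix i j assume "i < j" "i \<in> {..<r}" "j \<in> {..<r}"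
    then show "u i \<noteq> u j" using mem_Dep[of i j u] u[of i] ind[of j] by auto
  qed auto
  have int_indep: "k j = 0" if 0: "(\<Sum>j<r. sc (of_int (k j)) (u j)) = 0" and j: "j < r" for k j
  proof (rule ccontr)
    assume "k j \<noteq> 0"
    define t where "t = (GREATEST j. j < r \<and> k j \<noteq> 0)"
    have t: "t < r" "k t \<noteq> 0"
      using GreatestI_nat[of "\<lambda>j. j < r \<and> k j \<noteq> 0" j r] \<open>k j \<noteq> 0\<close> j unfolding t_def by auto
    have max: "k i = 0" if "t < i" "i < r" for i
      using Greatest_le_nat[of "\<lambda>j. j < r \<and> k j \<noteq> 0" i r] that unfolding t_def by auto
    \<comment> \<open>The sign makes the multiplier of \<open>u t\<close> positive, as
      \<open>Dep\<close> demands.\<close>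
    define \<beta> where "\<beta> = (\<lambda>i. of_int (- sgn (k t)) * of_int (k i) :: complex)"
    have "(\<Sum>j<r. sc (of_int (k j)) (u j)) = (\<Sum>j<Suc t. sc (of_int (k j)) (u j))"
      using t max by (intro sum.mono_neutral_right) auto
    then have "sc (of_int (k t)) (u t) = - comb (\<lambda>i. of_int (k i)) u t"
      using 0 by (simp add: comb_def eq_neg_iff_add_eq_0 add.commute)
    then have "sc (of_int (sgn (k t))) (sc (of_int (k t)) (u t))
        = sc (of_int (sgn (k t))) (- comb (\<lambda>i. of_int (k i)) u t)" by (rule arg_cong)
    also have "\<dots> = comb \<beta> u t" unfolding \<beta>_def comb_sc by simp
    finally have "sc (of_int (sgn (k t))) (sc (of_int (k t)) (u t)) = comb \<beta> u t" .
    moreover have "(of_int (sgn (k t)) * of_int (k t) :: complex) = of_nat (nat \<bar>k t\<bar>)"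
      by (rule sgn_mult_complex)
    ultimately have "sc (of_nat (nat \<bar>k t\<bar>)) (u t) - comb \<beta> u t = 0" by simp
    moreover have "\<beta> i \<in> R" for i unfolding \<beta>_def by (intro R_int_mult R_int)
    ultimately have "u t \<in> Dep t u" unfolding Dep_def using u[OF t(1)] t N_0
      by (intro CollectI conjI exI[of _ "nat \<bar>k t\<bar>"] exI[of _ \<beta>]) auto
    with ind[OF t(1)] show False by simp
  qed
  have "Q.independent (u ` {..<r})"
  proof
    assume "Q.dependent (u ` {..<r})"
    then obtain q v where v: "v \<in> u ` {..<r}" "q v \<noteq> 0" and 0: "(\<Sum>v\<in>u ` {..<r}. sc (of_rat (q v)) v) = 0"
      by (auto simp: Q.dependent_finite)
    obtain m k where m: "m > 0" and k: "\<And>v. v \<in> u ` {..<r} \<Longrightarrow> of_nat m * q v = of_int (k v)"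
      using common_denominator[of "u ` {..<r}" q] by (metis finite_imageI finite_lessThan)
    obtain j where j: "j < r" "v = u j" using v by blast
    have "(\<Sum>v\<in>u ` {..<r}. sc (of_int (k v)) v) = sc (of_nat m) (\<Sum>v\<in>u ` {..<r}. sc (of_rat (q v)) v)"
      unfolding scale_sum_right
    proof (intro sum.cong refl)
      fix v assume "v \<in> u ` {..<r}"
      then have "of_int (k v) = (of_nat m * of_rat (q v) :: complex)"
        by (metis k of_rat_mult of_rat_of_int_eq of_rat_of_nat_eq)
      then show "sc (of_int (k v)) v = sc (of_nat m) (sc (of_rat (q v)) v)" by simp
    qed
    then have "(\<Sum>j<r. sc (of_int (k (u j))) (u j)) = 0"
      using 0 by (simp add: sum.reindex[OF inj])
    from int_indep[OF this j(1)] have "k v = 0" using j by simp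
    then show False using k[of v] v m by simp
  qed
  moreover have "u ` {..<r} \<subseteq> Q.span G"
  proof
    fix v assume "v \<in> u ` {..<r}"
    then obtain q :: "'v \<Rightarrow> rat" where "v = (\<Sum>g\<in>G. sc (of_rat (q g)) g)" using span_G u by blast
    then show "v \<in> Q.span G" by (auto intro!: Q.span_sum Q.span_scale intro: Q.span_base)
  qed
  ultimately have "card (u ` {..<r}) \<le> card G"
    using Q.independent_span_bound[OF finite_G] by blast
  then show ?thesis using card_image[OF inj] by simp
qed

lemma chain_length: "chain r u \<Longrightarrow> r \<le> card G"
  by (rule independent_length[of r u]) (auto simp: chain_def)

text \<open>Take a longest chain: a vector of seminorm at most \<open>s\<close> outside its span
  could be chosen shortest and would extend the chain. The constants refer to \<open>card G\<close>
  instead of \<open>r\<close> so as not to depend on the chain.\<close>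

theorem reduced_basis:
  obtains r u where "r \<le> card G" "\<And>j. j < r \<Longrightarrow> u j \<in> \<Lambda>" "\<And>j. j < r \<Longrightarrow> 0 < N (u j)" "\<And>j. j < r \<Longrightarrow> N (u j) \<le> s"
    "\<And>z b j i. z \<in> \<Lambda> \<Longrightarrow> N (z - (\<Sum>j<r. sc (int_comb d e (b j)) (u j))) = 0 \<Longrightarrow> j < r \<Longrightarrow> i \<in> {1..d} \<Longrightarrow>
        real_of_int \<bar>b j i\<bar> * N (u j) \<le> coeff_const c d (card G) * N z"
    "\<And>x. x \<in> \<Lambda> \<Longrightarrow> N x \<le> s \<Longrightarrow>
        \<exists>b. N (sc (of_nat (denom_const c d (card G))) x - (\<Sum>j<r. sc (int_comb d e (b j)) (u j))) = 0"
proof -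
  define r where "r = (GREATEST r. \<exists>u. chain r u)"
  have ex: "\<exists>u. chain r u" unfolding r_def
    by (rule GreatestI_nat[of _ 0 "card G"]) (auto simp: chain_def[of 0] dest: chain_length)
  have max: "r' \<le> r" if "\<exists>u. chain r' u" for r'
    unfolding r_def using that by (rule Greatest_le_nat[of _ _ "card G"]) (auto dest: chain_length)
  obtain u where ch: "chain r u" using ex by blast
  have complete: "x \<in> Dep r u" if x: "x \<in> \<Lambda>" "N x \<le> s" for x
  proof (rule ccontr)
    assume "x \<notin> Dep r u"
    then have "{x\<in>\<Lambda>. N x \<le> s \<and> x \<notin> Dep r u} \<noteq> {}" using x by blast
    then obtain v where v: "v \<in> \<Lambda>" "N v \<le> s" "v \<notin> Dep r u"
      and min: "\<And>y. y \<in> \<Lambda> \<Longrightarrow> N y \<le> s \<Longrightarrow> y \<notin> Dep r u \<Longrightarrow> N v \<le> N y"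
      using N_min[of "{x\<in>\<Lambda>. N x \<le> s \<and> x \<notin> Dep r u}"] by auto
    have D: "Dep j (u(r := v)) = Dep j u" if "j \<le> r" for j
    proof -
      have "comb \<beta> (u(r := v)) j = comb \<beta> u j" for \<beta>
        unfolding comb_def using that by (intro sum.cong refl) auto
      then show ?thesis by (simp add: Dep_def)
    qed
    have "chain (Suc r) (u(r := v))"
      unfolding chain_def
    proof (intro allI impI)
      fix j assume "j < Suc r"
      then consider "j = r" | "j < r" by linarith
      then show "(u(r := v)) j \<in> \<Lambda> \<and> N ((u(r := v)) j) \<le> s \<and> (u(r := v)) j \<notin> Dep j (u(r := v)) \<and>
          (\<forall>x\<in>\<Lambda>. N x < N ((u(r := v)) j) \<longrightarrow> x \<in> Dep j (u(r := v)))"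
      proof cases
        case 1
        have "x \<in> Dep r u" if "x \<in> \<Lambda>" "N x < N v" for x
          using min[of x] that v(2) by force
        then show ?thesis using 1 v by (simp add: D)
      next
        case 2
        then show ?thesis using chainD[OF ch 2] by (simp add: D)
      qed
    qed
    then show False using max[of "Suc r"] by auto
  qed
  show thesis
  proof (rule that[of r u])
    show "r \<le> card G" by (rule chain_length[OF ch])
    show "u j \<in> \<Lambda>" "0 < N (u j)" "N (u j) \<le> s" if "j < r" for j
      using chainD[OF ch that] chain_pos[OF ch that] by auto
    show "real_of_int \<bar>b j i\<bar> * N (u j) \<le> coeff_const c d (card G) * N z"
      if "z \<in> \<Lambda>" "N (z - (\<Sum>j<r. sc (int_comb d e (b j)) (u j))) = 0" "j < r" "i \<in> {1..d}" for z b j i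
    proof -
      have "real_of_int \<bar>b j i\<bar> * N (u j) \<le> coeff_const c d r * N z"
        using that by (intro coefficient_bound[OF ch]) (auto simp: comb_def)
      also have "\<dots> \<le> coeff_const c d (card G) * N z"
        using N_nonneg[OF that(1)] coeff_const_mono[OF c_nonneg chain_length[OF ch]] by (intro mult_right_mono)
      finally show ?thesis .
    qed
    show "\<exists>b. N (sc (of_nat (denom_const c d (card G))) x - (\<Sum>j<r. sc (int_comb d e (b j)) (u j))) = 0"
      if x: "x \<in> \<Lambda>" "N x \<le> s" for x
    proof -
      obtain \<alpha> where \<alpha>: "\<forall>j<r. \<alpha> j \<in> R" and 0: "N (sc (of_nat (denom_const c d r)) x - comb \<alpha> u r) = 0"
        using denominator_bound[OF ch complete[OF x]] by blast
      obtain f where f: "denom_const c d (card G) = denom_const c d r * f"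
        using denom_const_dvd[OF chain_length[OF ch]] by blast
      have "sc (of_nat (denom_const c d (card G))) x - comb (\<lambda>j. of_nat f * \<alpha> j) u r
          = sc (of_nat f) (sc (of_nat (denom_const c d r)) x - comb \<alpha> u r)"
        by (simp add: f comb_sc scale_right_diff_distrib mult_ac)
      moreover have "sc (of_nat (denom_const c d r)) x - comb \<alpha> u r \<in> \<Lambda>"
        using \<alpha> x chainD(1)[OF ch] by (intro diff_mem sc_mem comb_mem R_nat) auto
      ultimately have "N (sc (of_nat (denom_const c d (card G))) x - comb (\<lambda>j. of_nat f * \<alpha> j) u r) = 0"
        using N_sc_zero[OF R_nat _ 0] by simp
      moreover have "\<forall>j. \<exists>b. j < r \<longrightarrow> of_nat f * \<alpha> j = int_comb d e b"
        using \<alpha> R_mult[OF R_nat] by blast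
      then obtain b where "\<And>j. j < r \<Longrightarrow> of_nat f * \<alpha> j = int_comb d e (b j)" by metis
      then have "comb (\<lambda>j. of_nat f * \<alpha> j) u r = (\<Sum>j<r. sc (int_comb d e (b j)) (u j))"
        unfolding comb_def by (intro sum.cong refl) auto
      ultimately show ?thesis by auto
    qed
  qed
qed

end

section \<open>Progressions in Bohr sets\<close>

definition psc :: "complex \<Rightarrow> ('i \<Rightarrow> complex) \<Rightarrow> 'i \<Rightarrow> complex" where
  "psc \<alpha> x = (\<lambda>i. \<alpha> * x i)"

lemma psc_apply [simp]: "psc \<alpha> x i = \<alpha> * x i"
  by (simp add: psc_def)

lemma vector_space_psc: "vector_space psc"
  by standard (simp_all add: fun_eq_iff algebra_simps)

lemma sum_fun_apply [simp]: "(\<Sum>k\<in>S. f k) i = (\<Sum>k\<in>S. f k i :: complex)"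
  by (induction S rule: infinite_finite_induct) simp_all

definition unit_fun :: "'i \<Rightarrow> 'i \<Rightarrow> complex" where
  "unit_fun i = (\<lambda>k. if k = i then 1 else 0)"

definition sup_norm :: "'i set \<Rightarrow> ('i \<Rightarrow> complex) \<Rightarrow> real" where
  "sup_norm I x = Max (insert 0 ((\<lambda>i. cmod (x i)) ` I))"

lemma sup_norm_le_iff: "finite I \<Longrightarrow> sup_norm I x \<le> b \<longleftrightarrow> 0 \<le> b \<and> (\<forall>i\<in>I. cmod (x i) \<le> b)"
  by (simp add: sup_norm_def)

lemma sup_norm_ge: "finite I \<Longrightarrow> i \<in> I \<Longrightarrow> cmod (x i) \<le> sup_norm I x"
  using sup_norm_le_iff[of I x "sup_norm I x"] by simp

lemma sup_norm_nonneg: "finite I \<Longrightarrow> 0 \<le> sup_norm I x"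
  using sup_norm_le_iff[of I x "sup_norm I x"] by simp

lemma sup_norm_add: "finite I \<Longrightarrow> sup_norm I (x + y) \<le> sup_norm I x + sup_norm I y"
  by (auto simp: sup_norm_le_iff sup_norm_nonneg intro!: norm_triangle_le add_mono sup_norm_ge add_nonneg_nonneg)

lemma sup_norm_psc:
  assumes "finite I" shows "sup_norm I (psc \<alpha> x) = cmod \<alpha> * sup_norm I x"
proof -
  have "insert 0 ((\<lambda>i. cmod (psc \<alpha> x i)) ` I) = (\<lambda>t. cmod \<alpha> * t) ` insert 0 ((\<lambda>i. cmod (x i)) ` I)"
    by (simp add: image_image norm_mult)
  moreover have "mono (\<lambda>t. cmod \<alpha> * t)" by (simp add: mono_def mult_left_mono)
  ultimately show ?thesis unfolding sup_norm_def using assms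
    by (simp only: mono_Max_commute[of "\<lambda>t. cmod \<alpha> * t"] finite_insert finite_imageI insert_not_empty simp_thms)
qed

text \<open>The Bohr set of \<open>\<Gamma>\<close> of width \<open>\<rho>\<close> corresponds to the vectors of this lattice of norm at most
  \<open>\<rho>\<close>; the frequency \<open>1\<close> recovers \<open>x\<close> modulo \<open>N\<close>.\<close>

definition bohr_lattice :: "nat set \<Rightarrow> nat \<Rightarrow> (nat \<Rightarrow> complex) set" where
  "bohr_lattice \<Gamma> N = {y. (\<forall>\<gamma>. \<gamma> \<notin> \<Gamma> \<longrightarrow> y \<gamma> = 0) \<and>
     (\<exists>x::int. \<forall>\<gamma>\<in>\<Gamma>. \<exists>k::int. y \<gamma> = of_int (int \<gamma> * x + int N * k))}"

lemma bohr_latticeI: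
  assumes "\<And>\<gamma>. \<gamma> \<notin> \<Gamma> \<Longrightarrow> y \<gamma> = 0" "\<And>\<gamma>. \<gamma> \<in> \<Gamma> \<Longrightarrow> \<exists>k::int. y \<gamma> = of_int (int \<gamma> * x + int N * k)"
  shows "y \<in> bohr_lattice \<Gamma> N"
  using assms unfolding bohr_lattice_def by blast

lemma bohr_latticeE:
  assumes "y \<in> bohr_lattice \<Gamma> N"
  obtains x :: int where "\<And>\<gamma>. \<gamma> \<in> \<Gamma> \<Longrightarrow> \<exists>k::int. y \<gamma> = of_int (int \<gamma> * x + int N * k)"
  using assms unfolding bohr_lattice_def by blast

lemma bohr_lattice_outside: "y \<in> bohr_lattice \<Gamma> N \<Longrightarrow> \<gamma> \<notin> \<Gamma> \<Longrightarrow> y \<gamma> = 0"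
  by (simp add: bohr_lattice_def)

lemma bohr_lattice_int:
  assumes "y \<in> bohr_lattice \<Gamma> N" shows "\<exists>t::int. y \<gamma> = of_int t"
proof (cases "\<gamma> \<in> \<Gamma>")
  case True
  then show ?thesis using assms unfolding bohr_lattice_def by blast
next
  case False
  then have "y \<gamma> = of_int 0" using assms by (simp add: bohr_lattice_def)
  then show ?thesis by blast
qed

text \<open>The entries of Bohr lattice vectors are integers, so the norm takes natural values; the
  existence of shortest vectors rests on this.\<close>

lemma sup_norm_bohr_nat:
  assumes "finite \<Gamma>" "y \<in> bohr_lattice \<Gamma> N"
  shows "real (nat \<lfloor>sup_norm \<Gamma> y\<rfloor>) = sup_norm \<Gamma> y"
proof -
  have "sup_norm \<Gamma> y \<in> insert 0 ((\<lambda>i. cmod (y i)) ` \<Gamma>)"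
    unfolding sup_norm_def using assms(1) by (intro Max_in) auto
  then have "\<exists>t::int. sup_norm \<Gamma> y = of_int t"
  proof
    assume "sup_norm \<Gamma> y \<in> (\<lambda>i. cmod (y i)) ` \<Gamma>"
    then obtain \<gamma> where "sup_norm \<Gamma> y = cmod (y \<gamma>)" by blast
    moreover obtain t where "y \<gamma> = of_int t" using bohr_lattice_int[OF assms(2)] by blast
    ultimately have "sup_norm \<Gamma> y = of_int \<bar>t\<bar>" by simp
    then show ?thesis by blast
  qed (auto intro: exI[of _ 0])
  then show ?thesis using sup_norm_nonneg[OF assms(1), of y] by auto
qed

section \<open>The integers as an order of rank one\<close>

lemma int_comb_one: "int_comb (Suc 0) (\<lambda>_. 1) a = of_int (a (Suc 0))"
  by (simp add: int_comb_def)

lemma range_int_comb_one: "range (int_comb (Suc 0) (\<lambda>_. 1)) = range of_int"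
proof (intro equalityI subsetI)
  fix x :: complex assume "x \<in> range of_int"
  then obtain t where "x = of_int t" by blast
  then have "x = int_comb (Suc 0) (\<lambda>_. 1) (\<lambda>_. t)" by (simp only: int_comb_one)
  then show "x \<in> range (int_comb (Suc 0) (\<lambda>_. 1))" by blast
qed (auto simp: int_comb_one)

lemma int_order_one: "int_order 1 (\<lambda>_. 1)"
proof
  fix \<alpha> assume "\<alpha> \<in> range (int_comb 1 (\<lambda>_. 1))" "\<alpha> \<noteq> 0"
  then obtain t :: int where t: "\<alpha> = of_int t" "t \<noteq> 0" unfolding One_nat_def range_int_comb_one by auto
  have "sgn t * t = \<bar>t\<bar>" by (simp add: abs_sgn mult.commute)
  then have "of_int (sgn t) * \<alpha> = of_int \<bar>t\<bar>" by (metis t(1) of_int_mult)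
  then have "of_int (sgn t) * \<alpha> = of_nat (nat \<bar>t\<bar>)" by simp
  then show "\<exists>\<beta>\<in>range (int_comb 1 (\<lambda>_. 1)). \<exists>m>0. \<beta> * \<alpha> = of_nat m"
    unfolding One_nat_def range_int_comb_one using t by (intro bexI[of _ "of_int (sgn t)"] exI[of _ "nat \<bar>t\<bar>"]) auto
qed (auto simp: int_comb_one range_int_comb_one intro: range_eqI[of _ _ 1])

lemma seminormed_bohr_lattice:
  assumes fin: "finite \<Gamma>"
  shows "seminormed_lattice 1 (\<lambda>_. 1) psc (bohr_lattice \<Gamma> N) (sup_norm \<Gamma>) 1 s (unit_fun ` \<Gamma>)"
proof -
  interpret vector_space psc by (rule vector_space_psc)
  interpret int_order 1 "\<lambda>_. 1" by (rule int_order_one)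
  show ?thesis
  proof
    show "0 \<in> bohr_lattice \<Gamma> N"
      by (rule bohr_latticeI[of _ _ 0]) (auto intro!: exI[of _ 0])
    show "x + y \<in> bohr_lattice \<Gamma> N" if xy: "x \<in> bohr_lattice \<Gamma> N" "y \<in> bohr_lattice \<Gamma> N" for x y
    proof -
      obtain p where p: "\<And>\<gamma>. \<gamma> \<in> \<Gamma> \<Longrightarrow> \<exists>k::int. x \<gamma> = of_int (int \<gamma> * p + int N * k)"
        using bohr_latticeE[OF xy(1)] by blast
      obtain q where q: "\<And>\<gamma>. \<gamma> \<in> \<Gamma> \<Longrightarrow> \<exists>k::int. y \<gamma> = of_int (int \<gamma> * q + int N * k)"
        using bohr_latticeE[OF xy(2)] by blast
      have "\<exists>k::int. (x + y) \<gamma> = of_int (int \<gamma> * (p + q) + int N * k)" if \<gamma>: "\<gamma> \<in> \<Gamma>" for \<gamma>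
      proof -
        obtain k l :: int where "x \<gamma> = of_int (int \<gamma> * p + int N * k)" "y \<gamma> = of_int (int \<gamma> * q + int N * l)"
          using p q \<gamma> by meson
        then show ?thesis by (intro exI[of _ "k + l"]) (simp add: algebra_simps)
      qed
      then show ?thesis using bohr_lattice_outside[OF xy(1)] bohr_lattice_outside[OF xy(2)]
        by (intro bohr_latticeI[of _ _ "p + q"]) auto
    qed
    show "psc \<alpha> x \<in> bohr_lattice \<Gamma> N" if \<alpha>: "\<alpha> \<in> range (int_comb 1 (\<lambda>_. 1))" and x: "x \<in> bohr_lattice \<Gamma> N" for \<alpha> x
    proof -
      obtain t :: int where t: "\<alpha> = of_int t" using \<alpha> unfolding One_nat_def range_int_comb_one by blast
      obtain p where p: "\<And>\<gamma>. \<gamma> \<in> \<Gamma> \<Longrightarrow> \<exists>k::int. x \<gamma> = of_int (int \<gamma> * p + int N * k)"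
        using bohr_latticeE[OF x] by blast
      have "\<exists>k::int. psc \<alpha> x \<gamma> = of_int (int \<gamma> * (t * p) + int N * k)" if \<gamma>: "\<gamma> \<in> \<Gamma>" for \<gamma>
      proof -
        obtain k :: int where "x \<gamma> = of_int (int \<gamma> * p + int N * k)" using p \<gamma> by blast
        then show ?thesis by (intro exI[of _ "t * k"]) (simp add: t algebra_simps)
      qed
      then show ?thesis using bohr_lattice_outside[OF x]
        by (intro bohr_latticeI[of _ _ "t * p"]) auto
    qed
    show "sup_norm \<Gamma> (x + y) \<le> sup_norm \<Gamma> x + sup_norm \<Gamma> y" for x y
      by (rule sup_norm_add[OF fin])
    show "sup_norm \<Gamma> (psc (of_int k) x) = real_of_int \<bar>k\<bar> * sup_norm \<Gamma> x" for k x
      by (simp add: sup_norm_psc[OF fin])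
    show "sup_norm \<Gamma> (psc 1 x) \<le> 1 * sup_norm \<Gamma> x" for x
      by (simp add: sup_norm_psc[OF fin])
    show "\<exists>x\<in>Y. \<forall>y\<in>Y. sup_norm \<Gamma> x \<le> sup_norm \<Gamma> y"
      if Y: "Y \<subseteq> {x\<in>bohr_lattice \<Gamma> N. sup_norm \<Gamma> x \<le> s}" "Y \<noteq> {}" for Y
    proof -
      define f where "f y = nat \<lfloor>sup_norm \<Gamma> y\<rfloor>" for y
      obtain x where "x \<in> Y" "\<forall>y. y \<in> Y \<longrightarrow> f x \<le> f y"
        using Y(2) ex_has_least_nat[of "\<lambda>y. y \<in> Y" _ f] by blast
      moreover have "real (f y) = sup_norm \<Gamma> y" if "y \<in> Y" for y
        unfolding f_def using sup_norm_bohr_nat[OF fin, of y N] Y that by blast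
      ultimately show ?thesis by (metis of_nat_le_iff)
    qed
    show "finite (unit_fun ` \<Gamma>)" using fin by simp
    show "\<exists>q::(nat \<Rightarrow> complex) \<Rightarrow> rat. x = (\<Sum>g\<in>unit_fun ` \<Gamma>. psc (of_rat (q g)) g)"
      if x: "x \<in> bohr_lattice \<Gamma> N" for x
    proof -
      have inj: "inj_on (unit_fun :: nat \<Rightarrow> nat \<Rightarrow> complex) \<Gamma>"
        by (rule inj_onI) (metis unit_fun_def zero_neq_one)
      obtain t :: "nat \<Rightarrow> int" where t: "\<And>\<gamma>. x \<gamma> = of_int (t \<gamma>)" using bohr_lattice_int[OF x] by metis
      define q where "q g = (of_int (t (the_inv_into \<Gamma> unit_fun g)) :: rat)" for g :: "nat \<Rightarrow> complex"
      have "x i = (\<Sum>\<gamma>\<in>\<Gamma>. of_int (t \<gamma>) * unit_fun \<gamma> i)" for i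
      proof (cases "i \<in> \<Gamma>")
        case True
        then show ?thesis using fin by (simp add: unit_fun_def t if_distrib cong: if_cong)
      next
        case False
        then have "x i = 0" using x by (simp add: bohr_lattice_def)
        moreover have "(\<Sum>\<gamma>\<in>\<Gamma>. of_int (t \<gamma>) * unit_fun \<gamma> i) = (0::complex)"
          by (rule sum.neutral) (use False in \<open>auto simp: unit_fun_def\<close>)
        ultimately show ?thesis by simp
      qed
      moreover have "(\<Sum>g\<in>unit_fun ` \<Gamma>. psc (of_rat (q g)) g) = (\<Sum>\<gamma>\<in>\<Gamma>. psc (of_int (t \<gamma>)) (unit_fun \<gamma>))"
        unfolding sum.reindex[OF inj] o_def
        by (intro sum.cong refl) (simp add: q_def the_inv_into_f_f[OF inj])
      ultimately show ?thesis by (intro exI[of _ q]) (simp add: fun_eq_iff)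
    qed
  qed auto
qed

lemma card_le_prod_intervals:
  fixes r :: nat
  assumes "f \<in> S \<rightarrow> (\<Pi>\<^sub>E j\<in>{..<r}. {- B j..B j :: int})" "inj_on f S" "\<And>j. j < r \<Longrightarrow> 0 \<le> B j"
  shows "real (card S) \<le> (\<Prod>j<r. 2 * real_of_int (B j) + 1)"
proof -
  have "card S \<le> card (\<Pi>\<^sub>E j\<in>{..<r}. {- B j..B j})"
    using assms by (intro card_inj_on_le[of f]) (auto intro!: finite_PiE)
  also have "real \<dots> = (\<Prod>j<r. real (card {- B j..B j}))"
    by (simp add: card_PiE)
  also have "\<dots> = (\<Prod>j<r. 2 * real_of_int (B j) + 1)"
    using assms(3) by (intro prod.cong refl) auto
  finally show ?thesis by simp
qed

text \<open>Counting replaces volumes: every residue modulo \<open>N\<close> gives a lattice vector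
  of norm at most \<open>N\<close>, whose multiple by \<open>K\<close> has bounded coordinates. So
  \<open>N\<close> is at most a product of interval lengths, each comparable to the corresponding
  \<open>2 * M j + 1\<close>.\<close>

lemma bohr_progression:
  fixes \<Gamma> :: "nat set" and N n :: nat
  assumes fin: "finite \<Gamma>" "1 \<in> \<Gamma>" "card \<Gamma> \<le> n" and N: "N > 0"
  defines "c \<equiv> 8 * coeff_const 1 1 n * denom_const 1 1 n * (n + 1) + 1"
  shows "\<exists>r u M. r \<le> n \<and> (\<forall>j<r. u j \<in> bohr_lattice \<Gamma> N) \<and> (\<forall>j<r. 0 \<le> M j) \<and>
    (\<forall>j<r. real_of_int (M j) * sup_norm \<Gamma> (u j) \<le> N / (4 * (real r + 1))) \<and>
    (\<forall>l. (\<Sum>j<r. psc (of_int (l j)) (u j)) = 0 \<longrightarrow> (\<forall>j<r. l j = 0)) \<and>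
    real N \<le> c ^ n * (\<Prod>j<r. 2 * real_of_int (M j) + 1)"
proof -
  interpret seminormed_lattice 1 "\<lambda>_. 1" psc "bohr_lattice \<Gamma> N" "sup_norm \<Gamma>" 1 "real N" "unit_fun ` \<Gamma>"
    by (rule seminormed_bohr_lattice[OF fin(1)])
  have cardG: "card (unit_fun ` \<Gamma> :: (nat \<Rightarrow> complex) set) \<le> n"
    using card_image_le[OF fin(1), of "unit_fun :: nat \<Rightarrow> nat \<Rightarrow> complex"] fin(3) by linarith
  define C where "C = coeff_const 1 1 (card (unit_fun ` \<Gamma> :: (nat \<Rightarrow> complex) set))"
  define K where "K = denom_const 1 1 (card (unit_fun ` \<Gamma> :: (nat \<Rightarrow> complex) set))"
  have C: "0 \<le> C" "C \<le> coeff_const 1 1 n"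
    unfolding C_def using coeff_const_mono[OF _ cardG] by (auto intro: coeff_const_nonneg)
  have K: "0 < K" "K \<le> denom_const 1 1 n"
    unfolding K_def using denom_const_dvd[OF cardG] by (auto intro: denom_const_pos dvd_imp_le)
  obtain r u where r: "r \<le> card (unit_fun ` \<Gamma> :: (nat \<Rightarrow> complex) set)"
    and u: "\<And>j. j < r \<Longrightarrow> u j \<in> bohr_lattice \<Gamma> N" "\<And>j. j < r \<Longrightarrow> 0 < sup_norm \<Gamma> (u j)"
      "\<And>j. j < r \<Longrightarrow> sup_norm \<Gamma> (u j) \<le> real N"
    and coeff: "\<And>z b j i. z \<in> bohr_lattice \<Gamma> N \<Longrightarrow>
       sup_norm \<Gamma> (z - (\<Sum>j<r. psc (int_comb 1 (\<lambda>_. 1) (b j)) (u j))) = 0 \<Longrightarrow> j < r \<Longrightarrow> i \<in> {1..1} \<Longrightarrow>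
        real_of_int \<bar>b j i\<bar> * sup_norm \<Gamma> (u j) \<le> C * sup_norm \<Gamma> z"
    and denom: "\<And>x. x \<in> bohr_lattice \<Gamma> N \<Longrightarrow> sup_norm \<Gamma> x \<le> N \<Longrightarrow>
       \<exists>b. sup_norm \<Gamma> (psc (of_nat K) x - (\<Sum>j<r. psc (int_comb 1 (\<lambda>_. 1) (b j)) (u j))) = 0"
    by (rule reduced_basis[folded C_def K_def]) blast
  have rn: "r \<le> n" using r cardG by simp
  have coeff1: "real_of_int \<bar>b j\<bar> * sup_norm \<Gamma> (u j) \<le> C * sup_norm \<Gamma> z"
    if "z \<in> bohr_lattice \<Gamma> N" "z = (\<Sum>j<r. psc (of_int (b j)) (u j))" "j < r" for z b j
    using coeff[of z "\<lambda>j _. b j" j 1] that by (simp add: int_comb_one N_0)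
  have zeroD: "x = y" if "x \<in> bohr_lattice \<Gamma> N" "y \<in> bohr_lattice \<Gamma> N" "sup_norm \<Gamma> (x - y) = 0" for x y
  proof
    fix i show "x i = y i"
    proof (cases "i \<in> \<Gamma>")
      case True
      then show ?thesis using sup_norm_ge[OF fin(1) True, of "x - y"] that(3) by simp
    next
      case False
      then show ?thesis using that by (simp add: bohr_lattice_def)
    qed
  qed
  \<comment> \<open>With these lengths a combination of all \<open>r\<close> generators stays in the
    ball of radius N/4, on which the lift to \<open>A\<close> will be additive. \<open>M j\<close>
    may be 0.\<close>
  define M where "M j = \<lfloor>N / (4 * (real r + 1) * sup_norm \<Gamma> (u j))\<rfloor>" for j
  have M0: "0 \<le> M j" if "j < r" for j
    unfolding M_def using u(2)[OF that] by simp
  have M1: "real_of_int (M j) * sup_norm \<Gamma> (u j) \<le> N / (4 * (real r + 1))" if "j < r" for j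
  proof -
    have "real_of_int (M j) * sup_norm \<Gamma> (u j) \<le> N / (4 * (real r + 1) * sup_norm \<Gamma> (u j)) * sup_norm \<Gamma> (u j)"
      unfolding M_def using u(2)[OF that] by (intro mult_right_mono) auto
    also have "\<dots> = N / (4 * (real r + 1))" using u(2)[OF that] by simp
    finally show ?thesis .
  qed
  have ind: "l j = 0" if "(\<Sum>j<r. psc (of_int (l j)) (u j)) = 0" "j < r" for l j
  proof -
    have "real_of_int \<bar>l j\<bar> * sup_norm \<Gamma> (u j) \<le> C * sup_norm \<Gamma> 0"
      by (rule coeff1[OF zero_mem that(1)[symmetric] that(2)])
    then show ?thesis using u(2)[OF that(2)] by (simp add: N_0 mult_le_0_iff)
  qed
  define y where "y x = (\<lambda>\<gamma>. if \<gamma> \<in> \<Gamma> then of_int ((int \<gamma> * int x) mod int N) else (0::complex))" for x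
  have y: "y x \<in> bohr_lattice \<Gamma> N" for x
  proof (rule bohr_latticeI[of _ _ "int x"])
    fix \<gamma> assume "\<gamma> \<in> \<Gamma>"
    then show "\<exists>k. y x \<gamma> = of_int (int \<gamma> * int x + int N * k)"
      by (intro exI[of _ "- ((int \<gamma> * int x) div int N)"]) (simp add: y_def minus_mult_div_eq_mod[symmetric])
  qed (simp add: y_def)
  have y_norm: "sup_norm \<Gamma> (y x) \<le> N" for x
  proof -
    have "cmod (y x \<gamma>) \<le> N" for \<gamma>
    proof -
      have "0 \<le> (int \<gamma> * int x) mod int N" "(int \<gamma> * int x) mod int N \<le> int N"
        using N by (simp_all add: less_imp_le)
      then have "\<bar>real_of_int ((int \<gamma> * int x) mod int N)\<bar> \<le> real N" by linarith
      then show ?thesis by (simp only: y_def norm_of_int split: if_split) simp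
    qed
    then show ?thesis by (simp add: sup_norm_le_iff[OF fin(1)])
  qed
  have "\<exists>b. psc (of_nat K) (y x) = (\<Sum>j<r. psc (of_int (b j)) (u j))" for x
  proof -
    obtain b where b: "sup_norm \<Gamma> (psc (of_nat K) (y x) - (\<Sum>j<r. psc (int_comb 1 (\<lambda>_. 1) (b j)) (u j))) = 0"
      using denom[OF y y_norm] by blast
    have "psc (of_nat K) (y x) = (\<Sum>j<r. psc (int_comb 1 (\<lambda>_. 1) (b j)) (u j))"
      by (rule zeroD[OF _ _ b]) (use y u in \<open>auto intro!: sc_mem R_nat sum_mem\<close>)
    then show ?thesis by (intro exI[of _ "\<lambda>j. b j 1"]) (simp add: int_comb_one)
  qed
  then obtain b where b: "\<And>x. psc (of_nat K) (y x) = (\<Sum>j<r. psc (of_int (b x j)) (u j))" by metis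
  define B where "B j = \<lfloor>C * (K * N) / sup_norm \<Gamma> (u j)\<rfloor>" for j
  have b_le: "\<bar>b x j\<bar> \<le> B j" if "j < r" for x j
  proof -
    have "real_of_int \<bar>b x j\<bar> * sup_norm \<Gamma> (u j) \<le> C * sup_norm \<Gamma> (psc (of_nat K) (y x))"
      by (rule coeff1[OF sc_mem[OF R_nat y] b that])
    also have "\<dots> \<le> C * (K * N)"
      using C y_norm by (intro mult_left_mono) (auto simp: N_nat[OF y] intro!: mult_left_mono)
    finally show ?thesis
      unfolding B_def using u(2)[OF that] by (simp add: le_floor_iff pos_le_divide_eq)
  qed
  have "real (card {..<N}) \<le> (\<Prod>j<r. 2 * real_of_int (B j) + 1)"
  proof (rule card_le_prod_intervals)
    show "(\<lambda>x. restrict (b x) {..<r}) \<in> {..<N} \<rightarrow> (\<Pi>\<^sub>E j\<in>{..<r}. {- B j..B j})"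
    proof
      fix x
      have "b x j \<in> {- B j..B j}" if "j < r" for j
        using b_le[OF that, of x] by (simp add: abs_le_iff minus_le_iff)
      then show "restrict (b x) {..<r} \<in> (\<Pi>\<^sub>E j\<in>{..<r}. {- B j..B j})"
        by (simp add: restrict_PiE_iff)
    qed
    show "inj_on (\<lambda>x. restrict (b x) {..<r}) {..<N}"
    proof (rule inj_onI)
      fix x x' assume x: "x \<in> {..<N}" "x' \<in> {..<N}" "restrict (b x) {..<r} = restrict (b x') {..<r}"
      then have "b x j = b x' j" if "j < r" for j using that by (metis lessThan_iff restrict_apply')
      then have "psc (of_nat K) (y x) = psc (of_nat K) (y x')" unfolding b by (intro sum.cong refl) auto
      \<comment> \<open>Frequency 1 carries \<open>x\<close> modulo \<open>N\<close> itself and so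
        separates the residues.\<close>
      then have "psc (of_nat K) (y x) 1 = psc (of_nat K) (y x') 1" by (rule fun_cong)
      then have "y x 1 = y x' 1" unfolding psc_apply using K by simp
      then have "int x mod int N = int x' mod int N" using fin(2) by (simp add: y_def)
      then show "x = x'" using x by simp
    qed
    show "0 \<le> B j" if "j < r" for j using b_le[OF that, of 0] by linarith
  qed
  also have "\<dots> \<le> (\<Prod>j<r. c * (2 * real_of_int (M j) + 1))"
  proof (rule prod_mono)
    fix j assume "j \<in> {..<r}"
    then have j: "j < r" by simp
    \<comment> \<open>\<open>B j\<close> is at most \<open>C * K * t\<close>, and \<open>t\<close>
      at most \<open>4 * (n + 1)\<close> times \<open>2 * M j + 1\<close>. This gives the 8 in
      \<open>c\<close>; the final summand 1 of \<open>c\<close> absorbs the 1 in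
      \<open>2 * B j + 1\<close>.\<close>
    define t where "t = N / sup_norm \<Gamma> (u j)"
    have t: "0 \<le> t" unfolding t_def using u(2)[OF j] by simp
    have "t / (4 * (real r + 1)) < real_of_int (M j) + 1"
      unfolding M_def t_def using floor_correct[of "N / (4 * (real r + 1) * sup_norm \<Gamma> (u j))"]
      by (simp add: mult.commute)
    then have "t \<le> (4 * (real r + 1)) * (real_of_int (M j) + 1)"
      by (simp add: divide_less_eq mult.commute)
    also have "\<dots> \<le> (4 * (n + 1)) * (2 * real_of_int (M j) + 1)"
      using M0[OF j] rn by (intro mult_mono) auto
    finally have t2: "t \<le> (4 * (n + 1)) * (2 * real_of_int (M j) + 1)" .
    have CK: "C * K \<le> coeff_const 1 1 n * denom_const 1 1 n"
      using C K by (intro mult_mono) auto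
    have "real_of_int (B j) \<le> C * K * t" unfolding B_def t_def by (simp add: mult.assoc)
    also have "\<dots> \<le> (coeff_const 1 1 n * denom_const 1 1 n) * ((4 * (n + 1)) * (2 * real_of_int (M j) + 1))"
      by (rule mult_mono[OF CK t2]) (use t coeff_const_nonneg[of 1 1 n] in auto)
    finally have "2 * real_of_int (B j)
        \<le> 2 * ((coeff_const 1 1 n * denom_const 1 1 n) * ((4 * (n + 1)) * (2 * real_of_int (M j) + 1)))"
      by simp
    also have "\<dots> = (c - 1) * (2 * real_of_int (M j) + 1)"
      unfolding c_def by (simp add: algebra_simps)
    finally have "2 * real_of_int (B j) + 1 \<le> (c - 1) * (2 * real_of_int (M j) + 1) + 1"
      by simp
    also have "\<dots> \<le> c * (2 * real_of_int (M j) + 1)"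
      using M0[OF j] by (simp add: algebra_simps)
    finally show "0 \<le> 2 * real_of_int (B j) + 1 \<and> 2 * real_of_int (B j) + 1 \<le> c * (2 * real_of_int (M j) + 1)"
      using b_le[OF j, of 0] by simp
  qed
  also have "\<dots> = c ^ r * (\<Prod>j<r. 2 * real_of_int (M j) + 1)"
    by (simp add: prod.distrib)
  also have "\<dots> \<le> c ^ n * (\<Prod>j<r. 2 * real_of_int (M j) + 1)"
  proof (intro mult_right_mono power_increasing rn prod_nonneg)
    have "0 \<le> coeff_const 1 1 n" by (rule coeff_const_nonneg) simp
    then show "1 \<le> c" by (simp add: c_def)
  qed (use M0 in auto)
  finally have "real N \<le> c ^ n * (\<Prod>j<r. 2 * real_of_int (M j) + 1)" by simp
  then show ?thesis
    by (intro exI[of _ r] exI[of _ u] exI[of _ M] conjI allI impI rn)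
       (erule u(1) M0 M1 | (erule ind, assumption) | assumption)+
qed

section \<open>Lifting progressions from the model\<close>

definition gap :: "nat \<Rightarrow> (nat \<Rightarrow> complex) \<Rightarrow> (nat \<Rightarrow> int) \<Rightarrow> complex set" where
  "gap r v M = {\<Sum>j<r. of_int (l j) * v j | l. \<forall>j<r. \<bar>l j\<bar> \<le> M j}"

lemma sum_list_mem_dil: "set xs \<subseteq> A \<Longrightarrow> sum_list xs \<in> dil (replicate (length xs) 1) A"
  by (induction xs) (auto intro: set_plus_intro)

lemma uminus_sum_list_mem_dil: "set xs \<subseteq> A \<Longrightarrow> - sum_list xs \<in> dil (replicate (length xs) (-1)) A"
  using imageI[OF sum_list_mem_dil[of xs A], of uminus] by (simp add: uminus_dil)

lemma card_le_card_dil: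
  assumes "finite A" "A \<noteq> {}" shows "card A \<le> card (dil (1 # mus) A)"
proof -
  obtain z where z: "z \<in> dil mus A" using dil_nonempty[OF assms(2)] by blast
  have "(+) z ` A \<subseteq> dil (1 # mus) A" using z by (auto simp: add.commute[of z] intro!: set_plus_intro)
  then have "card ((+) z ` A) \<le> card (dil (1 # mus) A)" by (rule card_mono[OF finite_dil[OF assms(1)]])
  then show ?thesis by (simp add: card_translate)
qed

text \<open>Bohr sets of the model lift back to \<open>2A - 2A\<close>. The lift \<open>\<psi>\<close> is injective and additive on the
  ball of radius \<open>N/4\<close> because a relation between three elements of \<open>2A - 2A\<close> has twelve terms.\<close>

lemma bohr_lift:
  fixes A :: "complex set" and g :: "complex \<Rightarrow> int" and N :: nat
  assumes A: "A \<noteq> {}" and N: "N > 0"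
    and model: "\<And>xs ys. set xs \<subseteq> A \<Longrightarrow> set ys \<subseteq> A \<Longrightarrow> length xs = 6 \<Longrightarrow> length ys = 6 \<Longrightarrow>
       int N dvd sum_list (map g xs) - sum_list (map g ys) \<longleftrightarrow> sum_list xs = sum_list ys"
    and \<Gamma>: "finite \<Gamma>" "1 \<in> \<Gamma>"
    and repr: "\<And>x::int. \<forall>\<gamma>\<in>\<Gamma>. 0 \<le> cos (2 * pi * (real \<gamma> * of_int x) / real N) \<Longrightarrow>
       \<exists>a\<in>A. \<exists>b\<in>A. \<exists>c\<in>A. \<exists>d\<in>A. int N dvd g a + g b - g c - g d - x"
  defines "U \<equiv> {y\<in>bohr_lattice \<Gamma> N. sup_norm \<Gamma> y \<le> real N / 4}"
  shows "\<exists>\<psi>. (\<forall>y\<in>U. \<psi> y \<in> dil [1, 1, -1, -1] A) \<and> inj_on \<psi> U \<and>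
     (\<forall>y\<in>U. \<forall>y'\<in>U. y + y' \<in> U \<longrightarrow> \<psi> (y + y') = \<psi> y + \<psi> y')"
proof -
  have "\<exists>q x. fst q \<in> A \<times> A \<and> snd q \<in> A \<times> A \<and> (\<forall>\<gamma>\<in>\<Gamma>. \<exists>k::int. y \<gamma> = of_int (int \<gamma> * x + int N * k)) \<and>
      int N dvd g (fst (fst q)) + g (snd (fst q)) - g (fst (snd q)) - g (snd (snd q)) - x"
    if y: "y \<in> U" for y
  proof -
    obtain x :: int where x: "\<And>\<gamma>. \<gamma> \<in> \<Gamma> \<Longrightarrow> \<exists>k::int. y \<gamma> = of_int (int \<gamma> * x + int N * k)"
      using bohr_latticeE[of y \<Gamma> N] y unfolding U_def by blast
    have "0 \<le> cos (2 * pi * (real \<gamma> * of_int x) / real N)" if \<gamma>: "\<gamma> \<in> \<Gamma>" for \<gamma>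
    proof -
      obtain k where k: "y \<gamma> = of_int (int \<gamma> * x + int N * k)" using x[OF \<gamma>] by blast
      define t where "t = real_of_int (int \<gamma> * x + int N * k)"
      have "\<bar>t\<bar> = cmod (y \<gamma>)" by (simp only: k t_def norm_of_int of_int_abs)
      also have "\<dots> \<le> real N / 4" using sup_norm_ge[OF \<Gamma>(1) \<gamma>, of y] y by (simp add: U_def)
      finally have "\<bar>t / real N\<bar> \<le> 1 / 4" using N by (simp add: field_simps)
      \<comment> \<open>The radius N/4 keeps the angle within a quarter turn, where the cosine is
        non-negative.\<close>
      then have "2 * pi * \<bar>t / real N\<bar> \<le> 2 * pi * (1 / 4)" by (intro mult_left_mono) auto
      then have "\<bar>2 * pi * (t / real N)\<bar> \<le> pi / 2" by (simp add: abs_mult)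
      then have "0 \<le> cos (2 * pi * (t / real N))"
        using cos_ge_zero[of "2 * pi * (t / real N)"] by linarith
      moreover have "t / real N = real \<gamma> * of_int x / real N + of_int k"
        using N by (simp add: t_def add_divide_distrib)
      then have "2 * pi * (t / real N) = 2 * pi * (real \<gamma> * of_int x) / real N + 2 * pi * of_int k"
        by (simp add: distrib_left)
      ultimately show ?thesis by (simp add: cos_add cos_int_2pin sin_int_2pin)
    qed
    then obtain a b c d where "a \<in> A" "b \<in> A" "c \<in> A" "d \<in> A" "int N dvd g a + g b - g c - g d - x"
      using repr by blast
    with x show ?thesis by (intro exI[of _ "((a, b), (c, d))"] exI[of _ x]) auto
  qed
  then obtain q x where qA: "\<And>y. y \<in> U \<Longrightarrow> fst (q y) \<in> A \<times> A" "\<And>y. y \<in> U \<Longrightarrow> snd (q y) \<in> A \<times> A"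
    and x: "\<And>y \<gamma>. y \<in> U \<Longrightarrow> \<gamma> \<in> \<Gamma> \<Longrightarrow> \<exists>k::int. y \<gamma> = of_int (int \<gamma> * x y + int N * k)"
    and gx: "\<And>y. y \<in> U \<Longrightarrow>
      int N dvd g (fst (fst (q y))) + g (snd (fst (q y))) - g (fst (snd (q y))) - g (snd (snd (q y))) - x y"
    by metis
  define a where "a y = fst (fst (q y))" for y
  define b where "b y = snd (fst (q y))" for y
  define c where "c y = fst (snd (q y))" for y
  define d where "d y = snd (snd (q y))" for y
  have abcd: "a y \<in> A" "b y \<in> A" "c y \<in> A" "d y \<in> A" if "y \<in> U" for y
    using qA[OF that] by (auto simp: a_def b_def c_def d_def mem_Times_iff)
  have g: "int N dvd g (a y) + g (b y) - g (c y) - g (d y) - x y" if "y \<in> U" for y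
    using gx[OF that] by (simp add: a_def b_def c_def d_def)
  define \<psi> where "\<psi> y = a y + b y - c y - d y" for y
  have "\<psi> y \<in> dil [1, 1, -1, -1] A" if "y \<in> U" for y
  proof -
    have "sum_list [a y, b y] + - sum_list [c y, d y]
        \<in> dil (replicate (length [a y, b y]) 1) A + dil (replicate (length [c y, d y]) (-1)) A"
      using abcd[OF that] by (intro set_plus_intro sum_list_mem_dil uminus_sum_list_mem_dil) auto
    then show ?thesis by (simp add: \<psi>_def numeral_2_eq_2 add.assoc algebra_simps)
  qed
  moreover have "inj_on \<psi> U"
  proof (rule inj_onI)
    fix y y' assume y: "y \<in> U" "y' \<in> U" and eq: "\<psi> y = \<psi> y'"
    \<comment> \<open>A relation of four against four terms, padded by two copies of
      \<open>a y\<close> on either side to the length six that the model controls.\<close>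
    have "int N dvd sum_list (map g [a y, b y, c y', d y', a y, a y]) - sum_list (map g [c y, d y, a y', b y', a y, a y])"
      by (rule model[THEN iffD2]) (use abcd y eq in \<open>auto simp: \<psi>_def algebra_simps\<close>)
    then have "int N dvd (g (a y) + g (b y) - g (c y) - g (d y)) - (g (a y') + g (b y') - g (c y') - g (d y'))"
      by (simp add: algebra_simps)
    from dvd_diff[OF this dvd_diff[OF g[OF y(1)] g[OF y(2)]]] have xx: "int N dvd x y - x y'"
      by (simp add: algebra_simps)
    show "y = y'"
    proof
      fix \<gamma>
      show "y \<gamma> = y' \<gamma>"
      proof (cases "\<gamma> \<in> \<Gamma>")
        case True
        obtain k k' :: int where k: "y \<gamma> = of_int (int \<gamma> * x y + int N * k)" "y' \<gamma> = of_int (int \<gamma> * x y' + int N * k')"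
          using x[OF y(1) True] x[OF y(2) True] by blast
        \<comment> \<open>Two integers within N/4 of 0 that agree modulo \<open>N\<close>
          coincide.\<close>
        define t where "t = (int \<gamma> * x y + int N * k) - (int \<gamma> * x y' + int N * k')"
        have t: "y \<gamma> - y' \<gamma> = of_int t" by (simp only: k t_def of_int_diff)
        have "t = int \<gamma> * (x y - x y') + int N * (k - k')" by (simp add: t_def algebra_simps)
        then have "int N dvd t" using xx by simp
        have "\<bar>real_of_int t\<bar> = cmod (y \<gamma> - y' \<gamma>)" unfolding t by simp
        also have "\<dots> \<le> cmod (y \<gamma>) + cmod (y' \<gamma>)" by (rule norm_triangle_ineq4)
        also have "\<dots> \<le> real N / 4 + real N / 4"
          using y sup_norm_ge[OF \<Gamma>(1) True, of y] sup_norm_ge[OF \<Gamma>(1) True, of y']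
          by (intro add_mono) (auto simp: U_def)
        also have "\<dots> < N" using N by simp
        finally have "\<bar>t\<bar> < int N" by linarith
        with \<open>int N dvd t\<close> have "t = 0" using zdvd_not_zless[of "\<bar>t\<bar>" "int N"] by auto
        then show ?thesis using t by simp
      next
        case False
        then show ?thesis using y bohr_lattice_outside[of y \<Gamma> N \<gamma>] bohr_lattice_outside[of y' \<Gamma> N \<gamma>]
            by (simp add: U_def)
      qed
    qed
  qed
  moreover have "\<psi> (y + y') = \<psi> y + \<psi> y'" if y: "y \<in> U" "y' \<in> U" "y + y' \<in> U" for y y'
  proof -
    obtain k k' k'' :: int where "y 1 = of_int (int 1 * x y + int N * k)" "y' 1 = of_int (int 1 * x y' + int N * k')"
      "(y + y') 1 = of_int (int 1 * x (y + y') + int N * k'')"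
      using x[OF y(1) \<Gamma>(2)] x[OF y(2) \<Gamma>(2)] x[OF y(3) \<Gamma>(2)] by blast
    then have "complex_of_int (x y + x y' - x (y + y')) = of_int (int N * (k'' - k - k'))"
      by (simp add: algebra_simps)
    then have "x y + x y' - x (y + y') = int N * (k'' - k - k')" by (simp only: of_int_eq_iff)
    then have "int N dvd x y + x y' - x (y + y')" by simp
    from dvd_add[OF this dvd_diff[OF dvd_add[OF g[OF y(1)] g[OF y(2)]] g[OF y(3)]]]
    have "int N dvd sum_list (map g [a y, b y, a y', b y', c (y + y'), d (y + y')])
        - sum_list (map g [c y, d y, c y', d y', a (y + y'), b (y + y')])"
      by (simp add: algebra_simps)
    then have "sum_list [a y, b y, a y', b y', c (y + y'), d (y + y')]
        = sum_list [c y, d y, c y', d y', a (y + y'), b (y + y')]"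
      by (rule model[THEN iffD1, rotated 4]) (use abcd y in auto)
    then show ?thesis by (simp add: \<psi>_def algebra_simps)
  qed
  ultimately show ?thesis by blast
qed

lemma sum_psc_mem_bohr_lattice:
  assumes "finite \<Gamma>" "\<And>j. j < r \<Longrightarrow> u j \<in> bohr_lattice \<Gamma> N"
  shows "(\<Sum>j<r. psc (of_int (l j)) (u j)) \<in> bohr_lattice \<Gamma> N"
    and "sup_norm \<Gamma> (\<Sum>j<r. psc (of_int (l j)) (u j)) \<le> (\<Sum>j<r. real_of_int \<bar>l j\<bar> * sup_norm \<Gamma> (u j))"
proof -
  interpret seminormed_lattice 1 "\<lambda>_. 1" psc "bohr_lattice \<Gamma> N" "sup_norm \<Gamma>" 1 0 "unit_fun ` \<Gamma>"
    by (rule seminormed_bohr_lattice[OF assms(1)])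
  have mem: "psc (of_int (l j)) (u j) \<in> bohr_lattice \<Gamma> N" if "j < r" for j
    by (rule sc_mem[OF R_int assms(2)[OF that]])
  show "(\<Sum>j<r. psc (of_int (l j)) (u j)) \<in> bohr_lattice \<Gamma> N"
    by (rule sum_mem) (use mem in simp)
  have "sup_norm \<Gamma> (\<Sum>j<r. psc (of_int (l j)) (u j)) \<le> (\<Sum>j<r. sup_norm \<Gamma> (psc (of_int (l j)) (u j)))"
    by (rule N_sum) (use mem in simp)
  also have "\<dots> = (\<Sum>j<r. real_of_int \<bar>l j\<bar> * sup_norm \<Gamma> (u j))"
    by (simp add: sup_norm_psc[OF assms(1)])
  finally show "sup_norm \<Gamma> (\<Sum>j<r. psc (of_int (l j)) (u j)) \<le> (\<Sum>j<r. real_of_int \<bar>l j\<bar> * sup_norm \<Gamma> (u j))" .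
qed

text \<open>\<open>\<psi>\<close> is additive only as long as the sum stays in \<open>U\<close>.
  Every partial sum of an admissible combination is again admissible, with zero coefficients
  inserted, so the combination can be built up inside \<open>U\<close> one step at a time.\<close>

lemma progression_lift:
  fixes u :: "nat \<Rightarrow> nat \<Rightarrow> complex" and M :: "nat \<Rightarrow> int" and N r :: nat
  assumes \<Gamma>: "finite \<Gamma>"
  defines "U \<equiv> {y\<in>bohr_lattice \<Gamma> N. sup_norm \<Gamma> y \<le> real N / 4}"
  assumes u: "\<And>j. j < r \<Longrightarrow> u j \<in> bohr_lattice \<Gamma> N"
    and M: "\<And>j. j < r \<Longrightarrow> real_of_int (M j) * sup_norm \<Gamma> (u j) \<le> N / (4 * (real r + 1))"
    and add: "\<And>y y'. y \<in> U \<Longrightarrow> y' \<in> U \<Longrightarrow> y + y' \<in> U \<Longrightarrow> \<psi> (y + y') = \<psi> y + (\<psi> y' :: complex)"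
    and l: "\<And>j. j < r \<Longrightarrow> \<bar>l j\<bar> \<le> M j"
  shows "(\<Sum>j<r. psc (of_int (l j)) (u j)) \<in> U"
    and "\<psi> (\<Sum>j<r. psc (of_int (l j)) (u j)) = (\<Sum>j<r. of_int (l j) * \<psi> (u j))"
proof -
  have U: "(\<Sum>j<r. psc (of_int (k j)) (u j)) \<in> U" if k: "\<And>j. j < r \<Longrightarrow> \<bar>k j\<bar> \<le> M j" for k
  proof -
    have "sup_norm \<Gamma> (\<Sum>j<r. psc (of_int (k j)) (u j)) \<le> (\<Sum>j<r. real_of_int \<bar>k j\<bar> * sup_norm \<Gamma> (u j))"
      by (rule sum_psc_mem_bohr_lattice[OF \<Gamma> u])
    also have "\<dots> \<le> (\<Sum>j<r. real N / (4 * (real r + 1)))"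
    proof (rule sum_mono)
      fix j assume j: "j \<in> {..<r}"
      have "real_of_int \<bar>k j\<bar> * sup_norm \<Gamma> (u j) \<le> real_of_int (M j) * sup_norm \<Gamma> (u j)"
        using k j sup_norm_nonneg[OF \<Gamma>] by (intro mult_right_mono) (auto simp del: of_int_abs)
      then show "real_of_int \<bar>k j\<bar> * sup_norm \<Gamma> (u j) \<le> real N / (4 * (real r + 1))"
        using M[of j] j by simp
    qed
    also have "\<dots> = real r / (real r + 1) * (real N / 4)" by simp
    also have "\<dots> \<le> 1 * (real N / 4)" by (intro mult_right_mono) auto
    finally show ?thesis using sum_psc_mem_bohr_lattice(1)[OF \<Gamma> u] by (simp add: U_def)
  qed
  show "(\<Sum>j<r. psc (of_int (l j)) (u j)) \<in> U" using l by (rule U)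
  have single: "psc (of_int k) (u j) \<in> U" if "j < r" "\<bar>k\<bar> \<le> M j" for k j
  proof -
    have "(\<Sum>i<r. psc (of_int (if i = j then k else 0)) (u i)) \<in> U"
    proof (rule U)
      fix i assume i: "i < r"
      have "0 \<le> M i" using l[OF i] by linarith
      then show "\<bar>if i = j then k else 0\<bar> \<le> M i" using that by simp
    qed
    moreover have "(\<Sum>i<r. psc (of_int (if i = j then k else 0)) (u i)) = psc (of_int k) (u j)"
    proof
      fix x
      have "(\<Sum>i<r. of_int (if i = j then k else 0) * u i x) = of_int k * u j x"
        using that(1) by (simp add: if_distrib[of of_int] if_distrib[of "\<lambda>t. t * _"] cong: if_cong)
      then show "(\<Sum>i<r. psc (of_int (if i = j then k else 0)) (u i)) x = psc (of_int k) (u j) x" by simp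
    qed
    ultimately show ?thesis by simp
  qed
  have zero: "0 \<in> U" using U[of "\<lambda>_. 0"] l by (force simp: psc_def zero_fun_def[symmetric])
  then have \<psi>0: "\<psi> 0 = 0" using add[of 0 0] by simp
  have nat: "\<psi> (psc (of_int (int k)) (u j)) = of_int (int k) * \<psi> (u j)" if "j < r" "int k \<le> M j" for k j
    using that
  proof (induction k)
    case 0
    have "psc (of_int (int 0)) (u j) = 0" by (simp add: fun_eq_iff)
    then show ?case by (simp only: \<psi>0) simp
  next
    case (Suc k)
    have eq: "psc (of_int (int (Suc k))) (u j) = psc (of_int (int k)) (u j) + u j"
      by (simp add: fun_eq_iff algebra_simps)
    have "u j = psc (of_int 1) (u j)" by (simp add: fun_eq_iff)
    then have "u j \<in> U" using single[of j 1] Suc.prems by simp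
    then have "\<psi> (psc (of_int (int (Suc k))) (u j)) = \<psi> (psc (of_int (int k)) (u j)) + \<psi> (u j)"
      using single[of j "int k"] single[of j "int (Suc k)"] Suc.prems
      unfolding eq by (intro add) auto
    also have "\<dots> = of_int (int k) * \<psi> (u j) + \<psi> (u j)"
      by (subst Suc.IH) (use Suc.prems in auto)
    also have "\<dots> = of_int (int (Suc k)) * \<psi> (u j)" by (simp add: algebra_simps)
    finally show ?case .
  qed
  have int: "\<psi> (psc (of_int k) (u j)) = of_int k * \<psi> (u j)" if "j < r" "\<bar>k\<bar> \<le> M j" for k j
  proof (cases "k \<ge> 0")
    case True
    then show ?thesis using nat[of j "nat k"] that by simp
  next
    case False
    have "psc (of_int k) (u j) + psc (of_int (- k)) (u j) = 0" by (simp add: fun_eq_iff)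
    then have "\<psi> (psc (of_int k) (u j)) + \<psi> (psc (of_int (- k)) (u j)) = 0"
      using add[of "psc (of_int k) (u j)" "psc (of_int (- k)) (u j)"] single[of j k] single[of j "- k"] that zero \<psi>0
      by simp
    moreover have "\<psi> (psc (of_int (- k)) (u j)) = of_int (- k) * \<psi> (u j)"
      using nat[of j "nat (- k)"] that False by simp
    ultimately show ?thesis by (simp add: add_eq_0_iff)
  qed
  have "\<psi> (\<Sum>j<r'. psc (of_int (l j)) (u j)) = (\<Sum>j<r'. of_int (l j) * \<psi> (u j))" if "r' \<le> r" for r'
    using that
  proof (induction r')
    case 0
    show ?case by (simp only: lessThan_0 sum.empty \<psi>0)
  next
    case (Suc r')
    have partial: "(\<Sum>j<t. psc (of_int (l j)) (u j)) \<in> U" if "t \<le> r" for t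
    proof -
      have "(\<Sum>j<r. psc (of_int (if j < t then l j else 0)) (u j)) \<in> U"
      proof (rule U)
        fix i assume i: "i < r"
        then show "\<bar>if i < t then l i else 0\<bar> \<le> M i" using l[OF i] by auto
      qed
      also have "(\<Sum>j<r. psc (of_int (if j < t then l j else 0)) (u j)) = (\<Sum>j<t. psc (of_int (l j)) (u j))"
        using that by (intro sum.mono_neutral_cong_right) (auto simp: fun_eq_iff)
      finally show ?thesis .
    qed
    have "\<psi> ((\<Sum>j<r'. psc (of_int (l j)) (u j)) + psc (of_int (l r')) (u r'))
        = \<psi> (\<Sum>j<r'. psc (of_int (l j)) (u j)) + \<psi> (psc (of_int (l r')) (u r'))"
      using partial[of r'] partial[of "Suc r'"] single[of r' "l r'"] l[of r'] Suc.prems by (intro add) auto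
    moreover have "\<psi> (\<Sum>j<r'. psc (of_int (l j)) (u j)) = (\<Sum>j<r'. of_int (l j) * \<psi> (u j))"
      using Suc.prems by (intro Suc.IH) auto
    moreover have "\<psi> (psc (of_int (l r')) (u r')) = of_int (l r') * \<psi> (u r')"
      using Suc.prems l[of r'] by (intro int) auto
    ultimately show ?case by (simp only: sum.lessThan_Suc)
  qed
  then show "\<psi> (\<Sum>j<r. psc (of_int (l j)) (u j)) = (\<Sum>j<r. of_int (l j) * \<psi> (u j))" by simp
qed

lemma card_gap_ge:
  fixes M :: "nat \<Rightarrow> int" and r :: nat
  assumes inj: "\<And>l l'. \<forall>j<r. \<bar>l j\<bar> \<le> M j \<Longrightarrow> \<forall>j<r. \<bar>l' j\<bar> \<le> M j \<Longrightarrow>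
      (\<Sum>j<r. of_int (l j) * v j) = (\<Sum>j<r. of_int (l' j) * v j) \<Longrightarrow> \<forall>j<r. l j = l' j"
    and M: "\<And>j. j < r \<Longrightarrow> 0 \<le> M j" and fin: "finite (gap r v M)"
  shows "(\<Prod>j<r. 2 * real_of_int (M j) + 1) \<le> real (card (gap r v M))"
proof -
  let ?B = "\<Pi>\<^sub>E j\<in>{..<r}. {- M j..M j}"
  have abs: "\<forall>j<r. \<bar>l j\<bar> \<le> M j" if "l \<in> ?B" for l
    using that by (auto simp: PiE_iff abs_le_iff minus_le_iff)
  have "inj_on (\<lambda>l. \<Sum>j<r. of_int (l j) * v j) ?B"
  proof (rule inj_onI)
    fix l l' assume *: "l \<in> ?B" "l' \<in> ?B" "(\<Sum>j<r. of_int (l j) * v j) = (\<Sum>j<r. of_int (l' j) * v j)"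
    show "l = l'"
      using * inj[OF abs[OF *(1)] abs[OF *(2)] *(3)] by (intro PiE_ext[of l "{..<r}" _ l']) auto
  qed
  then have "card ?B \<le> card (gap r v M)"
    by (rule card_inj_on_le) (use abs fin in \<open>auto simp: gap_def\<close>)
  moreover have "real (card ?B) = (\<Prod>j<r. real (card {- M j..M j}))" by (simp add: card_PiE)
  moreover have "\<dots> = (\<Prod>j<r. 2 * real_of_int (M j) + 1)" using M by (intro prod.cong refl) auto
  ultimately show ?thesis by linarith
qed

text \<open>The modulus \<open>N\<close> is the size of 6A - 6A, and the model keeps a sixth of
  \<open>A\<close>. The progression found in the Bohr set lifts injectively to 2A - 2A and has at
  least a fixed share of \<open>N\<close> elements, hence of |A|.\<close>

theorem bogolyubov_ruzsa:
  fixes C :: real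
  shows "\<exists>(n::nat) (c::real). \<forall>A. finite A \<longrightarrow> A \<noteq> {} \<longrightarrow>
    real (card (dil (replicate 6 1 @ replicate 6 (-1)) A)) \<le> C * card A \<longrightarrow>
    (\<exists>r v M. r \<le> n \<and> (\<forall>j<r. 0 \<le> M j) \<and> gap r v M \<subseteq> dil [1, 1, -1, -1] A \<and>
       real (card A) \<le> c * card (gap r v M))"
proof -
  \<comment> \<open>As \<open>N\<close> is at most 6C times the size of the modelled part A', the at
    most 2N^2/|A'|^2 frequencies from \<open>bogolyubov\<close> number at most 72 C^2; one more
    place is for the frequency 1.\<close>
  define n where "n = nat \<lceil>72 * C\<^sup>2\<rceil> + 1"
  define c where "c = (8 * coeff_const 1 1 n * denom_const 1 1 n * (n + 1) + 1) ^ n"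
  have c0: "0 \<le> c" unfolding c_def using coeff_const_nonneg[of 1 1 n] by simp
  have "\<exists>r v M. r \<le> n \<and> (\<forall>j<r. 0 \<le> M j) \<and> gap r v M \<subseteq> dil [1, 1, -1, -1] A \<and>
       real (card A) \<le> c * card (gap r v M)"
    if A: "finite A" "A \<noteq> {}" and C: "real (card (dil (replicate 6 1 @ replicate 6 (-1)) A)) \<le> C * card A"
    for A :: "complex set"
  proof -
    define D where "D = dil (replicate 6 1 @ replicate 6 (-1)) A"
    define N where "N = card D"
    have AN: "card A \<le> N"
      using card_le_card_dil[OF A, of "replicate 5 1 @ replicate 6 (-1)"]
      by (simp add: N_def D_def numeral_eq_Suc)
    have cA: "card A > 0" using A by (simp add: card_gt_0_iff)
    then have N: "N > 0" using AN by simp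
    let ?D = "{sum_list xs - sum_list ys | xs ys. set xs \<subseteq> A \<and> set ys \<subseteq> A \<and> length xs = 6 \<and> length ys = 6}"
    have D: "?D \<subseteq> D"
    proof
      fix z assume "z \<in> ?D"
      then obtain xs ys where z: "z = sum_list xs + - sum_list ys" and xy: "set xs \<subseteq> A" "set ys \<subseteq> A" "length xs = 6" "length ys = 6"
        by auto
      show "z \<in> D" unfolding z D_def dil_append
        using sum_list_mem_dil[OF xy(1)] uminus_sum_list_mem_dil[OF xy(2)] unfolding xy(3,4) by (rule set_plus_intro)
    qed
    have finD: "finite D" unfolding D_def by (rule finite_dil[OF A(1)])
    have "\<exists>A' g. A' \<subseteq> A \<and> card A \<le> 6 * card A' \<and>
      (\<forall>xs ys. set xs \<subseteq> A' \<longrightarrow> set ys \<subseteq> A' \<longrightarrow> length xs = 6 \<longrightarrow> length ys = 6 \<longrightarrow>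
         (int N dvd sum_list (map g xs) - sum_list (map g ys) \<longleftrightarrow> sum_list xs = sum_list ys))"
      unfolding N_def by (rule ruzsa_model[OF A _ finite_subset[OF D finD] card_mono[OF finD D]]) simp
    then obtain A' g where A': "A' \<subseteq> A" "card A \<le> 6 * card A'"
      and model: "\<And>xs ys. set xs \<subseteq> A' \<Longrightarrow> set ys \<subseteq> A' \<Longrightarrow> length xs = 6 \<Longrightarrow> length ys = 6 \<Longrightarrow>
         int N dvd sum_list (map g xs) - sum_list (map g ys) \<longleftrightarrow> sum_list xs = sum_list ys"
      by blast
    have finA': "finite A'" using A' A by (blast intro: finite_subset)
    have cA': "card A' > 0" using A'(2) cA by simp
    then have neA': "A' \<noteq> {}" by auto
    have inj: "a = b" if "a \<in> A'" "b \<in> A'" "int N dvd g a - g b" for a b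
      using model[of "[a, a, a, a, a, a]" "[b, a, a, a, a, a]"] that by simp
    have "\<exists>\<Gamma>\<subseteq>{..<N}. card \<Gamma> * (card A')\<^sup>2 \<le> 2 * N\<^sup>2 \<and>
      (\<forall>x::int. (\<forall>\<gamma>\<in>\<Gamma>. 0 \<le> cos (2 * pi * (real \<gamma> * of_int x) / N)) \<longrightarrow>
         (\<exists>a\<in>A'. \<exists>b\<in>A'. \<exists>c\<in>A'. \<exists>d\<in>A'. int N dvd g a + g b - g c - g d - x))"
      by (rule bogolyubov[OF finA' neA' N]) (rule inj)
    then obtain \<Gamma> where \<Gamma>0: "\<Gamma> \<subseteq> {..<N} \<and> card \<Gamma> * (card A')\<^sup>2 \<le> 2 * N\<^sup>2 \<and>
      (\<forall>x::int. (\<forall>\<gamma>\<in>\<Gamma>. 0 \<le> cos (2 * pi * (real \<gamma> * of_int x) / N)) \<longrightarrow>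
         (\<exists>a\<in>A'. \<exists>b\<in>A'. \<exists>c\<in>A'. \<exists>d\<in>A'. int N dvd g a + g b - g c - g d - x))" by (rule exE)
    note \<Gamma> = \<Gamma>0[THEN conjunct1] \<Gamma>0[THEN conjunct2, THEN conjunct1]
    note repr = \<Gamma>0[THEN conjunct2, THEN conjunct2]
    define \<Delta> where "\<Delta> = insert 1 \<Gamma>"
    have fin\<Gamma>: "finite \<Gamma>" using \<Gamma>(1) by (blast intro: finite_subset)
    then have \<Delta>: "finite \<Delta>" "1 \<in> \<Delta>" by (auto simp: \<Delta>_def)
    have "real N \<le> C * card A" using C by (simp add: N_def D_def)
    also have "\<dots> \<le> C * (6 * card A')"
    proof -
      have "0 \<le> C"
      proof (rule ccontr)
        assume "\<not> 0 \<le> C"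
        then have "C * card A < 0" using cA by (simp add: mult_less_0_iff)
        with \<open>real N \<le> C * card A\<close> show False by simp
      qed
      moreover have "real (card A) \<le> 6 * real (card A')" using A'(2) by linarith
      ultimately show ?thesis by (simp add: mult_left_mono)
    qed
    finally have NC: "real N \<le> 6 * C * card A'" by simp
    have "real (card \<Gamma>) * (real (card A'))\<^sup>2 \<le> 2 * (real N)\<^sup>2"
      using \<Gamma>(2) by (metis (mono_tags, lifting) of_nat_le_iff of_nat_mult of_nat_numeral of_nat_power)
    also have "\<dots> \<le> 2 * (6 * C * card A')\<^sup>2" using NC by (intro mult_left_mono power_mono) auto
    finally have "real (card \<Gamma>) * (real (card A'))\<^sup>2 \<le> (72 * C\<^sup>2) * (real (card A'))\<^sup>2"
      by (simp add: power_mult_distrib)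
    then have "real (card \<Gamma>) \<le> 72 * C\<^sup>2" using cA' by simp
    then have card\<Delta>: "card \<Delta> \<le> n"
      unfolding \<Delta>_def n_def using card_insert_le_m1[of _ 1 \<Gamma>] fin\<Gamma> by (simp add: card_insert_if) linarith
    have repr': "\<exists>a\<in>A'. \<exists>b\<in>A'. \<exists>c\<in>A'. \<exists>d\<in>A'. int N dvd g a + g b - g c - g d - x"
      if "\<forall>\<gamma>\<in>\<Delta>. 0 \<le> cos (2 * pi * (real \<gamma> * of_int x) / N)" for x :: int
      using that by (intro repr[rule_format]) (simp add: \<Delta>_def)
    define U where "U = {y\<in>bohr_lattice \<Delta> N. sup_norm \<Delta> y \<le> real N / 4}"
    have "\<exists>\<psi>. (\<forall>y\<in>U. \<psi> y \<in> dil [1, 1, -1, -1] A') \<and> inj_on \<psi> U \<and>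
        (\<forall>y\<in>U. \<forall>y'\<in>U. y + y' \<in> U \<longrightarrow> \<psi> (y + y') = \<psi> y + \<psi> y')"
      unfolding U_def by (rule bohr_lift[OF neA' N _ \<Delta>]) (rule model repr', assumption+)+
    then obtain \<psi> where \<psi>0: "(\<forall>y\<in>U. \<psi> y \<in> dil [1, 1, -1, -1] A') \<and> inj_on \<psi> U \<and>
        (\<forall>y\<in>U. \<forall>y'\<in>U. y + y' \<in> U \<longrightarrow> \<psi> (y + y') = \<psi> y + \<psi> y')" by (rule exE)
    note \<psi> = \<psi>0[THEN conjunct1] and inj\<psi> = \<psi>0[THEN conjunct2, THEN conjunct1]
      and add = \<psi>0[THEN conjunct2, THEN conjunct2]
    obtain r u M where prog: "r \<le> n \<and> (\<forall>j<r. u j \<in> bohr_lattice \<Delta> N) \<and> (\<forall>j<r. 0 \<le> M j) \<and>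
      (\<forall>j<r. real_of_int (M j) * sup_norm \<Delta> (u j) \<le> N / (4 * (real r + 1))) \<and>
      (\<forall>l. (\<Sum>j<r. psc (of_int (l j)) (u j)) = 0 \<longrightarrow> (\<forall>j<r. l j = 0)) \<and>
      real N \<le> c * (\<Prod>j<r. 2 * real_of_int (M j) + 1)"
      using bohr_progression[OF \<Delta> card\<Delta> N, folded c_def] by (elim exE)
    then have r: "r \<le> n" and u: "\<forall>j<r. u j \<in> bohr_lattice \<Delta> N" and M: "\<forall>j<r. 0 \<le> M j"
      "\<forall>j<r. real_of_int (M j) * sup_norm \<Delta> (u j) \<le> N / (4 * (real r + 1))"
      and ind: "\<forall>l. (\<Sum>j<r. psc (of_int (l j)) (u j)) = 0 \<longrightarrow> (\<forall>j<r. l j = 0)"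
      and size: "real N \<le> c * (\<Prod>j<r. 2 * real_of_int (M j) + 1)" by simp_all
    note lift = progression_lift[OF \<Delta>(1), of r u N M \<psi>, folded U_def]
    define v where "v j = \<psi> (u j)" for j
    have lift1: "(\<Sum>j<r. psc (of_int (l j)) (u j)) \<in> U"
      and lift2: "\<psi> (\<Sum>j<r. psc (of_int (l j)) (u j)) = (\<Sum>j<r. of_int (l j) * v j)"
      if "\<forall>j<r. \<bar>l j\<bar> \<le> M j" for l
      unfolding v_def by (rule lift; use u M add that in simp)+
    have sub: "gap r v M \<subseteq> dil [1, 1, -1, -1] A"
    proof
      fix z assume "z \<in> gap r v M"
      then obtain l where l: "\<forall>j<r. \<bar>l j\<bar> \<le> M j" "z = (\<Sum>j<r. of_int (l j) * v j)"
        unfolding gap_def by blast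
      then have "z \<in> dil [1, 1, -1, -1] A'"
        using \<psi> lift1[OF l(1)] lift2[OF l(1)] by metis
      then show "z \<in> dil [1, 1, -1, -1] A" using dil_mono[OF A'(1)] by blast
    qed
    have "(\<Prod>j<r. 2 * real_of_int (M j) + 1) \<le> real (card (gap r v M))"
    proof (rule card_gap_ge)
      fix l l' assume l: "\<forall>j<r. \<bar>l j\<bar> \<le> M j" "\<forall>j<r. \<bar>l' j\<bar> \<le> M j"
        and eq: "(\<Sum>j<r. of_int (l j) * v j) = (\<Sum>j<r. of_int (l' j) * v j)"
      have "(\<Sum>j<r. psc (of_int (l j)) (u j)) = (\<Sum>j<r. psc (of_int (l' j)) (u j))"
        using eq lift2[OF l(1)] lift2[OF l(2)] by (intro inj_onD[OF inj\<psi> _ lift1[OF l(1)] lift1[OF l(2)]]) simp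
      then have "(\<Sum>j<r. psc (of_int (l j - l' j)) (u j)) = 0"
        by (simp add: fun_eq_iff left_diff_distrib sum_subtractf)
      then show "\<forall>j<r. l j = l' j" using ind[rule_format, of "\<lambda>j. l j - l' j"] by auto
    next
      show "finite (gap r v M)" using sub finite_dil[OF A(1)] by (rule finite_subset)
    qed (use M in auto)
    then have "real N \<le> c * card (gap r v M)" using size c0 by (meson mult_left_mono order_trans)
    then have "real (card A) \<le> c * card (gap r v M)" using AN by linarith
    with r M sub show ?thesis by blast
  qed
  then show ?thesis by blast
qed

section \<open>Algebraic integers\<close>

interpretation intspan: Modules.module "\<lambda>(k::int) (x::complex). of_int k * x"
  by standard (simp_all add: algebra_simps)

text \<open>Determinant trick: multiplication by \<open>x\<close> acts on \<open>G\<close> through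
  an integer matrix, with the list of elements of \<open>G\<close> as eigenvector, non-zero because
  of \<open>g\<close>. So \<open>x\<close> is a root of a monic characteristic polynomial with
  integer coefficients.\<close>

lemma algebraic_int_if_stable:
  fixes x :: complex
  assumes G: "finite G" and g: "g \<in> G" "g \<noteq> 0" and stable: "\<And>h. h \<in> G \<Longrightarrow> x * h \<in> intspan.span G"
  shows "algebraic_int x"
proof -
  define n where "n = card G"
  obtain f where f: "bij_betw f {0..<n} G" unfolding n_def using ex_bij_betw_nat_finite[OF G] by blast
  have inj: "inj_on f {0..<n}" and im: "f ` {0..<n} = G" using f by (auto simp: bij_betw_def)
  have "\<exists>a. x * f i = (\<Sum>j\<in>{0..<n}. of_int (a j) * f j)" if "i < n" for i
  proof -
    have "x * f i \<in> intspan.span G" using that im by (intro stable) auto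
    then obtain u :: "complex \<Rightarrow> int" where "x * f i = (\<Sum>h\<in>G. of_int (u h) * h)"
      unfolding intspan.span_finite[OF G] by blast
    also have "\<dots> = (\<Sum>j\<in>{0..<n}. of_int (u (f j)) * f j)"
      unfolding im[symmetric] by (simp add: sum.reindex[OF inj])
    finally show ?thesis by (intro exI[of _ "\<lambda>j. u (f j)"])
  qed
  then obtain a where a: "\<And>i. i < n \<Longrightarrow> x * f i = (\<Sum>j\<in>{0..<n}. of_int (a i j) * f j)" by metis
  define A :: "int mat" where "A = mat n n (\<lambda>(i, j). a i j)"
  define B :: "complex mat" where "B = map_mat of_int A"
  define v where "v = vec n f"
  have A: "A \<in> carrier_mat n n" and B: "B \<in> carrier_mat n n" by (simp_all add: A_def B_def)
  have "B *\<^sub>v v = x \<cdot>\<^sub>v v"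
    by (rule eq_vecI) (use a in \<open>auto simp: A_def B_def v_def scalar_prod_def\<close>)
  moreover have "v \<noteq> 0\<^sub>v n"
  proof
    assume v0: "v = 0\<^sub>v n"
    obtain i where i: "i < n" "g = f i" using g im by auto
    then have "f i = v $ i" by (simp add: v_def)
    then show False using i g v0 by simp
  qed
  ultimately have "eigenvalue B x"
    unfolding eigenvalue_def eigenvector_def using B by (intro exI[of _ v]) (auto simp: v_def)
  then have "poly (char_poly B) x = 0" using eigenvalue_root_char_poly[OF B] by simp
  moreover have "char_poly B = map_poly of_int (char_poly A)"
    unfolding B_def by (rule of_int_hom.char_poly_hom[OF A])
  moreover have "lead_coeff (char_poly B) = 1" using degree_monic_char_poly[OF B] by simp
  ultimately show ?thesis
    by (intro algebraic_int.intros[of "char_poly B"]) (auto simp: coeff_map_poly)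
qed

definition powers :: "complex \<Rightarrow> nat \<Rightarrow> complex set" where
  "powers x n = (\<lambda>i. x ^ i) ` {..<n}"

lemma algebraic_int_imp_power:
  assumes "algebraic_int x"
  obtains n where "n > 0" "x ^ n \<in> intspan.span (powers x n)"
  using assms
proof cases
  case (1 p)
  define n where "n = degree p"
  have n: "n > 0"
  proof (rule ccontr)
    assume "\<not> n > 0"
    then have "p = [:lead_coeff p:]" by (metis n_def degree_0_id neq0_conv of_nat_0_less_iff)
    with 1 show False by (metis mult_zero_right poly_const_conv zero_neq_one)
  qed
  have "\<forall>i. \<exists>k::int. coeff p i = of_int k" using 1 by (meson Ints_cases)
  then obtain k :: "nat \<Rightarrow> int" where k: "\<And>i. coeff p i = of_int (k i)" by metis
  have "0 = (\<Sum>i\<le>n. coeff p i * x ^ i)" using 1 by (simp add: poly_altdef n_def)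
  also have "\<dots> = x ^ n + (\<Sum>i<n. coeff p i * x ^ i)"
    using 1 by (simp add: n_def lessThan_Suc_atMost[symmetric])
  finally have "x ^ n = - (\<Sum>i<n. of_int (k i) * x ^ i)" by (simp add: k eq_neg_iff_add_eq_0)
  also have "\<dots> \<in> intspan.span (powers x n)"
    by (intro intspan.span_neg intspan.span_sum intspan.span_scale intspan.span_base) (auto simp: powers_def)
  finally show ?thesis using n that by blast
qed

lemma power_imp_algebraic_int:
  assumes "n > 0" "x ^ n \<in> intspan.span (powers x n)"
  shows "algebraic_int x"
proof (rule algebraic_int_if_stable[of "powers x n" 1])
  show "1 \<in> powers x n" using assms(1) by (force simp: powers_def intro: image_eqI[of _ _ 0])
  fix h assume "h \<in> powers x n"
  then obtain i where i: "i < n" "h = x ^ i" by (auto simp: powers_def)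
  show "x * h \<in> intspan.span (powers x n)"
  proof (cases "Suc i < n")
    case True
    then have "x ^ Suc i \<in> powers x n" unfolding powers_def by blast
    then show ?thesis using i by (simp add: intspan.span_base)
  next
    case False
    then have "Suc i = n" using i by simp
    then have "x * h = x ^ n" using i by auto
    then show ?thesis using assms(2) by simp
  qed
qed (simp_all add: powers_def)

text \<open>The monomials \<open>x ^ i * y ^ j\<close> with exponents below those of the two
  integral equations span a module stable under both numbers.\<close>

lemma algebraic_int_sum_product:
  fixes x y :: complex
  assumes "algebraic_int x" "algebraic_int y"
  shows "algebraic_int (x + y)" "algebraic_int (x * y)"
proof -
  obtain m where m: "m > 0" "x ^ m \<in> intspan.span (powers x m)" using algebraic_int_imp_power[OF assms(1)] .
  obtain n where n: "n > 0" "y ^ n \<in> intspan.span (powers y n)" using algebraic_int_imp_power[OF assms(2)] .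
  define G where "G = (\<lambda>(i, j). x ^ i * y ^ j) ` ({..<m} \<times> {..<n})"
  have G: "finite G" "1 \<in> G" using m n by (force simp: G_def intro: image_eqI[of _ _ "(0, 0)"])+
  have mem: "x ^ i * y ^ j \<in> intspan.span G" if "i < m" "j < n" for i j
    using that by (intro intspan.span_base) (auto simp: G_def)
  have mult_span: "a * z \<in> intspan.span G" if "\<And>h. h \<in> H \<Longrightarrow> a * h \<in> intspan.span G" "z \<in> intspan.span H"
    for a z H
    using that(2)
  proof (induction rule: intspan.span_induct_alt)
    case (step c h z)
    have "of_int c * (a * h) + a * z \<in> intspan.span G"
      using step that(1) by (intro intspan.span_add intspan.span_scale) auto
    then show ?case by (simp add: algebra_simps)
  qed (simp add: intspan.span_zero)
  have xG: "x * h \<in> intspan.span G" if h: "h \<in> G" for h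
  proof -
    obtain i j where ij: "i < m" "j < n" "h = x ^ i * y ^ j" using h by (auto simp: G_def)
    show ?thesis
    proof (cases "Suc i < m")
      case True
      then show ?thesis using mem[of "Suc i" j] ij by (simp add: mult.assoc)
    next
      case False
      then have "Suc i = m" using ij by simp
      then have "x * h = y ^ j * x ^ m" using ij by auto
      also have "\<dots> \<in> intspan.span G"
        by (rule mult_span[OF _ m(2)]) (use mem ij in \<open>auto simp: powers_def mult.commute\<close>)
      finally show ?thesis .
    qed
  qed
  have yG: "y * h \<in> intspan.span G" if h: "h \<in> G" for h
  proof -
    obtain i j where ij: "i < m" "j < n" "h = x ^ i * y ^ j" using h by (auto simp: G_def)
    show ?thesis
    proof (cases "Suc j < n")
      case True
      then show ?thesis using mem[of i "Suc j"] ij by (simp add: algebra_simps)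
    next
      case False
      then have "Suc j = n" using ij by simp
      then have "y * h = x ^ i * y ^ n" using ij by (auto simp: algebra_simps)
      also have "\<dots> \<in> intspan.span G"
        by (rule mult_span[OF _ n(2)]) (use mem ij in \<open>auto simp: powers_def\<close>)
      finally show ?thesis .
    qed
  qed
  show "algebraic_int (x + y)"
    by (rule algebraic_int_if_stable[OF G]) (auto simp: distrib_right intro!: intspan.span_add xG yG)
  show "algebraic_int (x * y)"
    by (rule algebraic_int_if_stable[OF G]) (auto simp: mult.assoc intro!: mult_span[OF xG] yG)
qed

text \<open>With \<open>l\<close> the leading coefficient, multiplying the equation of
  \<open>x\<close> by \<open>l ^ (n - 1)\<close> gives a monic equation for \<open>l * x\<close>.
  Passing to the absolute value of \<open>l\<close> makes the multiplier positive.\<close>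

lemma algebraic_int_multiple:
  fixes x :: complex
  assumes "algebraic x" shows "\<exists>m::nat. m > 0 \<and> algebraic_int (of_nat m * x)"
proof -
  obtain p where p: "\<And>i. coeff p i \<in> \<int>" "p \<noteq> 0" "poly p x = 0" using assms by (rule Polynomial.algebraicE) blast
  have "\<forall>i. \<exists>k::int. coeff p i = of_int k" using p(1) by (meson Ints_cases)
  then obtain k :: "nat \<Rightarrow> int" where k: "\<And>i. coeff p i = of_int (k i)" by metis
  define n where "n = degree p"
  define l where "l = k n"
  have "l \<noteq> 0" using p(2) k[of n] by (auto simp: l_def n_def)
  have n: "n > 0"
  proof (rule ccontr)
    assume "\<not> n > 0"
    then have "poly p x = coeff p 0" by (simp add: poly_altdef n_def)
    with p(2,3) \<open>\<not> n > 0\<close> show False by (metis leading_coeff_0_iff n_def neq0_conv)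
  qed
  define y where "y = of_int l * x"
  have "0 = (\<Sum>i\<le>n. coeff p i * x ^ i)" using p by (simp add: poly_altdef n_def)
  also have "\<dots> = of_int l * x ^ n + (\<Sum>i<n. of_int (k i) * x ^ i)"
    by (simp add: k l_def lessThan_Suc_atMost[symmetric])
  finally have "of_int l * x ^ n = - (\<Sum>i<n. of_int (k i) * x ^ i)" by (simp add: eq_neg_iff_add_eq_0)
  moreover have "y ^ n = of_int l ^ (n - 1) * (of_int l * x ^ n)"
    using n by (cases n) (simp_all add: y_def power_mult_distrib algebra_simps)
  ultimately have "y ^ n = - (\<Sum>i<n. of_int l ^ (n - 1) * (of_int (k i) * x ^ i))"
    by (simp add: sum_distrib_left)
  also have "(\<Sum>i<n. of_int l ^ (n - 1) * (of_int (k i) * x ^ i)) = (\<Sum>i<n. of_int (l ^ (n - 1 - i) * k i) * y ^ i)"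
  proof (rule sum.cong)
    fix i assume "i \<in> {..<n}"
    then have "n - 1 = (n - 1 - i) + i" by simp
    then have "(of_int l :: complex) ^ (n - 1) = of_int l ^ (n - 1 - i) * of_int l ^ i" by (metis power_add)
    then show "of_int l ^ (n - 1) * (of_int (k i) * x ^ i) = of_int (l ^ (n - 1 - i) * k i) * y ^ i"
      by (simp add: y_def power_mult_distrib)
  qed simp
  also have "- \<dots> \<in> intspan.span (powers y n)"
    by (intro intspan.span_neg intspan.span_sum intspan.span_scale intspan.span_base) (auto simp: powers_def)
  finally have "algebraic_int y" using n by (intro power_imp_algebraic_int)
  then have "algebraic_int (of_nat (nat \<bar>l\<bar>) * x)"
    by (cases "l \<ge> 0") (auto simp: y_def)
  then show ?thesis using \<open>l \<noteq> 0\<close> by (intro exI[of _ "nat \<bar>l\<bar>"]) simp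
qed

lemma algebraic_if_multiple:
  fixes x :: complex
  assumes "algebraic_int (of_nat m * x)" "m > 0" shows "algebraic x"
  using assms(1)
proof cases
  case (1 p)
  show ?thesis
  proof (rule Polynomial.algebraicI)
    show "coeff (pcompose p [:0, of_nat m:]) i \<in> \<int>" for i
      using 1 by (simp add: coeff_pcompose_linear)
    have "coeff (pcompose p [:0, of_nat m:]) (degree p) \<noteq> 0"
      using 1 assms(2) by (simp add: coeff_pcompose_linear)
    then show "pcompose p [:0, of_nat m:] \<noteq> 0" by auto
    show "poly (pcompose p [:0, of_nat m:]) x = 0" using 1 by (simp add: poly_pcompose mult.commute)
  qed
qed

lemma algebraic_sum_product:
  fixes x y :: complex
  assumes "algebraic x" "algebraic y"
  shows "algebraic (x + y)" "algebraic (x * y)"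
proof -
  obtain m n :: nat where m: "m > 0" "algebraic_int (of_nat m * x)" and n: "n > 0" "algebraic_int (of_nat n * y)"
    using assms algebraic_int_multiple by blast
  have "algebraic_int (of_nat n * (of_nat m * x) + of_nat m * (of_nat n * y))"
    by (intro algebraic_int_sum_product(1) algebraic_int_sum_product(2)[OF _ m(2)]
          algebraic_int_sum_product(2)[OF _ n(2)] int_imp_algebraic_int Ints_of_nat)
  also have "of_nat n * (of_nat m * x) + of_nat m * (of_nat n * y) = of_nat (m * n) * (x + y)"
    by (simp add: algebra_simps)
  finally show "algebraic (x + y)" by (rule algebraic_if_multiple) (use m n in simp)
  have "algebraic_int ((of_nat m * x) * (of_nat n * y))"
    by (rule algebraic_int_sum_product(2)[OF m(2) n(2)])
  also have "(of_nat m * x) * (of_nat n * y) = of_nat (m * n) * (x * y)"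
    by (simp add: algebra_simps)
  finally show "algebraic (x * y)" by (rule algebraic_if_multiple) (use m n in simp)
qed

section \<open>Fields generated by algebraic numbers\<close>

lemma a_inv_complex: "a_inv ring_of_type_algebra x = - (x::complex)"
proof -
  interpret ring "ring_of_type_algebra :: complex ring" by (rule ring_from_type_algebra)
  show ?thesis by (rule minus_equality) (simp_all add: ring_of_type_algebra_def)
qed

lemma m_inv_complex: "x \<noteq> 0 \<Longrightarrow> m_inv ring_of_type_algebra x = inverse (x::complex)"
proof -
  interpret cring "ring_of_type_algebra :: complex ring" by (rule cring_from_type_algebra)
  show "x \<noteq> 0 \<Longrightarrow> m_inv ring_of_type_algebra x = inverse x"
    by (rule comm_inv_char) (simp_all add: ring_of_type_algebra_def)
qed

lemma ring_of_type_algebra_simps: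
  "one ring_of_type_algebra = 1" "zero ring_of_type_algebra = 0"
  "add ring_of_type_algebra = (+)" "monoid.mult ring_of_type_algebra = (*)"
  by (simp_all add: ring_of_type_algebra_def fun_eq_iff)

lemma rat_adjoin_1: "1 \<in> rat_adjoin S"
  and rat_adjoin_base: "x \<in> S \<Longrightarrow> x \<in> rat_adjoin S"
  and rat_adjoin_uminus: "x \<in> rat_adjoin S \<Longrightarrow> - x \<in> rat_adjoin S"
  and rat_adjoin_add: "x \<in> rat_adjoin S \<Longrightarrow> y \<in> rat_adjoin S \<Longrightarrow> x + y \<in> rat_adjoin S"
  and rat_adjoin_mult: "x \<in> rat_adjoin S \<Longrightarrow> y \<in> rat_adjoin S \<Longrightarrow> x * y \<in> rat_adjoin S"
  unfolding rat_adjoin_def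
  using generate_field.one[of ring_of_type_algebra S] generate_field.incl[of x S ring_of_type_algebra]
    generate_field.a_inv[of x ring_of_type_algebra S] generate_field.eng_add[of x ring_of_type_algebra S y]
    generate_field.eng_mult[of x ring_of_type_algebra S y]
  by (simp_all add: ring_of_type_algebra_simps a_inv_complex)

lemma rat_adjoin_inverse: "x \<in> rat_adjoin S \<Longrightarrow> x \<noteq> 0 \<Longrightarrow> inverse x \<in> rat_adjoin S"
  unfolding rat_adjoin_def using generate_field.m_inv[of x ring_of_type_algebra S]
  by (simp add: ring_of_type_algebra_simps m_inv_complex)

lemma rat_adjoin_induct [consumes 1, case_names one base uminus inverse add mult]:
  assumes "x \<in> rat_adjoin S" and "P 1" "\<And>x. x \<in> S \<Longrightarrow> P x" "\<And>x. P x \<Longrightarrow> P (- x)"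
    "\<And>x. P x \<Longrightarrow> P (inverse x)" "\<And>x y. P x \<Longrightarrow> P y \<Longrightarrow> P (x + y)" "\<And>x y. P x \<Longrightarrow> P y \<Longrightarrow> P (x * y)"
  shows "P x"
  using assms(1) unfolding rat_adjoin_def
proof (induction rule: generate_field.induct)
  case (m_inv h)
  then show ?case using assms(5)[of h] by (simp add: ring_of_type_algebra_simps m_inv_complex)
qed (use assms in \<open>simp_all add: ring_of_type_algebra_simps a_inv_complex\<close>)

lemma rat_adjoin_0: "0 \<in> rat_adjoin S"
  using rat_adjoin_add[OF rat_adjoin_1 rat_adjoin_uminus[OF rat_adjoin_1]] by simp

lemma rat_adjoin_of_nat: "of_nat n \<in> rat_adjoin S"
  by (induction n) (simp_all add: rat_adjoin_0 rat_adjoin_1 rat_adjoin_add)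

lemma rat_adjoin_of_int: "of_int n \<in> rat_adjoin S"
  by (cases n) (simp_all add: rat_adjoin_of_nat rat_adjoin_uminus del: of_nat_Suc)

lemma rat_adjoin_sum: "(\<And>i. i \<in> I \<Longrightarrow> f i \<in> rat_adjoin S) \<Longrightarrow> sum f I \<in> rat_adjoin S"
  by (induction I rule: infinite_finite_induct) (simp_all add: rat_adjoin_0 rat_adjoin_add)

lemma algebraic_rat_adjoin:
  assumes "\<And>x. x \<in> S \<Longrightarrow> algebraic x" "x \<in> rat_adjoin S"
  shows "algebraic x"
  using assms(2) by (induction rule: rat_adjoin_induct) (auto simp: assms(1) algebraic_sum_product)

text \<open>For the axiom \<open>inverse\<close>: the inverse of \<alpha> lies in \<open>K\<close>
  and is algebraic, so a positive integer multiple of it is an algebraic integer in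
  \<open>K\<close>. For \<open>indep\<close>: the coordinates of 0 are unique.\<close>

lemma int_order_ring_of_integers:
  assumes S: "\<And>x. x \<in> S \<Longrightarrow> algebraic x" and K: "K = rat_adjoin S"
    and basis: "int_basis d e (ring_of_integers K)"
  shows "int_order d e" "range (int_comb d e) \<subseteq> K"
proof -
  have range: "x \<in> range (int_comb d e)" if "x \<in> K" "algebraic_int x" for x
  proof -
    have "x \<in> ring_of_integers K" using that by (simp add: ring_of_integers_def)
    then obtain l where "x = (\<Sum>i=1..d. of_int (l i) * e i)"
      using basis unfolding int_basis_def by blast
    then show ?thesis unfolding int_comb_def by blast
  qed
  have e: "e i \<in> K" "algebraic_int (e i)" if "i \<in> {1..d}" for i
    using basis that by (auto simp: int_basis_def ring_of_integers_def)
  show sub: "range (int_comb d e) \<subseteq> K"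
    unfolding int_comb_def using e K by (auto intro!: rat_adjoin_sum rat_adjoin_mult rat_adjoin_of_int)
  show "int_order d e"
  proof
    show "e i * e j \<in> range (int_comb d e)" if "i \<in> {1..d}" "j \<in> {1..d}" for i j
      using e[OF that(1)] e[OF that(2)] K by (intro range algebraic_int_sum_product) (auto intro: rat_adjoin_mult)
    show "1 \<in> range (int_comb d e)" using K by (intro range) (auto simp: rat_adjoin_1)
    show "\<exists>\<beta>\<in>range (int_comb d e). \<exists>m>0. \<beta> * \<alpha> = of_nat m"
      if \<alpha>: "\<alpha> \<in> range (int_comb d e)" "\<alpha> \<noteq> 0" for \<alpha>
    proof -
      have inv: "inverse \<alpha> \<in> K" using \<alpha> sub K by (auto intro: rat_adjoin_inverse)
      then have "algebraic (inverse \<alpha>)" using algebraic_rat_adjoin[OF S] K by blast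
      then obtain m :: nat where m: "m > 0" "algebraic_int (of_nat m * inverse \<alpha>)"
        using algebraic_int_multiple by blast
      then have "of_nat m * inverse \<alpha> \<in> range (int_comb d e)"
        using inv K by (intro range) (auto intro: rat_adjoin_mult rat_adjoin_of_nat)
      then show ?thesis using m \<alpha> by (intro bexI[of _ "of_nat m * inverse \<alpha>"] exI[of _ m]) auto
    qed
    show "a i = 0" if a: "int_comb d e a = 0" and i: "i \<in> {1..d}" for a i
    proof -
      have "0 \<in> ring_of_integers K" using K by (simp add: ring_of_integers_def rat_adjoin_0)
      then have "\<exists>!l. l \<in> extensional {1..d} \<and> 0 = (\<Sum>i=1..d. of_int (l i) * e i)"
        using basis unfolding int_basis_def by blast
      moreover have "0 = (\<Sum>i=1..d. of_int (restrict a {1..d} i) * e i)"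
        using a unfolding int_comb_def by simp
      moreover have "0 = (\<Sum>i=1..d. of_int (restrict (\<lambda>_. 0) {1..d} i) * e i)" by simp
      ultimately have "restrict a {1..d} = restrict (\<lambda>_. 0) {1..d}" by (metis restrict_extensional)
      then show ?thesis using i by (metis restrict_apply')
    qed
  qed
qed

section \<open>Quotient seminorms\<close>

context seminormed_lattice
begin

lemma Dep_R_mult: "\<alpha> \<in> R \<Longrightarrow> x \<in> Dep r u \<Longrightarrow> (\<And>j. j < r \<Longrightarrow> u j \<in> \<Lambda>) \<Longrightarrow> sc \<alpha> x \<in> Dep r u"
proof -
  assume \<alpha>: "\<alpha> \<in> R" and "x \<in> Dep r u" and u: "\<And>j. j < r \<Longrightarrow> u j \<in> \<Lambda>"
  then obtain m \<beta> where x: "x \<in> \<Lambda>" and m: "m > (0::nat)" and \<beta>: "\<forall>j<r. \<beta> j \<in> R"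
    and 0: "N (sc (of_nat m) x - comb \<beta> u r) = 0" by (auto simp: Dep_def)
  have "sc (of_nat m) (sc \<alpha> x) - comb (\<lambda>j. \<alpha> * \<beta> j) u r = sc \<alpha> (sc (of_nat m) x - comb \<beta> u r)"
    by (simp add: comb_sc scale_right_diff_distrib mult.commute)
  moreover have "sc (of_nat m) x - comb \<beta> u r \<in> \<Lambda>"
    using x u \<beta> by (intro diff_mem sc_mem comb_mem R_nat) auto
  ultimately have "N (sc (of_nat m) (sc \<alpha> x) - comb (\<lambda>j. \<alpha> * \<beta> j) u r) = 0"
    using N_sc_zero[OF \<alpha> _ 0] by simp
  then show ?thesis unfolding Dep_def using x m \<alpha> \<beta>
    by (intro CollectI conjI exI[of _ m] exI[of _ "\<lambda>j. \<alpha> * \<beta> j"]) (auto intro: sc_mem R_mult)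
qed

lemma Dep_add: "x \<in> Dep r u \<Longrightarrow> y \<in> Dep r u \<Longrightarrow> (\<And>j. j < r \<Longrightarrow> u j \<in> \<Lambda>) \<Longrightarrow> x + y \<in> Dep r u"
proof -
  assume "x \<in> Dep r u" "y \<in> Dep r u" and u: "\<And>j. j < r \<Longrightarrow> u j \<in> \<Lambda>"
  then obtain m \<beta> m' \<beta>' where x: "x \<in> \<Lambda>" and m: "m > (0::nat)" and \<beta>: "\<forall>j<r. \<beta> j \<in> R"
    and 0: "N (sc (of_nat m) x - comb \<beta> u r) = 0"
    and y: "y \<in> \<Lambda>" and m': "m' > (0::nat)" and \<beta>': "\<forall>j<r. \<beta>' j \<in> R"
    and zero': "N (sc (of_nat m') y - comb \<beta>' u r) = 0" by (auto simp: Dep_def)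
  define \<gamma> where "\<gamma> = (\<lambda>j. of_nat m' * \<beta> j + of_nat m * \<beta>' j)"
  have "sc (of_nat (m * m')) (x + y) - comb \<gamma> u r
      = sc (of_nat m') (sc (of_nat m) x - comb \<beta> u r) + sc (of_nat m) (sc (of_nat m') y - comb \<beta>' u r)"
    by (simp add: \<gamma>_def comb_sc comb_add scale_right_diff_distrib scale_right_distrib mult.commute)
  moreover have "sc (of_nat m) x - comb \<beta> u r \<in> \<Lambda>" "sc (of_nat m') y - comb \<beta>' u r \<in> \<Lambda>"
    using x y u \<beta> \<beta>' by (intro diff_mem sc_mem comb_mem R_nat; auto)+
  ultimately have "N (sc (of_nat (m * m')) (x + y) - comb \<gamma> u r) = 0"
    using N_zero_add N_sc_zero[OF R_nat] sc_mem[OF R_nat] 0 zero' by simp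
  moreover have "\<forall>j<r. \<gamma> j \<in> R" unfolding \<gamma>_def using \<beta> \<beta>' by (auto intro!: R_add R_mult R_nat)
  ultimately show ?thesis unfolding Dep_def using x y m m'
    by (intro CollectI conjI exI[of _ "m * m'"] exI[of _ \<gamma>]) (auto intro: add_mem)
qed

lemma Dep_diff: "x \<in> Dep r u \<Longrightarrow> y \<in> Dep r u \<Longrightarrow> (\<And>j. j < r \<Longrightarrow> u j \<in> \<Lambda>) \<Longrightarrow> x - y \<in> Dep r u"
  using Dep_add[of x r u "sc (of_int (-1)) y"] Dep_R_mult[OF R_int, of y r u "-1"] by simp

lemma Dep_div: "sc (of_nat k) x \<in> Dep r u \<Longrightarrow> k > 0 \<Longrightarrow> x \<in> \<Lambda> \<Longrightarrow> x \<in> Dep r u"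
proof -
  assume "sc (of_nat k) x \<in> Dep r u" and k: "k > 0" and x: "x \<in> \<Lambda>"
  then obtain m \<beta> where "m > (0::nat)" "\<forall>j<r. \<beta> j \<in> R" "N (sc (of_nat m) (sc (of_nat k) x) - comb \<beta> u r) = 0"
    by (auto simp: Dep_def)
  with k x show ?thesis unfolding Dep_def
    by (intro CollectI conjI exI[of _ "m * k"] exI[of _ \<beta>]) auto
qed

lemma Dep_subset: "x \<in> Dep r u \<Longrightarrow> x \<in> \<Lambda>"
  by (simp add: Dep_def)

lemma shift_mem: "x \<in> \<Lambda> \<Longrightarrow> w \<in> Dep r u \<Longrightarrow> sc (of_nat m) x + w \<in> \<Lambda>"
  by (intro add_mem sc_mem R_nat) (auto dest: Dep_subset)

text \<open>Elements of \<open>Dep r u\<close> have coordinates with an uncontrolled denominator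
  \<open>m0\<close>. Dividing the numerators by \<open>m * m0\<close> with remainder approximates
  \<open>w\<close> by \<open>m\<close> times a lattice vector of the span, with an error
  proportional to \<open>m\<close> and free of \<open>m0\<close>.\<close>

lemma round_Dep:
  assumes u: "\<And>j. j < r \<Longrightarrow> u j \<in> \<Lambda>" "\<And>j. j < r \<Longrightarrow> N (u j) \<le> S" and w: "w \<in> Dep r u" and m: "m > 0"
  shows "\<exists>w'\<in>Dep r u. N (w - sc (of_nat m) w') \<le> m * (r * (d * c * S))"
proof -
  obtain m0 \<beta> where wL: "w \<in> \<Lambda>" and m0: "m0 > (0::nat)" and \<beta>: "\<forall>j<r. \<beta> j \<in> R"
    and 0: "N (sc (of_nat m0) w - comb \<beta> u r) = 0" using w by (auto simp: Dep_def)
  have "\<forall>j. \<exists>b. j < r \<longrightarrow> \<beta> j = int_comb d e b" using \<beta> by blast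
  then obtain b where b: "\<And>j. j < r \<Longrightarrow> \<beta> j = int_comb d e (b j)" by metis
  define a where "a j i = b j i div int (m * m0)" for j i
  define E where "E = comb (\<lambda>j. int_comb d e (\<lambda>i. b j i - int (m * m0) * a j i)) u r"
  define w' where "w' = comb (\<lambda>j. int_comb d e (a j)) u r"
  have w'L: "w' \<in> \<Lambda>" unfolding w'_def using u by (intro comb_mem) auto
  have w': "w' \<in> Dep r u" unfolding Dep_def using w'L
    by (intro CollectI conjI exI[of _ 1] exI[of _ "\<lambda>j. int_comb d e (a j)"]) (auto simp: w'_def[symmetric] N_0)
  have EL: "E \<in> \<Lambda>" unfolding E_def using u by (intro comb_mem) auto
  have NE: "N E \<le> r * (d * c * (real (m * m0)) * S)"
    unfolding E_def
  proof (rule N_comb[OF u])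
    fix j i
    have "b j i - int (m * m0) * a j i = b j i mod int (m * m0)" by (simp add: a_def minus_mult_div_eq_mod)
    moreover have "0 \<le> b j i mod int (m * m0)" "b j i mod int (m * m0) < int (m * m0)" using m m0 by simp_all
    ultimately show "real_of_int \<bar>b j i - int (m * m0) * a j i\<bar> \<le> real (m * m0)" by linarith
  qed auto
  have "comb \<beta> u r = comb (\<lambda>j. int_comb d e (b j)) u r"
    unfolding comb_def by (intro sum.cong refl) (use b in auto)
  then have "E = comb \<beta> u r - sc (of_nat (m * m0)) w'"
    by (simp only: E_def w'_def int_comb_diff int_comb_mult comb_diff comb_sc of_int_of_nat_eq)
  then have "sc (of_nat m0) (w - sc (of_nat m) w') - E = sc (of_nat m0) w - comb \<beta> u r"
    by (simp add: scale_right_diff_distrib mult.commute)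
  moreover have D: "w - sc (of_nat m) w' \<in> \<Lambda>" using wL w'L by (intro diff_mem sc_mem R_nat)
  ultimately have "N (sc (of_nat m0) (w - sc (of_nat m) w')) \<le> N E"
    using 0 EL by (intro N_le_if_diff_zero sc_mem R_nat) auto
  with NE have "real m0 * N (w - sc (of_nat m) w') \<le> real m0 * (m * (r * (d * c * S)))"
    unfolding N_nat[OF D] by (simp add: mult_ac)
  then have "N (w - sc (of_nat m) w') \<le> m * (r * (d * c * S))" using m0 by simp
  with w' show ?thesis by blast
qed

text \<open>The seminorm induced on the quotient by \<open>Dep r u \<otimes> \<rat>\<close>; the division by \<open>m\<close> makes up for the
  restriction of \<open>w\<close> to lattice vectors.\<close>

definition quot_norm :: "nat \<Rightarrow> (nat \<Rightarrow> 'v) \<Rightarrow> 'v \<Rightarrow> real" where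
  "quot_norm r u x = Inf {N (sc (of_nat m) x + w) / real m | m w. m > (0::nat) \<and> w \<in> Dep r u}"

context
  fixes r :: nat and u :: "nat \<Rightarrow> 'v" and S :: real
  assumes u: "\<And>j. j < r \<Longrightarrow> u j \<in> \<Lambda>" "\<And>j. j < r \<Longrightarrow> N (u j) \<le> S"
    and finite_balls: "\<And>b. finite {x\<in>\<Lambda>. N x \<le> b}"
begin

lemma quot_norm_le:
  assumes "x \<in> \<Lambda>" "m > 0" "w \<in> Dep r u"
  shows "quot_norm r u x \<le> N (sc (of_nat m) x + w) / real m"
  unfolding quot_norm_def
proof (rule cInf_lower)
  show "bdd_below {N (sc (of_nat m) x + w) / real m | m w. m > (0::nat) \<and> w \<in> Dep r u}"
    using assms(1) by (intro bdd_belowI[of _ 0]) (auto intro!: divide_nonneg_nonneg N_nonneg shift_mem)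
qed (use assms in blast)

lemma quot_norm_less:
  assumes "x \<in> \<Lambda>" "quot_norm r u x < b"
  obtains m w where "m > 0" "w \<in> Dep r u" "N (sc (of_nat m) x + w) < real m * b"
proof -
  have "0 \<in> Dep r u" by (rule zero_Dep[OF zero_mem N_0])
  then have "{N (sc (of_nat m) x + w) / real m | m w. m > (0::nat) \<and> w \<in> Dep r u} \<noteq> {}" by blast
  then obtain m w where "m > (0::nat)" "w \<in> Dep r u" "N (sc (of_nat m) x + w) / real m < b"
    using cInf_lessD[of "{N (sc (of_nat m) x + w) / real m | m w. m > (0::nat) \<and> w \<in> Dep r u}" b] assms(2)
    unfolding quot_norm_def by blast
  then show thesis using that[of m w] by (simp add: divide_less_eq mult.commute)
qed

lemma quot_norm_le_N: "x \<in> \<Lambda> \<Longrightarrow> quot_norm r u x \<le> N x"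
  using quot_norm_le[of x 1 0] zero_Dep[OF zero_mem N_0, of r u] by simp

lemma quot_norm_nonneg: "x \<in> \<Lambda> \<Longrightarrow> 0 \<le> quot_norm r u x"
proof (rule ccontr)
  assume x: "x \<in> \<Lambda>" and "\<not> 0 \<le> quot_norm r u x"
  then obtain m w where "m > 0" "w \<in> Dep r u" "N (sc (of_nat m) x + w) < real m * 0"
    using quot_norm_less[OF x, of 0] by auto
  moreover have "0 \<le> N (sc (of_nat m) x + w)"
    using x \<open>w \<in> Dep r u\<close> by (intro N_nonneg shift_mem)
  ultimately show False by simp
qed

text \<open>Rounding \<open>w\<close> removes the division by \<open>m\<close> from the infimum, so
  a single lattice vector realises the quotient seminorm up to an additive constant. The 1 allows
  for an infimum that is not attained.\<close>

lemma quot_norm_lift: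
  assumes x: "x \<in> \<Lambda>" "quot_norm r u x \<le> b"
  obtains w where "w \<in> Dep r u" "N (x + w) \<le> b + 1 + r * (d * c * S)"
proof -
  obtain m w where m: "m > 0" "w \<in> Dep r u" "N (sc (of_nat m) x + w) < real m * (b + 1)"
    using quot_norm_less[of x "b + 1"] x by auto
  obtain w' where w': "w' \<in> Dep r u" "N (w - sc (of_nat m) w') \<le> m * (r * (d * c * S))"
    using round_Dep[OF u m(2,1)] by blast
  have L: "w \<in> \<Lambda>" "w' \<in> \<Lambda>" using m(2) w'(1) by (auto intro: Dep_subset)
  have "sc (of_nat m) (x + w') = (sc (of_nat m) x + w) - (w - sc (of_nat m) w')"
    by (simp add: scale_right_distrib)
  then have "real m * N (x + w') \<le> N (sc (of_nat m) x + w) + N (w - sc (of_nat m) w')"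
    using N_nat[of "x + w'" m] N_diff[of "sc (of_nat m) x + w" "w - sc (of_nat m) w'"] x L
    by (simp add: add_mem diff_mem sc_mem R_nat)
  also have "\<dots> \<le> real m * (b + 1 + r * (d * c * S))"
    using m(3) w'(2) by (simp add: distrib_left)
  finally have "N (x + w') \<le> b + 1 + r * (d * c * S)" using m(1) by simp
  with w'(1) show thesis by (rule that)
qed

lemma quot_norm_shift_le:
  assumes x: "x \<in> \<Lambda>" and w: "w \<in> Dep r u"
  shows "quot_norm r u (x + w) \<le> quot_norm r u x"
proof (rule ccontr)
  assume "\<not> ?thesis"
  then obtain m w' where m: "m > 0" "w' \<in> Dep r u" "N (sc (of_nat m) x + w') < real m * quot_norm r u (x + w)"
    using quot_norm_less[OF x, of "quot_norm r u (x + w)"] by auto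
  have "quot_norm r u (x + w) \<le> N (sc (of_nat m) (x + w) + (w' - sc (of_nat m) w)) / real m"
    using x w m u Dep_subset[OF w] by (intro quot_norm_le add_mem Dep_diff Dep_R_mult R_nat) auto
  also have "sc (of_nat m) (x + w) + (w' - sc (of_nat m) w) = sc (of_nat m) x + w'"
    by (simp add: scale_right_distrib)
  finally show False using m by (simp add: pos_le_divide_eq mult.commute)
qed

lemma quot_norm_shift:
  assumes x: "x \<in> \<Lambda>" and w: "w \<in> Dep r u"
  shows "quot_norm r u (x + w) = quot_norm r u x"
proof (rule antisym)
  have "- w \<in> Dep r u" using Dep_R_mult[OF R_int w, of "-1"] u by simp
  then show "quot_norm r u x \<le> quot_norm r u (x + w)"
    using quot_norm_shift_le[of "x + w" "- w"] x w by (simp add: add_mem Dep_subset)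
qed (rule quot_norm_shift_le[OF assms])

lemma quot_norm_add:
  assumes x: "x \<in> \<Lambda>" and y: "y \<in> \<Lambda>"
  shows "quot_norm r u (x + y) \<le> quot_norm r u x + quot_norm r u y"
proof (rule field_le_epsilon)
  fix \<epsilon> :: real assume \<epsilon>: "0 < \<epsilon>"
  obtain m w where m: "m > 0" "w \<in> Dep r u" "N (sc (of_nat m) x + w) < real m * (quot_norm r u x + \<epsilon> / 2)"
    using quot_norm_less[OF x, of "quot_norm r u x + \<epsilon> / 2"] \<epsilon> by auto
  obtain m' w' where m': "m' > 0" "w' \<in> Dep r u" "N (sc (of_nat m') y + w') < real m' * (quot_norm r u y + \<epsilon> / 2)"
    using quot_norm_less[OF y, of "quot_norm r u y + \<epsilon> / 2"] \<epsilon> by auto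
  have L: "sc (of_nat m) x + w \<in> \<Lambda>" "sc (of_nat m') y + w' \<in> \<Lambda>"
    using x y m m' by (auto intro!: shift_mem)
  have "quot_norm r u (x + y) \<le> N (sc (of_nat (m * m')) (x + y) + (sc (of_nat m') w + sc (of_nat m) w')) / real (m * m')"
    using x y m m' u by (intro quot_norm_le add_mem Dep_add Dep_R_mult R_nat) auto
  also have "sc (of_nat (m * m')) (x + y) + (sc (of_nat m') w + sc (of_nat m) w')
      = sc (of_nat m') (sc (of_nat m) x + w) + sc (of_nat m) (sc (of_nat m') y + w')"
    by (simp add: scale_right_distrib mult.commute)
  also have "N \<dots> \<le> real m' * N (sc (of_nat m) x + w) + real m * N (sc (of_nat m') y + w')"
    using N_add[of "sc (of_nat m') (sc (of_nat m) x + w)" "sc (of_nat m) (sc (of_nat m') y + w')"] L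
    by (simp add: N_nat sc_mem R_nat)
  also have "\<dots> \<le> real m' * (real m * (quot_norm r u x + \<epsilon> / 2)) + real m * (real m' * (quot_norm r u y + \<epsilon> / 2))"
    using m m' by (intro add_mono mult_left_mono) auto
  also have "\<dots> = real (m * m') * (quot_norm r u x + quot_norm r u y + \<epsilon>)" by (simp add: algebra_simps)
  finally show "quot_norm r u (x + y) \<le> quot_norm r u x + quot_norm r u y + \<epsilon>"
    using m m' by (simp add: divide_right_mono)
qed

lemma quot_norm_R_mult_le:
  assumes x: "x \<in> \<Lambda>" and \<alpha>: "\<alpha> \<in> R" and C: "0 \<le> C" "\<And>y. y \<in> \<Lambda> \<Longrightarrow> N (sc \<alpha> y) \<le> C * N y"
  shows "quot_norm r u (sc \<alpha> x) \<le> C * quot_norm r u x"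
proof (rule field_le_epsilon)
  fix \<epsilon> :: real assume \<epsilon>: "0 < \<epsilon>"
  define \<delta> where "\<delta> = \<epsilon> / (C + 1)"
  have \<delta>: "0 < \<delta>" "C * \<delta> \<le> \<epsilon>" using \<epsilon> C(1) by (simp_all add: \<delta>_def field_simps)
  obtain m w where m: "m > 0" "w \<in> Dep r u" "N (sc (of_nat m) x + w) < real m * (quot_norm r u x + \<delta>)"
    using quot_norm_less[OF x, of "quot_norm r u x + \<delta>"] \<delta> by auto
  have "quot_norm r u (sc \<alpha> x) \<le> N (sc (of_nat m) (sc \<alpha> x) + sc \<alpha> w) / real m"
    using x m u \<alpha> by (intro quot_norm_le sc_mem Dep_R_mult) auto
  also have "sc (of_nat m) (sc \<alpha> x) + sc \<alpha> w = sc \<alpha> (sc (of_nat m) x + w)"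
    by (simp add: scale_right_distrib mult.commute)
  also have "N \<dots> / real m \<le> C * (real m * (quot_norm r u x + \<delta>)) / real m"
    using m x C by (intro divide_right_mono order_trans[OF C(2)] mult_left_mono shift_mem) auto
  also have "\<dots> = C * quot_norm r u x + C * \<delta>" using m by (simp add: distrib_left)
  finally show "quot_norm r u (sc \<alpha> x) \<le> C * quot_norm r u x + \<epsilon>" using \<delta> by linarith
qed

lemma quot_norm_int:
  assumes x: "x \<in> \<Lambda>"
  shows "quot_norm r u (sc (of_int k) x) = real_of_int \<bar>k\<bar> * quot_norm r u x"
proof (cases "k = 0")
  case True
  have "quot_norm r u 0 \<le> 0" using quot_norm_le_N[OF zero_mem] by (simp add: N_0)
  then show ?thesis using True quot_norm_nonneg[OF zero_mem] by simp
next
  case False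
  show ?thesis
  proof (rule antisym)
    show "quot_norm r u (sc (of_int k) x) \<le> real_of_int \<bar>k\<bar> * quot_norm r u x"
      using N_int by (intro quot_norm_R_mult_le[OF x R_int]) auto
    show "real_of_int \<bar>k\<bar> * quot_norm r u x \<le> quot_norm r u (sc (of_int k) x)"
    proof (rule ccontr)
      assume "\<not> ?thesis"
      then obtain m w where m: "m > 0" "w \<in> Dep r u"
        "N (sc (of_nat m) (sc (of_int k) x) + w) < real m * (real_of_int \<bar>k\<bar> * quot_norm r u x)"
        using quot_norm_less[OF sc_mem[OF R_int x, of k], of "real_of_int \<bar>k\<bar> * quot_norm r u x"] by auto
      \<comment> \<open>A representative of \<open>k\<close> times \<open>x\<close> with weight
        \<open>m\<close> is, up to sign, one of \<open>x\<close> with weight \<open>m\<close> times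
        the absolute value of \<open>k\<close>; weights must be positive.\<close>
      have sgn: "of_int (sgn k) * (of_nat m * of_int k) = (of_nat (m * nat \<bar>k\<bar>) :: complex)"
      proof -
        have "of_int (sgn k) * of_int k = (of_nat (nat \<bar>k\<bar>) :: complex)" by (rule sgn_mult_complex)
        then show ?thesis by (simp add: mult.left_commute)
      qed
      have L: "sc (of_nat m) (sc (of_int k) x) + w \<in> \<Lambda>"
        using x m by (intro shift_mem sc_mem R_int)
      have "quot_norm r u x \<le> N (sc (of_nat (m * nat \<bar>k\<bar>)) x + sc (of_int (sgn k)) w) / real (m * nat \<bar>k\<bar>)"
        using x m u False by (intro quot_norm_le Dep_R_mult R_int) auto
      also have "sc (of_nat (m * nat \<bar>k\<bar>)) x + sc (of_int (sgn k)) w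
          = sc (of_int (sgn k)) (sc (of_nat m) (sc (of_int k) x) + w)"
        by (simp only: scale_right_distrib scale_scale sgn[symmetric])
      also have "N \<dots> = N (sc (of_nat m) (sc (of_int k) x) + w)"
        using N_int[OF L, of "sgn k"] False by (simp add: abs_sgn_eq)
      finally have "real (m * nat \<bar>k\<bar>) * quot_norm r u x \<le> N (sc (of_nat m) (sc (of_int k) x) + w)"
        using m False by (simp add: pos_le_divide_eq mult.commute)
      then show False using m(3) by (simp add: mult.assoc)
    qed
  qed
qed

text \<open>All multiples of \<open>x\<close> have lifts in one and the same ball, which is finite.
  Two of the lifts coincide, so a positive multiple of \<open>x\<close> lies in
  \<open>Dep r u\<close>, and \<open>Dep_div\<close> removes the multiplier.\<close>

lemma quot_norm_zero:
  assumes x: "x \<in> \<Lambda>" and 0: "quot_norm r u x = 0"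
  shows "x \<in> Dep r u"
proof -
  define b where "b = 0 + 1 + r * (d * c * S)"
  have "\<exists>w. w \<in> Dep r u \<and> N (sc (of_nat m) x + w) \<le> b" for m :: nat
    using quot_norm_lift[of "sc (of_nat m) x" 0] quot_norm_int[OF x, of "int m"] 0 x
    unfolding b_def by (metis R_nat mult_zero_right of_int_of_nat_eq order_refl sc_mem)
  then obtain w where w: "\<And>m. w m \<in> Dep r u" "\<And>m::nat. N (sc (of_nat m) x + w m) \<le> b" by metis
  define f where "f m = sc (of_nat m) x + w m" for m :: nat
  have "range f \<subseteq> {y\<in>\<Lambda>. N y \<le> b}"
    using w x by (auto simp: f_def intro!: shift_mem)
  then have "finite (range f)" using finite_balls by (rule finite_subset)
  then have "\<not> inj f" using finite_imageD[of f UNIV] by auto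
  then obtain i j where ij: "f i = f j" "i < j" unfolding inj_def by (metis linorder_neqE_nat)
  have "sc (of_nat (j - i)) x = (f j - f i) + (w i - w j)"
    using ij(2) by (simp add: f_def of_nat_diff scale_left_diff_distrib)
  also have "\<dots> = w i - w j" using ij(1) by simp
  also have "\<dots> \<in> Dep r u" by (rule Dep_diff[OF w(1) w(1)]) (rule u(1))
  finally show ?thesis by (rule Dep_div) (use ij(2) x in simp_all)
qed

text \<open>Only the existence of minima is delicate: each vector of bounded quotient seminorm has a
  lift of the same quotient seminorm in a finite ball, so only finitely many values occur.\<close>

lemma seminormed_quotient: "seminormed_lattice d e sc \<Lambda> (quot_norm r u) c s' G"
proof
  show "quot_norm r u (sc (e i) x) \<le> c * quot_norm r u x" if "x \<in> \<Lambda>" "i \<in> {1..d}" for x i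
    using that N_basis c_nonneg by (intro quot_norm_R_mult_le R_basis) auto
  show "\<exists>x\<in>Y. \<forall>y\<in>Y. quot_norm r u x \<le> quot_norm r u y"
    if Y: "Y \<subseteq> {x\<in>\<Lambda>. quot_norm r u x \<le> s'}" "Y \<noteq> {}" for Y
  proof -
    define B where "B = {x\<in>\<Lambda>. N x \<le> s' + 1 + r * (d * c * S)}"
    have "quot_norm r u ` Y \<subseteq> quot_norm r u ` B"
    proof
      fix t assume "t \<in> quot_norm r u ` Y"
      then obtain y where y: "y \<in> \<Lambda>" "quot_norm r u y \<le> s'" "t = quot_norm r u y" using Y by blast
      obtain w where w: "w \<in> Dep r u" "N (y + w) \<le> s' + 1 + r * (d * c * S)"
        using quot_norm_lift[OF y(1,2)] .
      have "t = quot_norm r u (y + w)" using y w quot_norm_shift by simp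
      moreover have "y + w \<in> B" using w y by (simp add: B_def add_mem Dep_subset)
      ultimately show "t \<in> quot_norm r u ` B" by blast
    qed
    moreover have "finite (quot_norm r u ` B)" unfolding B_def by (intro finite_imageI finite_balls)
    ultimately have fin: "finite (quot_norm r u ` Y)" by (rule finite_subset)
    have "Min (quot_norm r u ` Y) \<in> quot_norm r u ` Y" using fin Y(2) by (intro Min_in) auto
    then obtain x where x: "x \<in> Y" "Min (quot_norm r u ` Y) = quot_norm r u x" by (rule imageE)
    have "quot_norm r u x \<le> quot_norm r u y" if "y \<in> Y" for y
      unfolding x(2)[symmetric] using fin that by (intro Min_le) auto
    with x(1) show ?thesis by (intro bexI[of _ x] ballI)
  qed
qed (use zero_mem add_mem sc_mem quot_norm_add quot_norm_int c_nonneg finite_G span_G in auto)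

end

end

section \<open>Free modules over an order\<close>

context int_order
begin

text \<open>On the indices 1 to \<open>d\<close> the choice is unique by
  \<open>indep\<close>.\<close>

definition crd :: "complex \<Rightarrow> nat \<Rightarrow> int" where
  "crd \<alpha> = (SOME a. \<alpha> = int_comb d e a)"

lemma int_comb_crd: "\<alpha> \<in> R \<Longrightarrow> int_comb d e (crd \<alpha>) = \<alpha>"
proof -
  assume "\<alpha> \<in> R"
  then have "\<exists>a. \<alpha> = int_comb d e a" by blast
  then have "\<alpha> = int_comb d e (crd \<alpha>)" unfolding crd_def by (rule someI_ex)
  then show "int_comb d e (crd \<alpha>) = \<alpha>" by simp
qed

lemma crd_int_comb: "i \<in> {1..d} \<Longrightarrow> crd (int_comb d e a) i = a i"
  using indep[of "\<lambda>i. crd (int_comb d e a) i - a i" i] int_comb_crd[OF rangeI, of a]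
  by (simp add: int_comb_diff)

lemma crd_add: "\<alpha> \<in> R \<Longrightarrow> \<beta> \<in> R \<Longrightarrow> i \<in> {1..d} \<Longrightarrow> crd (\<alpha> + \<beta>) i = crd \<alpha> i + crd \<beta> i"
  using crd_int_comb[of i "\<lambda>i. crd \<alpha> i + crd \<beta> i"] by (simp add: int_comb_add int_comb_crd)

lemma crd_int_mult: "\<alpha> \<in> R \<Longrightarrow> i \<in> {1..d} \<Longrightarrow> crd (of_int k * \<alpha>) i = k * crd \<alpha> i"
  using crd_int_comb[of i "\<lambda>i. k * crd \<alpha> i"] by (simp add: int_comb_mult int_comb_crd)

text \<open>A crude bound for multiplication by basis elements in coordinates: the absolute values
  of all structure constants are added up. It becomes the parameter \<open>c\<close> of the
  lattices, so that the reduction constants depend on the order and the rank alone.\<close>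

definition struct_const :: real where
  "struct_const = real_of_int (\<Sum>i=1..d. \<Sum>j=1..d. \<Sum>k=1..d. \<bar>crd (e i * e j) k\<bar>)"

lemma struct_const_nonneg: "0 \<le> struct_const"
  unfolding struct_const_def by (simp add: sum_nonneg)

lemma crd_basis_mult_le:
  assumes \<alpha>: "\<alpha> \<in> R" and i: "i \<in> {1..d}" and k: "k \<in> {1..d}"
    and b: "\<And>j. j \<in> {1..d} \<Longrightarrow> real_of_int \<bar>crd \<alpha> j\<bar> \<le> b"
  shows "real_of_int \<bar>crd (e i * \<alpha>) k\<bar> \<le> struct_const * b"
proof -
  have b0: "0 \<le> b" using b[OF i] by linarith
  have "e i * \<alpha> = (\<Sum>j=1..d. of_int (crd \<alpha> j) * (e i * e j))"
    by (subst int_comb_crd[OF \<alpha>, symmetric]) (simp add: int_comb_def sum_distrib_left mult_ac)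
  also have "\<dots> = (\<Sum>j=1..d. int_comb d e (\<lambda>k. crd \<alpha> j * crd (e i * e j) k))"
    using i by (intro sum.cong refl) (simp add: int_comb_mult int_comb_crd basis_mult)
  also have "\<dots> = int_comb d e (\<lambda>k. \<Sum>j=1..d. crd \<alpha> j * crd (e i * e j) k)"
    by (simp add: int_comb_sum)
  finally have "crd (e i * \<alpha>) k = (\<Sum>j=1..d. crd \<alpha> j * crd (e i * e j) k)"
    using crd_int_comb[OF k] by simp
  then have "real_of_int \<bar>crd (e i * \<alpha>) k\<bar> \<le> (\<Sum>j=1..d. real_of_int \<bar>crd \<alpha> j * crd (e i * e j) k\<bar>)"
    by (simp only: of_int_abs of_int_sum) (rule sum_abs)
  also have "\<dots> \<le> (\<Sum>j=1..d. b * real_of_int \<bar>crd (e i * e j) k\<bar>)"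
  proof (rule sum_mono)
    fix j assume "j \<in> {1..d}"
    from mult_right_mono[OF b[OF this], of "real_of_int \<bar>crd (e i * e j) k\<bar>"]
    show "real_of_int \<bar>crd \<alpha> j * crd (e i * e j) k\<bar> \<le> b * real_of_int \<bar>crd (e i * e j) k\<bar>"
      by (simp add: abs_mult)
  qed
  also have "\<dots> = b * real_of_int (\<Sum>j=1..d. \<bar>crd (e i * e j) k\<bar>)" by (simp add: sum_distrib_left)
  also have "\<dots> \<le> b * struct_const"
  proof (rule mult_left_mono[OF _ b0])
    have "(\<Sum>j=1..d. \<bar>crd (e i * e j) k\<bar>) \<le> (\<Sum>j=1..d. \<Sum>k=1..d. \<bar>crd (e i * e j) k\<bar>)"
      by (intro sum_mono member_le_sum[OF k]) auto
    also have "\<dots> \<le> (\<Sum>i=1..d. \<Sum>j=1..d. \<Sum>k=1..d. \<bar>crd (e i * e j) k\<bar>)"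
      by (rule member_le_sum[OF i, of "\<lambda>i. \<Sum>j=1..d. \<Sum>k=1..d. \<bar>crd (e i * e j) k\<bar>"]) (auto intro: sum_nonneg)
    finally show "real_of_int (\<Sum>j=1..d. \<bar>crd (e i * e j) k\<bar>) \<le> struct_const"
      unfolding struct_const_def by (simp only: of_int_le_iff)
  qed
  finally show ?thesis by (simp add: mult.commute)
qed

definition lat :: "nat \<Rightarrow> (nat \<Rightarrow> complex) set" where
  "lat n = {x. (\<forall>j<n. x j \<in> R) \<and> (\<forall>j\<ge>n. x j = 0)}"

text \<open>A basis over the integers: its size, of order \<open>n * d\<close>, is what bounds the
  length of chains.\<close>

definition lat_basis :: "nat \<Rightarrow> (nat \<Rightarrow> complex) set" where
  "lat_basis n = (\<lambda>(j, i). psc (e i) (unit_fun j)) ` ({..<n} \<times> {1..d})"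

text \<open>The gauge of a box. All \<open>d\<close> coordinates of a component share the length
  \<open>L j\<close>, so multiplication by the order distorts it by a factor independent of the
  lengths.\<close>

definition box_norm :: "nat \<Rightarrow> (nat \<Rightarrow> nat) \<Rightarrow> (nat \<Rightarrow> complex) \<Rightarrow> real" where
  "box_norm n L x = Max (insert 0 ((\<lambda>(j, i). real_of_int \<bar>crd (x j) i\<bar> / L j) ` ({..<n} \<times> {1..d})))"

lemma latD: "x \<in> lat n \<Longrightarrow> x j \<in> R"
  by (cases "j < n") (auto simp: lat_def R_0)

lemma box_norm_le_iff:
  assumes "\<forall>j<n. 0 < L j"
  shows "box_norm n L x \<le> b \<longleftrightarrow> 0 \<le> b \<and> (\<forall>j<n. \<forall>i\<in>{1..d}. real_of_int \<bar>crd (x j) i\<bar> \<le> b * L j)"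
proof -
  have "box_norm n L x \<le> b \<longleftrightarrow> 0 \<le> b \<and> (\<forall>j<n. \<forall>i\<in>{1..d}. real_of_int \<bar>crd (x j) i\<bar> / L j \<le> b)"
    unfolding box_norm_def by (subst Max_le_iff) auto
  also have "\<dots> \<longleftrightarrow> 0 \<le> b \<and> (\<forall>j<n. \<forall>i\<in>{1..d}. real_of_int \<bar>crd (x j) i\<bar> \<le> b * L j)"
    using assms by (auto simp: pos_divide_le_eq)
  finally show ?thesis .
qed

lemma box_norm_nonneg: "0 \<le> box_norm n L x"
  unfolding box_norm_def by (rule Max_ge) auto

lemma box_norm_ge:
  assumes "\<forall>j<n. 0 < L j" "j < n" "i \<in> {1..d}"
  shows "real_of_int \<bar>crd (x j) i\<bar> \<le> box_norm n L x * L j"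
  using box_norm_le_iff[OF assms(1), of x "box_norm n L x"] assms by blast

lemma finite_lat_ball:
  assumes L: "\<forall>j<n. 0 < L j"
  shows "finite {x\<in>lat n. box_norm n L x \<le> b}"
proof -
  define B where "B j = \<lceil>b * L j\<rceil>" for j
  let ?S = "\<Pi>\<^sub>E j\<in>{..<n}. \<Pi>\<^sub>E i\<in>{1..d}. {- B j..B j}"
  let ?f = "\<lambda>a j. if j < n then int_comb d e (a j) else 0"
  have "{x\<in>lat n. box_norm n L x \<le> b} \<subseteq> ?f ` ?S"
  proof
    fix x assume x: "x \<in> {x\<in>lat n. box_norm n L x \<le> b}"
    define a where "a = (\<lambda>j\<in>{..<n}. \<lambda>i\<in>{1..d}. crd (x j) i)"
    have "\<bar>crd (x j) i\<bar> \<le> B j" if "j < n" "i \<in> {1..d}" for j i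
    proof -
      have "real_of_int \<bar>crd (x j) i\<bar> \<le> b * L j" using x that unfolding box_norm_le_iff[OF L] by blast
      also have "\<dots> \<le> of_int (B j)" unfolding B_def by (rule le_of_int_ceiling)
      finally show ?thesis by (simp only: of_int_le_iff)
    qed
    then have "a \<in> ?S" by (auto simp: a_def abs_le_iff minus_le_iff)
    moreover have "x j = ?f a j" for j
    proof (cases "j < n")
      case True
      then have "int_comb d e (a j) = int_comb d e (crd (x j))" unfolding int_comb_def a_def by simp
      then show ?thesis using True x latD[of x n j] by (simp add: int_comb_crd)
    next
      case False
      then show ?thesis using x by (simp add: lat_def)
    qed
    ultimately show "x \<in> ?f ` ?S" by blast
  qed
  moreover have "finite ?S" by (intro finite_PiE) auto
  ultimately show ?thesis by (meson finite_imageI finite_subset)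
qed

lemma seminormed_lat:
  assumes L: "\<forall>j<n. 0 < L j"
  shows "seminormed_lattice d e psc (lat n) (box_norm n L) struct_const s (lat_basis n)"
proof -
  interpret vector_space psc by (rule vector_space_psc)
  interpret Q: vector_space "\<lambda>q. psc (of_rat q)"
    by standard (simp_all add: of_rat_add of_rat_mult scale_left_distrib scale_right_distrib)
  show ?thesis
  proof
    show "0 \<in> lat n" by (simp add: lat_def R_0)
    show "x + y \<in> lat n" if "x \<in> lat n" "y \<in> lat n" for x y using that by (simp add: lat_def R_add)
    show "psc \<alpha> x \<in> lat n" if "\<alpha> \<in> R" "x \<in> lat n" for \<alpha> x using that by (simp add: lat_def R_mult)
    show "box_norm n L (x + y) \<le> box_norm n L x + box_norm n L y" if xy: "x \<in> lat n" "y \<in> lat n" for x y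
      unfolding box_norm_le_iff[OF L]
    proof (intro conjI allI impI ballI)
      fix j i assume ji: "j < n" "i \<in> {1..d}"
      show "real_of_int \<bar>crd ((x + y) j) i\<bar> \<le> (box_norm n L x + box_norm n L y) * L j"
        using box_norm_ge[OF L ji, of x] box_norm_ge[OF L ji, of y] crd_add[OF latD[OF xy(1)] latD[OF xy(2)] ji(2), of j j]
        by (simp add: distrib_right)
    qed (simp add: box_norm_nonneg)
    show "box_norm n L (psc (of_int k) x) = real_of_int \<bar>k\<bar> * box_norm n L x" if x: "x \<in> lat n" for k x
    proof -
      let ?I = "{..<n} \<times> {1..d}"
      have "insert 0 ((\<lambda>(j, i). real_of_int \<bar>crd (psc (of_int k) x j) i\<bar> / L j) ` ?I)
          = (\<lambda>t. real_of_int \<bar>k\<bar> * t) ` insert 0 ((\<lambda>(j, i). real_of_int \<bar>crd (x j) i\<bar> / L j) ` ?I)"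
      proof -
        have "(\<lambda>(j, i). real_of_int \<bar>crd (psc (of_int k) x j) i\<bar> / L j) ` ?I
            = (\<lambda>(j, i). real_of_int \<bar>k\<bar> * (real_of_int \<bar>crd (x j) i\<bar> / L j)) ` ?I"
          using latD[OF x] by (intro image_cong refl) (auto simp: crd_int_mult abs_mult)
        then show ?thesis by (simp add: image_image case_prod_unfold)
      qed
      moreover have "mono (\<lambda>t. real_of_int \<bar>k\<bar> * t)" by (simp add: mono_def mult_left_mono)
      ultimately show ?thesis unfolding box_norm_def
        by (simp only: mono_Max_commute[of "\<lambda>t. real_of_int \<bar>k\<bar> * t"] finite_insert finite_imageI
            insert_not_empty simp_thms finite_cartesian_product finite_lessThan finite_atLeastAtMost)
    qed
    show "box_norm n L (psc (e i) x) \<le> struct_const * box_norm n L x" if x: "x \<in> lat n" and i: "i \<in> {1..d}" for x i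
      unfolding box_norm_le_iff[OF L]
    proof (intro conjI allI impI ballI)
      fix j k assume jk: "j < n" "k \<in> {1..d}"
      have "real_of_int \<bar>crd (e i * x j) k\<bar> \<le> struct_const * (box_norm n L x * L j)"
        using box_norm_ge[OF L jk(1)] by (intro crd_basis_mult_le[OF latD[OF x] i jk(2)])
      then show "real_of_int \<bar>crd (psc (e i) x j) k\<bar> \<le> struct_const * box_norm n L x * L j"
        by (simp add: mult.assoc)
    qed (simp add: box_norm_nonneg struct_const_nonneg)
    show "0 \<le> struct_const" by (rule struct_const_nonneg)
    show "\<exists>x\<in>Y. \<forall>y\<in>Y. box_norm n L x \<le> box_norm n L y"
      if Y: "Y \<subseteq> {x\<in>lat n. box_norm n L x \<le> s}" "Y \<noteq> {}" for Y
    proof -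
      have "finite Y" using Y(1) finite_lat_ball[OF L] by (rule finite_subset)
      then show ?thesis using ex_min_if_finite[of "box_norm n L ` Y"] Y(2) by (auto simp: not_less)
    qed
    show "finite (lat_basis n)" by (simp add: lat_basis_def)
    show "\<exists>q::(nat \<Rightarrow> complex) \<Rightarrow> rat. x = (\<Sum>g\<in>lat_basis n. psc (of_rat (q g)) g)" if x: "x \<in> lat n" for x
    proof -
      have "x t = (\<Sum>j<n. \<Sum>i=1..d. psc (of_rat (of_int (crd (x j) i))) (psc (e i) (unit_fun j))) t" for t
      proof -
        have "(\<Sum>j<n. \<Sum>i=1..d. psc (of_rat (of_int (crd (x j) i))) (psc (e i) (unit_fun j))) t
            = (\<Sum>j<n. int_comb d e (crd (x j)) * unit_fun j t)"
          by (simp add: int_comb_def sum_distrib_right mult.assoc)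
        also have "\<dots> = (\<Sum>j<n. x j * unit_fun j t)" using latD[OF x] by (simp add: int_comb_crd)
        also have "\<dots> = x t"
          using x by (cases "t < n") (auto simp: unit_fun_def lat_def if_distrib cong: if_cong)
        finally show ?thesis by simp
      qed
      then have "x = (\<Sum>j<n. \<Sum>i=1..d. psc (of_rat (of_int (crd (x j) i))) (psc (e i) (unit_fun j)))" by (rule ext)
      also have "\<dots> \<in> Q.span (lat_basis n)"
        by (intro Q.span_sum Q.span_scale Q.span_base) (auto simp: lat_basis_def)
      finally show ?thesis using Q.span_finite[of "lat_basis n"] by (auto simp: lat_basis_def)
    qed
  qed
qed

section \<open>Images of boxes under linear maps\<close>

definition lin :: "nat \<Rightarrow> (nat \<Rightarrow> complex) \<Rightarrow> (nat \<Rightarrow> complex) \<Rightarrow> complex" where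
  "lin n v x = (\<Sum>j<n. x j * v j)"

lemma lin_add: "lin n v (x + y) = lin n v x + lin n v y"
  and lin_diff: "lin n v (x - y) = lin n v x - lin n v y"
  and lin_psc: "lin n v (psc \<alpha> x) = \<alpha> * lin n v x"
  by (simp_all add: lin_def sum.distrib sum_subtractf sum_distrib_left algebra_simps)

lemma lin_sum: "lin n v (\<Sum>k\<in>S. f k) = (\<Sum>k\<in>S. lin n v (f k))"
proof (induction S rule: infinite_finite_induct)
  case (insert k S)
  then show ?case by (simp only: sum.insert lin_add simp_thms)
qed (simp_all add: lin_def)

definition ball_image :: "nat \<Rightarrow> (nat \<Rightarrow> nat) \<Rightarrow> (nat \<Rightarrow> complex) \<Rightarrow> real \<Rightarrow> complex set" where
  "ball_image n L v b = lin n v ` {x\<in>lat n. box_norm n L x \<le> b}"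

lemma finite_ball_image: "\<forall>j<n. 0 < L j \<Longrightarrow> finite (ball_image n L v b)"
  unfolding ball_image_def by (intro finite_imageI finite_lat_ball)

text \<open>Division with remainder by \<open>L j\<close> in every coordinate covers the ball of radius \<open>b\<close> by boundedly
  many translates of the unit ball.\<close>

lemma card_ball_image_le:
  assumes L: "\<forall>j<n. 0 < L j"
  shows "card (ball_image n L v b) \<le> nat (2 * (\<lceil>\<bar>b\<bar>\<rceil> + 1) + 1) ^ (d * n) * card (ball_image n L v 1)"
proof -
  define Q where "Q = \<lceil>\<bar>b\<bar>\<rceil> + 1"
  let ?S = "\<Pi>\<^sub>E j\<in>{..<n}. \<Pi>\<^sub>E i\<in>{1..d}. {- Q..Q}"
  define g where "g q = (\<Sum>j<n. int_comb d e (\<lambda>i. int (L j) * q j i) * v j)" for q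
  have "ball_image n L v b \<subseteq> (\<lambda>(q, t). g q + t) ` (?S \<times> ball_image n L v 1)"
  proof
    fix z assume "z \<in> ball_image n L v b"
    then obtain x where x: "x \<in> lat n" "box_norm n L x \<le> b" "z = lin n v x" by (auto simp: ball_image_def)
    define q where "q = (\<lambda>j\<in>{..<n}. \<lambda>i\<in>{1..d}. crd (x j) i div int (L j))"
    define y where "y j = (if j < n then int_comb d e (\<lambda>i. crd (x j) i mod int (L j)) else 0)" for j
    have y: "y \<in> lat n" by (simp add: lat_def y_def)
    have "box_norm n L y \<le> 1"
      unfolding box_norm_le_iff[OF L]
    proof (intro conjI allI impI ballI)
      fix j i assume ji: "j < n" "i \<in> {1..d}"
      have "crd (y j) i = crd (x j) i mod int (L j)" using ji by (simp add: y_def crd_int_comb)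
      moreover have "0 \<le> crd (x j) i mod int (L j)" "crd (x j) i mod int (L j) < int (L j)" using L[rule_format, OF ji(1)] by simp_all
      ultimately show "real_of_int \<bar>crd (y j) i\<bar> \<le> 1 * real (L j)" by linarith
    qed simp
    then have "lin n v y \<in> ball_image n L v 1" using y by (auto simp: ball_image_def)
    moreover have "q \<in> ?S"
    proof -
      have "crd (x j) i div int (L j) \<in> {- Q..Q}" if ji: "j < n" "i \<in> {1..d}" for j i
      proof -
        have "real_of_int \<bar>crd (x j) i\<bar> \<le> b * L j" using x(2) ji unfolding box_norm_le_iff[OF L] by blast
        also have "\<dots> \<le> real_of_int \<lceil>\<bar>b\<bar>\<rceil> * real (L j)" by (intro mult_right_mono) linarith+
        also have "\<dots> = real_of_int (\<lceil>\<bar>b\<bar>\<rceil> * int (L j))" by simp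
        finally have "\<bar>crd (x j) i\<bar> \<le> \<lceil>\<bar>b\<bar>\<rceil> * int (L j)" by (simp only: of_int_le_iff)
        then have "crd (x j) i \<le> \<lceil>\<bar>b\<bar>\<rceil> * int (L j)" "- \<lceil>\<bar>b\<bar>\<rceil> * int (L j) \<le> crd (x j) i" by (simp_all add: abs_le_iff)
        moreover have "(t * int (L j)) div int (L j) = t" for t using L ji(1) by simp
        ultimately have "crd (x j) i div int (L j) \<le> \<lceil>\<bar>b\<bar>\<rceil>" "- \<lceil>\<bar>b\<bar>\<rceil> \<le> crd (x j) i div int (L j)"
          using L ji(1) zdiv_mono1[of "crd (x j) i" "\<lceil>\<bar>b\<bar>\<rceil> * int (L j)" "int (L j)"]
            zdiv_mono1[of "- \<lceil>\<bar>b\<bar>\<rceil> * int (L j)" "crd (x j) i" "int (L j)"] by (metis of_nat_0_less_iff)+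
        then show ?thesis by (simp add: Q_def)
      qed
      then show ?thesis by (auto simp: q_def)
    qed
    moreover have "z = g q + lin n v y"
    proof -
      have "x j = int_comb d e (\<lambda>i. int (L j) * q j i) + y j" if j: "j < n" for j
      proof -
        have "x j = int_comb d e (\<lambda>i. int (L j) * (crd (x j) i div int (L j)) + crd (x j) i mod int (L j))"
          using int_comb_crd[OF latD[OF x(1)], of j] by simp
        also have "\<dots> = int_comb d e (\<lambda>i. int (L j) * (crd (x j) i div int (L j))) + y j"
          using j by (simp only: int_comb_add y_def if_True)
        also have "int_comb d e (\<lambda>i. int (L j) * (crd (x j) i div int (L j))) = int_comb d e (\<lambda>i. int (L j) * q j i)"
          using j unfolding int_comb_def by (simp add: q_def)
        finally show ?thesis .
      qed
      then have "z = (\<Sum>j<n. (int_comb d e (\<lambda>i. int (L j) * q j i) + y j) * v j)"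
        unfolding x(3) lin_def by (intro sum.cong refl) auto
      then show ?thesis by (simp add: g_def lin_def distrib_right sum.distrib)
    qed
    ultimately show "z \<in> (\<lambda>(q, t). g q + t) ` (?S \<times> ball_image n L v 1)" by force
  qed
  moreover have "finite (?S \<times> ball_image n L v 1)"
    using finite_ball_image[OF L] by (intro finite_cartesian_product finite_PiE) auto
  ultimately have "card (ball_image n L v b) \<le> card (?S \<times> ball_image n L v 1)" by (rule surj_card_le[rotated])
  also have "\<dots> = nat (2 * Q + 1) ^ (d * n) * card (ball_image n L v 1)"
  proof -
    have "nat (Q + 1 + Q) = nat (2 * Q + 1)" by simp
    then have "card {- Q..Q} = nat (2 * Q + 1)" by (simp add: algebra_simps)
    then show ?thesis by (simp add: card_cartesian_product card_PiE power_mult)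
  qed
  finally show ?thesis by (simp add: Q_def)
qed

end

section \<open>Proper covers\<close>

context int_order
begin

text \<open>GAPs with base point 0 and generators numbered from 0; \<open>osum_is_OK_GAP\<close>
  translates this and the next notion into those of the theorem.\<close>

definition osum :: "nat \<Rightarrow> (nat \<Rightarrow> complex) \<Rightarrow> (nat \<Rightarrow> nat) \<Rightarrow> complex set" where
  "osum r w L = {\<Sum>j<r. \<alpha> j * w j | \<alpha>. \<forall>j<r. \<alpha> j \<in> int_box d e (real (L j))}"

definition oproper :: "nat \<Rightarrow> nat \<Rightarrow> (nat \<Rightarrow> complex) \<Rightarrow> (nat \<Rightarrow> nat) \<Rightarrow> bool" where
  "oproper p r w L \<longleftrightarrow> (\<forall>\<alpha> \<beta>. (\<forall>j<r. \<alpha> j \<in> int_box d e (real (p * L j))) \<longrightarrow> (\<forall>j<r. \<beta> j \<in> int_box d e (real (p * L j))) \<longrightarrow>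
     (\<Sum>j<r. \<alpha> j * w j) = (\<Sum>j<r. \<beta> j * w j) \<longrightarrow> (\<forall>j<r. \<alpha> j = \<beta> j))"

lemma int_box_iff: "\<alpha> \<in> int_box d e B \<longleftrightarrow> (\<exists>l. \<alpha> = int_comb d e l \<and> (\<forall>i\<in>{1..d}. real_of_int \<bar>l i\<bar> < B))"
  unfolding int_box_def int_comb_def by blast

lemma box_norm_zero:
  assumes L: "\<forall>j<n. 0 < L j" and x: "x \<in> lat n" and 0: "box_norm n L x = 0"
  shows "x = 0"
proof
  fix j
  show "x j = 0 j"
  proof (cases "j < n")
    case True
    have "crd (x j) i = 0" if "i \<in> {1..d}" for i
      using box_norm_ge[OF L True that, of x] 0 by simp
    then have "int_comb d e (crd (x j)) = 0" by (simp add: int_comb_def)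
    then show ?thesis using int_comb_crd[OF latD[OF x]] by simp
  next
    case False
    then show ?thesis using x by (simp add: lat_def)
  qed
qed

abbreviation Dep_box :: "nat \<Rightarrow> (nat \<Rightarrow> nat) \<Rightarrow> nat \<Rightarrow> (nat \<Rightarrow> nat \<Rightarrow> complex) \<Rightarrow> (nat \<Rightarrow> complex) set" where
  "Dep_box n L \<equiv> seminormed_lattice.Dep d e psc (lat n) (box_norm n L)"

text \<open>Bounds the seminorm of a combination of the reduced generators with coordinates up to
  \<open>L' j\<close>. The first factor bounds the number of generators,
  \<open>d * struct_const\<close> is the distortion by the order, and the last summand 1 pays for
  rounding \<open>L' j\<close> up.\<close>

definition cover_bound :: "nat \<Rightarrow> real" where
  "cover_bound n = card (lat_basis n) * (d * struct_const *
     (coeff_const struct_const d (card (lat_basis n)) * denom_const struct_const d (card (lat_basis n)) + 1))"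

text \<open>Reducing modulo the kernel vectors \<open>z\<close> gives a proper cover as soon as the kernel of the
  parametrisation has no further vectors in a much larger ball.\<close>

lemma proper_cover_step:
  fixes n k p :: nat and S :: real
  defines "M \<equiv> denom_const struct_const d (card (lat_basis n))"
    and "\<rho> \<equiv> k * (d * struct_const * S)"
  assumes L: "\<forall>j<n. 0 < L j"
    and z: "\<And>j. j < k \<Longrightarrow> z j \<in> lat n" "\<And>j. j < k \<Longrightarrow> lin n v (z j) = 0" "\<And>j. j < k \<Longrightarrow> box_norm n L (z j) \<le> S"
    and kernel: "\<And>y. y \<in> lat n \<Longrightarrow> lin n v y = 0 \<Longrightarrow> box_norm n L y \<le> 2 * real p * cover_bound n + 1 + \<rho> \<Longrightarrow> y \<in> Dep_box n L k z"
  shows "\<exists>r w L'. r \<le> card (lat_basis n) \<and> (\<forall>j<r. 0 < L' j) \<and> (\<forall>j<r. \<exists>x\<in>lat n. w j = lin n v x / of_nat M) \<and>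
     ball_image n L v 1 \<subseteq> osum r w L' \<and> osum r w L' \<subseteq> (\<lambda>x. x / of_nat M) ` ball_image n L v (cover_bound n + 1 + \<rho>) \<and>
     oproper p r w L'"
proof -
  define C where "C = coeff_const struct_const d (card (lat_basis n))"
  have C0: "0 \<le> C" unfolding C_def by (rule coeff_const_nonneg[OF struct_const_nonneg])
  have M0: "0 < M" unfolding M_def by (rule denom_const_pos)
  interpret box: seminormed_lattice d e psc "lat n" "box_norm n L" struct_const 0 "lat_basis n"
    by (rule seminormed_lat[OF L])
  note fin = finite_lat_ball[OF L]
  define W where "W = box.Dep k z"
  define q where "q = box.quot_norm k z"
  interpret quot: seminormed_lattice d e psc "lat n" q struct_const 1 "lat_basis n"
    unfolding q_def
    by (rule box.seminormed_quotient[where S = S]) (erule z(1) | erule z(3) | rule fin)+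
  have q_le: "q x \<le> box_norm n L x" if "x \<in> lat n" for x
    unfolding q_def
    by (rule box.quot_norm_le_N[where S = S, OF _ _ _ that]) (erule z(1) | erule z(3) | rule fin)+
  have q_zero: "x \<in> W" if x: "x \<in> lat n" "q x = 0" for x
    unfolding W_def
    by (rule box.quot_norm_zero[where S = S, OF _ _ _ x(1) x(2)[unfolded q_def]])
       (erule z(1) | erule z(3) | rule fin)+
  have q_lift: "\<exists>w\<in>W. box_norm n L (x + w) \<le> b + 1 + \<rho>" if x: "x \<in> lat n" "q x \<le> b" for x b
  proof -
    obtain w where "w \<in> W" "box_norm n L (x + w) \<le> b + 1 + \<rho>"
      unfolding W_def \<rho>_def
      by (rule box.quot_norm_lift[where S = S, OF _ _ _ x(1) x(2)[unfolded q_def]])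
         (erule z(1) | erule z(3) | rule fin | (rule that; assumption))+
    then show ?thesis by blast
  qed
  have W_lat: "x \<in> lat n" if "x \<in> W" for x using that unfolding W_def by (rule box.Dep_subset)
  \<comment> \<open>The box seminorm is in fact a norm, so a positive multiple of \<open>x\<close>
    is exactly a combination of the kernel vectors \<open>z\<close>.\<close>
  have lin_W: "lin n v x = 0" if x: "x \<in> W" for x
  proof -
    obtain m \<beta> where m: "m > (0::nat)" and \<beta>: "\<forall>j<k. \<beta> j \<in> R"
      and 0: "box_norm n L (psc (of_nat m) x - box.comb \<beta> z k) = 0"
      using x unfolding W_def box.Dep_def by blast
    have "psc (of_nat m) x - box.comb \<beta> z k \<in> lat n"
      using W_lat[OF x] \<beta> z by (intro box.diff_mem box.sc_mem box.comb_mem R_nat) auto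
    then have "psc (of_nat m) x - box.comb \<beta> z k = 0" by (rule box_norm_zero[OF L _ 0])
    then have "lin n v (psc (of_nat m) x) - lin n v (box.comb \<beta> z k) = 0"
      by (metis lin_diff diff_self right_minus_eq)
    moreover have "lin n v (box.comb \<beta> z k) = 0"
      unfolding box.comb_def lin_sum lin_psc using z(2) by (intro sum.neutral) auto
    ultimately show ?thesis using m by (simp only: lin_psc) simp
  qed
  obtain r u where r: "r \<le> card (lat_basis n)"
    and u: "\<And>j. j < r \<Longrightarrow> u j \<in> lat n" "\<And>j. j < r \<Longrightarrow> 0 < q (u j)" "\<And>j. j < r \<Longrightarrow> q (u j) \<le> 1"
    and coeff: "\<And>x b j i. x \<in> lat n \<Longrightarrow> q (x - (\<Sum>j<r. psc (int_comb d e (b j)) (u j))) = 0 \<Longrightarrow> j < r \<Longrightarrow> i \<in> {1..d} \<Longrightarrow>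
        real_of_int \<bar>b j i\<bar> * q (u j) \<le> C * q x"
    and denom: "\<And>x. x \<in> lat n \<Longrightarrow> q x \<le> 1 \<Longrightarrow>
        \<exists>b. q (psc (of_nat M) x - (\<Sum>j<r. psc (int_comb d e (b j)) (u j))) = 0"
    by (rule quot.reduced_basis[folded C_def M_def]) blast
  \<comment> \<open>The added 1 answers the strict inequality in \<open>int_box\<close>. The
    division by \<open>M\<close> in \<open>w\<close> lets the generators reach the ball itself,
    since only \<open>M\<close> times its vectors are known to be combinations.\<close>
  define L' where "L' j = nat \<lfloor>C * M / q (u j)\<rfloor> + 1" for j
  define w where "w j = lin n v (u j) / of_nat M" for j
  define comb where "comb b = (\<Sum>j<r. psc (int_comb d e (b j)) (u j))" for b
  have comb_lat: "comb b \<in> lat n" for b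
    unfolding comb_def using u(1) by (intro box.sum_mem box.sc_mem) auto
  have lin_comb: "lin n v (comb b) / of_nat M = (\<Sum>j<r. int_comb d e (b j) * w j)" for b
    unfolding comb_def lin_sum lin_psc by (simp add: w_def sum_divide_distrib)
  have L'q: "real (L' j) * q (u j) \<le> C * M + 1" if j: "j < r" for j
  proof -
    have "0 \<le> C * M / q (u j)" using C0 u(2)[OF j] by simp
    then have "real (L' j) \<le> C * M / q (u j) + 1" by (simp add: L'_def)
    then have "real (L' j) * q (u j) \<le> (C * M / q (u j) + 1) * q (u j)"
      using u(2)[OF j] by (intro mult_right_mono) auto
    also have "\<dots> = C * M + q (u j)" using u(2)[OF j] by (simp add: distrib_right)
    finally show ?thesis using u(3)[OF j] by simp
  qed
  have q_comb: "q (comb b) \<le> t * cover_bound n"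
    if t: "0 \<le> t" and b: "\<And>j i. j < r \<Longrightarrow> i \<in> {1..d} \<Longrightarrow> real_of_int \<bar>b j i\<bar> \<le> t * real (L' j)" for b and t :: real
  proof -
    have "q (comb b) \<le> (\<Sum>j<r. q (psc (int_comb d e (b j)) (u j)))"
      unfolding comb_def using u(1) by (intro quot.N_sum quot.sc_mem) auto
    also have "\<dots> \<le> (\<Sum>j<r. t * (d * struct_const * (C * M + 1)))"
    proof (rule sum_mono)
      fix j assume j: "j \<in> {..<r}"
      have "q (psc (int_comb d e (b j)) (u j)) \<le> d * struct_const * (t * L' j) * q (u j)"
        using u(1) b j by (intro quot.N_int_comb) auto
      also have "\<dots> = t * (d * struct_const * (L' j * q (u j)))" by simp
      also have "\<dots> \<le> t * (d * struct_const * (C * M + 1))"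
        using L'q j t struct_const_nonneg by (intro mult_left_mono) auto
      finally show "q (psc (int_comb d e (b j)) (u j)) \<le> t * (d * struct_const * (C * M + 1))" .
    qed
    also have "\<dots> = t * (r * (d * struct_const * (C * M + 1)))" by simp
    also have "\<dots> \<le> t * cover_bound n"
      unfolding cover_bound_def C_def[symmetric] M_def[symmetric]
      using t r struct_const_nonneg C0 by (intro mult_left_mono mult_right_mono) auto
    finally show ?thesis .
  qed
  have "ball_image n L v 1 \<subseteq> osum r w L'"
  proof
    fix y assume "y \<in> ball_image n L v 1"
    then obtain x where x: "x \<in> lat n" "box_norm n L x \<le> 1" "y = lin n v x" by (auto simp: ball_image_def)
    have qx: "q x \<le> 1" using q_le[OF x(1)] x(2) by simp
    obtain b where b: "q (psc (of_nat M) x - comb b) = 0"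
      using denom[OF x(1) qx] unfolding comb_def by blast
    have Mx: "psc (of_nat M) x \<in> lat n" using x(1) by (rule box.sc_mem[OF R_nat])
    have "lin n v (psc (of_nat M) x - comb b) = 0"
      using b by (intro lin_W q_zero box.diff_mem Mx comb_lat)
    then have "of_nat M * y = lin n v (comb b)" unfolding lin_diff lin_psc x(3) by simp
    then have y: "y = (\<Sum>j<r. int_comb d e (b j) * w j)" unfolding lin_comb[symmetric] using M0 by (simp add: field_simps)
    have "int_comb d e (b j) \<in> int_box d e (real (L' j))" if j: "j < r" for j
    proof -
      have "real_of_int \<bar>b j i\<bar> < real (L' j)" if i: "i \<in> {1..d}" for i
      proof -
        have "real_of_int \<bar>b j i\<bar> * q (u j) \<le> C * q (psc (of_nat M) x)"
          using coeff[OF Mx _ j i, of b] b unfolding comb_def by simp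
        also have "\<dots> = C * M * q x" using quot.N_nat[OF x(1), of M] by simp
        also have "\<dots> \<le> C * M * 1" using qx C0 by (intro mult_left_mono) auto
        finally have "real_of_int \<bar>b j i\<bar> \<le> C * M / q (u j)" using u(2)[OF j] by (simp add: pos_le_divide_eq)
        then have "\<bar>b j i\<bar> \<le> \<lfloor>C * M / q (u j)\<rfloor>" by (simp add: le_floor_iff)
        then have "\<bar>b j i\<bar> < int (L' j)" unfolding L'_def by linarith
        then show ?thesis by linarith
      qed
      then show ?thesis unfolding int_box_iff by blast
    qed
    then show "y \<in> osum r w L'" unfolding osum_def y
      by (intro CollectI exI[of _ "\<lambda>j. int_comb d e (b j)"]) simp
  qed
  \<comment> \<open>Adding an element of \<open>W\<close> does not change the image, so the
    combination may be replaced by a lift of controlled box norm; this is what bounds the size of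
    the cover.\<close>
  moreover have "osum r w L' \<subseteq> (\<lambda>x. x / of_nat M) ` ball_image n L v (cover_bound n + 1 + \<rho>)"
  proof
    fix y assume "y \<in> osum r w L'"
    then obtain \<alpha> where \<alpha>: "\<forall>j<r. \<alpha> j \<in> int_box d e (real (L' j))" "y = (\<Sum>j<r. \<alpha> j * w j)"
      unfolding osum_def by blast
    have "\<forall>j. \<exists>l. j < r \<longrightarrow> \<alpha> j = int_comb d e l \<and> (\<forall>i\<in>{1..d}. real_of_int \<bar>l i\<bar> < real (L' j))"
      using \<alpha>(1) unfolding int_box_iff by blast
    then obtain b where b: "\<And>j. j < r \<Longrightarrow> \<alpha> j = int_comb d e (b j)"
      "\<And>j i. j < r \<Longrightarrow> i \<in> {1..d} \<Longrightarrow> real_of_int \<bar>b j i\<bar> < real (L' j)" by metis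
    have "q (comb b) \<le> 1 * cover_bound n" using b(2) by (intro q_comb) (auto simp: less_imp_le)
    then obtain w' where w': "w' \<in> W" "box_norm n L (comb b + w') \<le> cover_bound n + 1 + \<rho>"
      using q_lift[OF comb_lat, of b "cover_bound n"] by auto
    have "y = (\<Sum>j<r. int_comb d e (b j) * w j)" unfolding \<alpha>(2) using b(1) by (intro sum.cong refl) auto
    also have "\<dots> = lin n v (comb b + w') / of_nat M" unfolding lin_comb[symmetric] lin_add lin_W[OF w'(1)] by simp
    finally show "y \<in> (\<lambda>x. x / of_nat M) ` ball_image n L v (cover_bound n + 1 + \<rho>)"
      using w' comb_lat W_lat[OF w'(1)] unfolding ball_image_def by (blast intro: box.add_mem)
  qed
  \<comment> \<open>Two tuples with the same sum differ by \<open>D\<close>, whose combination has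
    seminorm at most \<open>2 * p * cover_bound n\<close>. Its lift lies in the kernel and within
    the radius in \<open>kernel\<close>, hence in \<open>W\<close>. So the combination has quotient
    seminorm 0, and the coefficient bound forces \<open>D\<close> to vanish.\<close>
  moreover have "oproper p r w L'"
    unfolding oproper_def
  proof (intro allI impI)
    fix \<alpha> \<beta> j
    assume "\<forall>j<r. \<alpha> j \<in> int_box d e (real (p * L' j))" "\<forall>j<r. \<beta> j \<in> int_box d e (real (p * L' j))"
      and eq: "(\<Sum>j<r. \<alpha> j * w j) = (\<Sum>j<r. \<beta> j * w j)" and j: "j < r"
    then have "\<forall>j. \<exists>l. j < r \<longrightarrow> \<alpha> j = int_comb d e l \<and> (\<forall>i\<in>{1..d}. real_of_int \<bar>l i\<bar> < real (p * L' j))"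
      and "\<forall>j. \<exists>l. j < r \<longrightarrow> \<beta> j = int_comb d e l \<and> (\<forall>i\<in>{1..d}. real_of_int \<bar>l i\<bar> < real (p * L' j))"
      unfolding int_box_iff by blast+
    then obtain a b where a: "\<And>j. j < r \<Longrightarrow> \<alpha> j = int_comb d e (a j)"
      "\<And>j i. j < r \<Longrightarrow> i \<in> {1..d} \<Longrightarrow> real_of_int \<bar>a j i\<bar> < real (p * L' j)"
      and b: "\<And>j. j < r \<Longrightarrow> \<beta> j = int_comb d e (b j)"
      "\<And>j i. j < r \<Longrightarrow> i \<in> {1..d} \<Longrightarrow> real_of_int \<bar>b j i\<bar> < real (p * L' j)" by metis
    define D where "D = (\<lambda>j i. a j i - b j i)"
    have "q (comb D) \<le> (2 * real p) * cover_bound n"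
    proof (rule q_comb)
      fix j i assume "j < r" "i \<in> {1..d}"
      from a(2)[OF this] b(2)[OF this] show "real_of_int \<bar>D j i\<bar> \<le> 2 * real p * real (L' j)" unfolding D_def by simp
    qed simp
    then obtain w' where w': "w' \<in> W" "box_norm n L (comb D + w') \<le> 2 * real p * cover_bound n + 1 + \<rho>"
      using q_lift[OF comb_lat, of D "2 * real p * cover_bound n"] by auto
    have "(\<Sum>j<r. int_comb d e (D j) * w j) = (\<Sum>j<r. \<alpha> j * w j) - (\<Sum>j<r. \<beta> j * w j)"
      unfolding sum_subtractf[symmetric] D_def int_comb_diff
      by (intro sum.cong refl) (simp add: a(1) b(1) left_diff_distrib)
    then have "lin n v (comb D) / of_nat M = 0" unfolding lin_comb using eq by simp
    then have "lin n v (comb D + w') = 0" unfolding lin_add lin_W[OF w'(1)] using M0 by simp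
    then have "comb D + w' \<in> W"
      unfolding W_def using w' comb_lat W_lat[OF w'(1)] by (intro kernel box.add_mem) auto
    then have "(comb D + w') - w' \<in> W" using w'(1) unfolding W_def
      by (rule box.Dep_diff) (erule z(1))
    then have DW: "comb D \<in> box.Dep k z" by (simp add: W_def)
    have "q (0 + comb D) = q 0"
      unfolding q_def
      by (rule box.quot_norm_shift[where S = S, OF _ _ _ box.zero_mem DW]) (erule z(1) | erule z(3) | rule fin)+
    then have qD: "q (comb D) = 0" by (simp add: quot.N_0)
    have "D j i = 0" if i: "i \<in> {1..d}" for i
    proof -
      have "real_of_int \<bar>D j i\<bar> * q (u j) \<le> C * q (comb D)"
        by (rule coeff[OF comb_lat _ j i]) (simp only: comb_def[symmetric] diff_self quot.N_0)
      then show ?thesis using qD u(2)[OF j] by (simp add: mult_le_0_iff)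
    qed
    then have "int_comb d e (D j) = 0" by (simp add: int_comb_def)
    then show "\<alpha> j = \<beta> j" using a(1)[OF j] b(1)[OF j] by (simp add: D_def int_comb_diff)
  qed
  moreover have "\<forall>j<r. \<exists>x\<in>lat n. w j = lin n v x / of_nat M" using u(1) w_def by blast
  moreover have "\<forall>j<r. 0 < L' j" by (simp add: L'_def)
  ultimately show ?thesis using r by blast
qed

text \<open>The shape of \<open>w j\<close> is recorded in order to show later that the generators
  lie in \<open>K\<close>.\<close>

definition properly_coverable :: "nat \<Rightarrow> nat \<Rightarrow> nat \<Rightarrow> (nat \<Rightarrow> nat) \<Rightarrow> (nat \<Rightarrow> complex) \<Rightarrow> bool" where
  "properly_coverable p F n L v \<longleftrightarrow> (\<exists>r w L'. r \<le> card (lat_basis n) \<and> (\<forall>j<r. 0 < L' j) \<and>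
     (\<forall>j<r. \<exists>x\<in>lat n. \<exists>M::nat. w j = lin n v x / of_nat M) \<and>
     ball_image n L v 1 \<subseteq> osum r w L' \<and> card (osum r w L') \<le> F * card (ball_image n L v 1) \<and> oproper p r w L')"

lemma properly_coverable_mono: "properly_coverable p F n L v \<Longrightarrow> F \<le> F' \<Longrightarrow> properly_coverable p F' n L v"
proof -
  assume "properly_coverable p F n L v" "F \<le> F'"
  then obtain r w L' where *: "r \<le> card (lat_basis n)" "\<forall>j<r. 0 < L' j"
    "\<forall>j<r. \<exists>x\<in>lat n. \<exists>M::nat. w j = lin n v x / of_nat M" "ball_image n L v 1 \<subseteq> osum r w L'"
    "card (osum r w L') \<le> F * card (ball_image n L v 1)" "oproper p r w L'"
    unfolding properly_coverable_def by (elim exE conjE)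
  have "card (osum r w L') \<le> F' * card (ball_image n L v 1)"
    using *(5) mult_le_mono1[OF \<open>F \<le> F'\<close>] by (rule le_trans)
  with * show "properly_coverable p F' n L v" unfolding properly_coverable_def
    by (intro exI[of _ r] exI[of _ w] exI[of _ L'] conjI)
qed

text \<open>Induction on \<open>m\<close>, the room left for further kernel vectors. Either some
  kernel vector independent of \<open>z\<close> lies within the radius of
  \<open>proper_cover_step\<close>, and it is appended, or that lemma applies. \<open>F\<close> can
  be fixed before \<open>L\<close>, \<open>v\<close> and \<open>z\<close> because the radii depend
  only on \<open>k\<close>, \<open>S\<close>, \<open>p\<close>, \<open>n\<close> and the
  order.\<close>

lemma properly_coverable_aux:
  fixes p n :: nat
  assumes "k + m = Suc (card (lat_basis n))"
  shows "\<exists>F. \<forall>L v z. (\<forall>j<n. 0 < L j) \<longrightarrow>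
     (\<forall>j<k. z j \<in> lat n \<and> lin n v (z j) = 0 \<and> box_norm n L (z j) \<le> S \<and> z j \<notin> Dep_box n L j z) \<longrightarrow>
     properly_coverable p F n L v"
  using assms
proof (induction m arbitrary: k S)
  \<comment> \<open>Here \<open>k\<close> exceeds the bound of \<open>independent_length\<close>, so
    no such \<open>z\<close> exists.\<close>
  case 0
  have False if L: "\<forall>j<n. 0 < L j" and z: "\<forall>j<k. z j \<in> lat n \<and> z j \<notin> Dep_box n L j z" for L z
  proof -
    interpret box: seminormed_lattice d e psc "lat n" "box_norm n L" struct_const 0 "lat_basis n"
      by (rule seminormed_lat) (use L in simp)
    have "k \<le> card (lat_basis n)" by (rule box.independent_length[of k z]) (use z in auto)
    with 0 show False by simp
  qed
  then show ?case by blast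
next
  case (Suc m)
  define \<rho> where "\<rho> = k * (d * struct_const * S)"
  \<comment> \<open>The radius required by \<open>proper_cover_step\<close>. It grows with
    \<open>S\<close>, since lifting modulo longer vectors costs more; hence the larger scale in the
    next round.\<close>
  define T where "T = 2 * real p * cover_bound n + 1 + \<rho>"
  have "Suc k + m = Suc (card (lat_basis n))" using Suc.prems by simp
  from Suc.IH[OF this, of "max S T"] obtain F where F: "\<forall>L v z. (\<forall>j<n. 0 < L j) \<longrightarrow>
     (\<forall>j<Suc k. z j \<in> lat n \<and> lin n v (z j) = 0 \<and> box_norm n L (z j) \<le> max S T \<and> z j \<notin> Dep_box n L j z) \<longrightarrow>
     properly_coverable p F n L v" by (rule exE)
  define F' where "F' = nat (2 * (\<lceil>\<bar>cover_bound n + 1 + \<rho>\<bar>\<rceil> + 1) + 1) ^ (d * n)"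
  have "properly_coverable p (max F F') n L v"
    if L: "\<forall>j<n. 0 < L j"
      and z: "\<forall>j<k. z j \<in> lat n \<and> lin n v (z j) = 0 \<and> box_norm n L (z j) \<le> S \<and> z j \<notin> Dep_box n L j z" for L v z
  proof (cases "\<exists>y\<in>lat n. lin n v y = 0 \<and> box_norm n L y \<le> T \<and> y \<notin> Dep_box n L k z")
    case True
    then obtain y where y: "y \<in> lat n" "lin n v y = 0" "box_norm n L y \<le> T" "y \<notin> Dep_box n L k z" by blast
    interpret box: seminormed_lattice d e psc "lat n" "box_norm n L" struct_const 0 "lat_basis n"
      by (rule seminormed_lat) (use L in simp)
    have D: "box.Dep j (z(k := y)) = box.Dep j z" if "j \<le> k" for j
    proof -
      have "box.comb \<beta> (z(k := y)) j = box.comb \<beta> z j" for \<beta>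
        unfolding box.comb_def using that by (intro sum.cong refl) auto
      then show ?thesis by (simp add: box.Dep_def)
    qed
    have "properly_coverable p F n L v"
    proof (rule F[THEN spec, THEN spec, THEN spec, THEN mp, THEN mp])
      show "\<forall>j<Suc k. (z(k := y)) j \<in> lat n \<and> lin n v ((z(k := y)) j) = 0 \<and>
          box_norm n L ((z(k := y)) j) \<le> max S T \<and> (z(k := y)) j \<notin> box.Dep j (z(k := y))"
      proof (intro allI impI)
        fix j assume "j < Suc k"
        then consider "j = k" | "j < k" by linarith
        then show "(z(k := y)) j \<in> lat n \<and> lin n v ((z(k := y)) j) = 0 \<and>
          box_norm n L ((z(k := y)) j) \<le> max S T \<and> (z(k := y)) j \<notin> box.Dep j (z(k := y))"
          using y z D[of j] by cases (auto simp: le_max_iff_disj)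
      qed
    qed (rule L)
    then show ?thesis by (rule properly_coverable_mono) simp
  next
    case False
    have "\<exists>r w L'. r \<le> card (lat_basis n) \<and> (\<forall>j<r. 0 < L' j) \<and>
     (\<forall>j<r. \<exists>x\<in>lat n. w j = lin n v x / of_nat (denom_const struct_const d (card (lat_basis n)))) \<and>
     ball_image n L v 1 \<subseteq> osum r w L' \<and>
     osum r w L' \<subseteq> (\<lambda>x. x / of_nat (denom_const struct_const d (card (lat_basis n)))) `
       ball_image n L v (cover_bound n + 1 + \<rho>) \<and> oproper p r w L'"
      unfolding \<rho>_def by (rule proper_cover_step[where z = z]) (use L z False in \<open>auto simp: T_def \<rho>_def\<close>)
    then obtain r w L' where *: "r \<le> card (lat_basis n)" "\<forall>j<r. 0 < L' j"
      "\<forall>j<r. \<exists>x\<in>lat n. w j = lin n v x / of_nat (denom_const struct_const d (card (lat_basis n)))"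
      "ball_image n L v 1 \<subseteq> osum r w L'"
      and sub: "osum r w L' \<subseteq> (\<lambda>x. x / of_nat (denom_const struct_const d (card (lat_basis n)))) `
       ball_image n L v (cover_bound n + 1 + \<rho>)" and pr: "oproper p r w L'" by (elim exE conjE)
    have fin: "finite (ball_image n L v (cover_bound n + 1 + \<rho>))" using L by (intro finite_ball_image) auto
    have "card (osum r w L') \<le> card (ball_image n L v (cover_bound n + 1 + \<rho>))"
      by (rule surj_card_le[OF fin sub])
    also have "\<dots> \<le> F' * card (ball_image n L v 1)"
      unfolding F'_def using L by (intro card_ball_image_le) auto
    finally have size: "card (osum r w L') \<le> F' * card (ball_image n L v 1)" .
    have "\<forall>j<r. \<exists>x\<in>lat n. \<exists>M::nat. w j = lin n v x / of_nat M" using *(3) by blast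
    then have "properly_coverable p F' n L v"
      unfolding properly_coverable_def
      by (intro exI[of _ r] exI[of _ w] exI[of _ L'] conjI *(1,2,4) size pr)
    then show ?thesis by (rule properly_coverable_mono) simp
  qed
  then show ?case by blast
qed

theorem proper_cover:
  "\<exists>F. \<forall>L v. (\<forall>j<n. 0 < L j) \<longrightarrow> properly_coverable p F n L v"
  using properly_coverable_aux[of 0 "Suc (card (lat_basis n))" n 0 p] by auto

end

section \<open>Generalized arithmetic progressions over the ring of integers\<close>

text \<open>Boxes need positive lengths: a direction of length 0 becomes one of length 1 with
  generator 0.\<close>

lemma gap_positive:
  assumes "\<And>j. j < r \<Longrightarrow> 0 \<le> M j"
  shows "gap r (\<lambda>j. if M j = 0 then 0 else v j) (\<lambda>j. max 1 (M j)) = gap r v M"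
proof -
  have sum: "(\<Sum>j<r. of_int (l j) * (if M j = 0 then 0 else v j)) = (\<Sum>j<r. of_int (if M j = 0 then 0 else l j) * v j)"
    for l :: "nat \<Rightarrow> int" by (intro sum.cong refl) auto
  have le: "\<forall>j<r. \<bar>if M j = 0 then 0 else l j\<bar> \<le> M j" if "\<forall>j<r. \<bar>l j\<bar> \<le> max 1 (M j)" for l
  proof (intro allI impI)
    fix j assume j: "j < r"
    have "\<bar>l j\<bar> \<le> max 1 (M j)" "0 \<le> M j" using that assms j by auto
    then show "\<bar>if M j = 0 then 0 else l j\<bar> \<le> M j" by (auto simp: max_def split: if_splits)
  qed
  have "gap r (\<lambda>j. if M j = 0 then 0 else v j) (\<lambda>j. max 1 (M j)) \<subseteq> gap r v M"
  proof
    fix x assume "x \<in> gap r (\<lambda>j. if M j = 0 then 0 else v j) (\<lambda>j. max 1 (M j))"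
    then obtain l where l: "\<forall>j<r. \<bar>l j\<bar> \<le> max 1 (M j)"
      "x = (\<Sum>j<r. of_int (l j) * (if M j = 0 then 0 else v j))" unfolding gap_def by blast
    show "x \<in> gap r v M" unfolding gap_def l(2) sum using le[OF l(1)]
      by (intro CollectI exI[of _ "\<lambda>j. if M j = 0 then 0 else l j"] conjI refl)
  qed
  moreover have "gap r v M \<subseteq> gap r (\<lambda>j. if M j = 0 then 0 else v j) (\<lambda>j. max 1 (M j))"
  proof
    fix x assume "x \<in> gap r v M"
    then obtain l where l: "\<forall>j<r. \<bar>l j\<bar> \<le> M j" "x = (\<Sum>j<r. of_int (l j) * v j)" unfolding gap_def by blast
    have "x = (\<Sum>j<r. of_int (l j) * (if M j = 0 then 0 else v j))"
      unfolding l(2) using l(1) by (intro sum.cong refl) auto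
    moreover have "\<forall>j<r. \<bar>l j\<bar> \<le> max 1 (M j)" using l(1) by (simp add: le_max_iff_disj)
    ultimately show "x \<in> gap r (\<lambda>j. if M j = 0 then 0 else v j) (\<lambda>j. max 1 (M j))"
      unfolding gap_def by blast
  qed
  ultimately show ?thesis by blast
qed

text \<open>Serves to place the generators in \<open>K\<close>, which their origin in the cyclic
  model does not show.\<close>

lemma mem_gap: "j < r \<Longrightarrow> (\<And>j. j < r \<Longrightarrow> 1 \<le> M j) \<Longrightarrow> v j \<in> gap r v M"
proof -
  assume j: "j < r" and M: "\<And>j. j < r \<Longrightarrow> 1 \<le> M j"
  define l :: "nat \<Rightarrow> int" where "l i = (if i = j then 1 else 0)" for i
  have "\<forall>i<r. \<bar>l i\<bar> \<le> M i"
  proof (intro allI impI)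
    fix i assume "i < r"
    from M[OF this] show "\<bar>l i\<bar> \<le> M i" by (auto simp: l_def)
  qed
  moreover have "(\<Sum>i<r. of_int (l i) * v i) = v j"
    using j by (simp add: l_def if_distrib[of of_int] if_distrib[of "\<lambda>x. x * _"] cong: if_cong)
  ultimately show "v j \<in> gap r v M" unfolding gap_def by (intro CollectI exI[of _ l]) simp
qed

lemma sum_lessThan_add: "(\<Sum>j<m + n. h j) = (\<Sum>j<m. h j) + (\<Sum>j<n. h (m + j) :: complex)" for m n :: nat
  by (induction n) (simp_all add: add.assoc)

lemma sum_dilates_mem_dil:
  "(\<And>i. i \<in> set is \<Longrightarrow> t i \<in> dil mus A) \<Longrightarrow>
    sum_list (map (\<lambda>i. e i * t i) is) \<in> dil (concat (map (\<lambda>i. map ((*) (e i)) mus) is)) A"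
proof (induction "is")
  case (Cons i "is")
  have "e i * t i \<in> (*) (e i) ` dil mus A" by (rule imageI) (simp add: Cons.prems)
  then have "e i * t i \<in> dil (map ((*) (e i)) mus) A" by (simp only: mult_dil)
  then show ?case using Cons by (auto simp: dil_append intro: set_plus_intro)
qed simp

context int_order
begin

lemma crd_of_int:
  assumes "e 1 = 1" "i \<in> {1..d}" shows "crd (of_int t) i = (if i = 1 then t else 0)"
proof -
  have "1 \<in> {1..d}" using assms(2) by simp
  then have "int_comb d e (\<lambda>i. if i = 1 then t else 0) = of_int t"
    using assms(1) by (simp add: int_comb_def if_distrib[of of_int] if_distrib[of "\<lambda>x. x * _"] cong: if_cong)
  then show ?thesis using crd_int_comb[OF assms(2), of "\<lambda>i. if i = 1 then t else 0"] by simp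
qed

definition join :: "nat \<Rightarrow> (nat \<Rightarrow> 'b) \<Rightarrow> (nat \<Rightarrow> 'b) \<Rightarrow> nat \<Rightarrow> 'b" where
  "join z f g j = (if j < z then f j else g (j - z))"

lemma lin_join: "lin (z + r) (join z f v) x = (\<Sum>j<z. x j * f j) + (\<Sum>j<r. x (z + j) * v j)"
  unfolding lin_def sum_lessThan_add by (simp add: join_def)

context
  fixes z r :: nat and f v :: "nat \<Rightarrow> complex" and M :: "nat \<Rightarrow> int"
  assumes M: "\<And>j. j < r \<Longrightarrow> 1 \<le> M j" and e1: "e 1 = 1"
begin

text \<open>Length 1 allows picking one element of the covering set with coordinate 1; twice
  \<open>M j\<close> leaves room for a difference of two elements of the progression.\<close>

definition lengths :: "nat \<Rightarrow> nat" where
  "lengths = join z (\<lambda>_. 1) (\<lambda>j. nat (2 * M j))"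

lemma lengths_pos: "\<forall>j<z + r. 0 < lengths j"
proof (intro allI impI)
  fix j assume j: "j < z + r"
  show "0 < lengths j"
  proof (cases "j < z")
    case False
    then have "1 \<le> M (j - z)" using j by (intro M) linarith
    then show ?thesis using False by (simp add: lengths_def join_def)
  qed (simp add: lengths_def join_def)
qed

lemma mem_ball_image_join:
  assumes j0: "j0 < z" and g: "g \<in> gap r v M" "g' \<in> gap r v M"
  shows "f j0 + (g - g') \<in> ball_image (z + r) lengths (join z f v) 1"
proof -
  obtain l where l: "\<forall>j<r. \<bar>l j\<bar> \<le> M j" "g = (\<Sum>j<r. of_int (l j) * v j)" using g(1) unfolding gap_def by blast
  obtain l' where l': "\<forall>j<r. \<bar>l' j\<bar> \<le> M j" "g' = (\<Sum>j<r. of_int (l' j) * v j)" using g(2) unfolding gap_def by blast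
  define t :: "nat \<Rightarrow> int" where "t j = (if j < z + r then join z (\<lambda>j. if j = j0 then 1 else 0) (\<lambda>j. l j - l' j) j else 0)" for j
  define x where "x j = (of_int (t j) :: complex)" for j
  have x: "x \<in> lat (z + r)" by (simp add: lat_def x_def R_int t_def)
  have "box_norm (z + r) lengths x \<le> 1"
    unfolding box_norm_le_iff[OF lengths_pos]
  proof (intro conjI allI impI ballI)
    fix j i assume j: "j < z + r" and i: "i \<in> {1..d}"
    have "\<bar>t j\<bar> \<le> int (lengths j)"
    proof (cases "j < z")
      case False
      then have "j - z < r" using j by simp
      then have "\<bar>l (j - z)\<bar> \<le> M (j - z)" "\<bar>l' (j - z)\<bar> \<le> M (j - z)" using l(1) l'(1) by auto
      then have "\<bar>l (j - z) - l' (j - z)\<bar> \<le> 2 * M (j - z)" by linarith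
      then show ?thesis using False j by (simp add: t_def lengths_def join_def)
    qed (simp add: t_def lengths_def join_def)
    moreover have "\<bar>crd (x j) i\<bar> \<le> \<bar>t j\<bar>" by (simp add: x_def crd_of_int[OF e1 i])
    ultimately have "\<bar>crd (x j) i\<bar> \<le> int (lengths j)" by linarith
    then show "real_of_int \<bar>crd (x j) i\<bar> \<le> 1 * real (lengths j)" by linarith
  qed simp
  moreover have "lin (z + r) (join z f v) x = f j0 + (g - g')"
  proof -
    have "(\<Sum>j<z. x j * f j) = (\<Sum>j<z. if j = j0 then f j else 0)"
      by (intro sum.cong refl) (simp add: x_def t_def join_def)
    also have "\<dots> = f j0" using j0 by simp
    finally have "(\<Sum>j<z. x j * f j) = f j0" .
    moreover have "(\<Sum>j<r. x (z + j) * v j) = g - g'"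
      unfolding l(2) l'(2) sum_subtractf[symmetric]
      by (intro sum.cong refl) (simp add: x_def t_def join_def left_diff_distrib)
    ultimately show ?thesis by (simp add: lin_join)
  qed
  ultimately show ?thesis unfolding ball_image_def using x by (intro image_eqI[of _ _ x]) auto
qed

text \<open>Expand the progression part along the basis: the factor of each \<open>e i\<close> is a
  sum of two elements of the progression, hence lies in 4A - 4A, and \<open>E\<close> lists the
  resulting multipliers. Over the covering set the coordinates are -1, 0 or 1, which gives the power
  of 3.\<close>

lemma card_ball_image_join:
  fixes A :: "complex set"
  defines "E \<equiv> concat (map (\<lambda>i. map ((*) (e i)) [1, 1, -1, -1, 1, 1, -1, -1]) [1..<Suc d])"
  assumes A: "finite A" and gap: "gap r v M \<subseteq> dil [1, 1, -1, -1] A"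
  shows "card (ball_image (z + r) lengths (join z f v) 1) \<le> 3 ^ (d * z) * card (dil E A)"
proof -
  let ?S = "\<Pi>\<^sub>E j\<in>{..<z}. \<Pi>\<^sub>E i\<in>{1..d}. {- 1..1::int}"
  define h where "h q = (\<Sum>j<z. int_comb d e (q j) * f j)" for q
  have "ball_image (z + r) lengths (join z f v) 1 \<subseteq> (\<lambda>(q, t). h q + t) ` (?S \<times> dil E A)"
  proof
    fix y assume "y \<in> ball_image (z + r) lengths (join z f v) 1"
    then obtain x where x: "x \<in> lat (z + r)" "box_norm (z + r) lengths x \<le> 1" "y = lin (z + r) (join z f v) x"
      unfolding ball_image_def by blast
    have le: "\<bar>crd (x j) i\<bar> \<le> int (lengths j)" if "j < z + r" "i \<in> {1..d}" for j i
    proof -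
      have "real_of_int \<bar>crd (x j) i\<bar> \<le> 1 * real (lengths j)"
        using x(2) that unfolding box_norm_le_iff[OF lengths_pos] by blast
      then show ?thesis by linarith
    qed
    define q where "q = (\<lambda>j\<in>{..<z}. \<lambda>i\<in>{1..d}. crd (x j) i)"
    have q: "q \<in> ?S"
    proof -
      have "crd (x j) i \<in> {- 1..1}" if "j < z" "i \<in> {1..d}" for j i
        using le[of j i] that by (simp add: lengths_def join_def abs_le_iff)
      then show ?thesis by (auto simp: q_def)
    qed
    have hq: "(\<Sum>j<z. x j * f j) = h q"
      unfolding h_def
    proof (intro sum.cong refl)
      fix j assume j: "j \<in> {..<z}"
      have "x j = int_comb d e (crd (x j))" using latD[OF x(1)] by (simp add: int_comb_crd)
      also have "\<dots> = int_comb d e (q j)" using j unfolding int_comb_def q_def by simp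
      finally show "x j * f j = int_comb d e (q j) * f j" by simp
    qed
    define t where "t i = (\<Sum>j<r. of_int (crd (x (z + j)) i) * v j)" for i
    have t: "t i \<in> dil [1, 1, -1, -1, 1, 1, -1, -1] A" if i: "i \<in> {1..d}" for i
    proof -
      have b: "\<bar>crd (x (z + j)) i\<bar> \<le> 2 * M j" if "j < r" for j
        using le[of "z + j" i] M[OF that] that i by (simp add: lengths_def join_def)
      \<comment> \<open>A coefficient of absolute value at most \<open>2 * M j\<close> is split into
        its rounded half and the rest, each at most \<open>M j\<close>.\<close>
      have "(\<Sum>j<r. of_int (crd (x (z + j)) i div 2) * v j) \<in> gap r v M"
        unfolding gap_def using b by (intro CollectI exI[of _ "\<lambda>j. crd (x (z + j)) i div 2"] conjI refl allI impI) force
      moreover have "(\<Sum>j<r. of_int (crd (x (z + j)) i - crd (x (z + j)) i div 2) * v j) \<in> gap r v M"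
        unfolding gap_def using b
        by (intro CollectI exI[of _ "\<lambda>j. crd (x (z + j)) i - crd (x (z + j)) i div 2"] conjI refl allI impI) force
      ultimately have "(\<Sum>j<r. of_int (crd (x (z + j)) i div 2) * v j) +
          (\<Sum>j<r. of_int (crd (x (z + j)) i - crd (x (z + j)) i div 2) * v j) \<in> dil [1, 1, -1, -1] A + dil [1, 1, -1, -1] A"
        using gap by (intro set_plus_intro) auto
      also have "dil [1, 1, -1, -1] A + dil [1, 1, -1, -1] A = dil [1, 1, -1, -1, 1, 1, -1, -1] A"
        by (simp only: dil_append[symmetric] append.simps)
      also have "(\<Sum>j<r. of_int (crd (x (z + j)) i div 2) * v j) +
          (\<Sum>j<r. of_int (crd (x (z + j)) i - crd (x (z + j)) i div 2) * v j) = t i"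
        unfolding t_def sum.distrib[symmetric] by (intro sum.cong refl) (simp add: algebra_simps)
      finally show ?thesis .
    qed
    have "(\<Sum>j<r. x (z + j) * v j) = (\<Sum>j<r. \<Sum>i=1..d. e i * (of_int (crd (x (z + j)) i) * v j))"
    proof (intro sum.cong refl)
      fix j
      have "x (z + j) = int_comb d e (crd (x (z + j)))" using latD[OF x(1)] by (simp add: int_comb_crd)
      also have "\<dots> * v j = (\<Sum>i=1..d. e i * (of_int (crd (x (z + j)) i) * v j))"
        by (simp add: int_comb_def sum_distrib_left sum_distrib_right mult_ac)
      finally show "x (z + j) * v j = (\<Sum>i=1..d. e i * (of_int (crd (x (z + j)) i) * v j))" .
    qed
    also have "\<dots> = (\<Sum>i=1..d. e i * t i)" by (subst sum.swap) (simp add: t_def sum_distrib_left)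
    also have "\<dots> = sum_list (map (\<lambda>i. e i * t i) [1..<Suc d])"
      by (simp only: interv_sum_list_conv_sum_set_nat set_upt atLeastLessThanSuc_atLeastAtMost)
    also have "\<dots> \<in> dil E A"
      unfolding E_def by (rule sum_dilates_mem_dil, rule t) auto
    finally have "(\<Sum>j<r. x (z + j) * v j) \<in> dil E A" .
    moreover have "y = h q + (\<Sum>j<r. x (z + j) * v j)" unfolding x(3) lin_join hq ..
    ultimately show "y \<in> (\<lambda>(q, t). h q + t) ` (?S \<times> dil E A)" using q by force
  qed
  moreover have "finite (?S \<times> dil E A)"
    by (intro finite_cartesian_product finite_PiE finite_dil[OF A]) auto
  ultimately have "card (ball_image (z + r) lengths (join z f v) 1) \<le> card (?S \<times> dil E A)"
    by (rule surj_card_le[rotated])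
  also have "\<dots> = 3 ^ (d * z) * card (dil E A)"
    by (simp add: card_cartesian_product card_PiE power_mult)
  finally show ?thesis .
qed

end

lemma card_lat_basis_le: "card (lat_basis n) \<le> n * d"
  unfolding lat_basis_def using card_image_le[of "{..<n} \<times> {1..d}" "\<lambda>(j, i). psc (e i) (unit_fun j)"]
  by (simp add: card_cartesian_product)

lemma osum_is_OK_GAP:
  assumes "\<And>j. j < r \<Longrightarrow> w j \<in> K" "\<forall>j<r. 0 < L j" "0 \<in> K"
  defines "v \<equiv> (\<lambda>j. case j of 0 \<Rightarrow> 0 | Suc i \<Rightarrow> w i)" and "L' \<equiv> (\<lambda>j. case j of 0 \<Rightarrow> 0 | Suc i \<Rightarrow> L i)"
  shows "is_OK_GAP K d e r v L' (osum r w L)" and "oproper p r w L \<Longrightarrow> proper_OK_GAP p d e r v L'"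
proof -
  have sum: "(\<Sum>j=1..r. l j * v j) = (\<Sum>j<r. l (Suc j) * w j)" for l
    by (simp add: sum.atLeast1_atMost_eq v_def)
  have ex: "\<exists>i. j = Suc i \<and> i < r" if "j \<in> {1..r}" for j using that by (cases j) auto
  have v0: "v 0 = 0" by (simp add: v_def)
  have "{v 0 + (\<Sum>j=1..r. l j * v j) | l. \<forall>j\<in>{1..r}. l j \<in> int_box d e (real (L' j))} = osum r w L"
  proof (intro equalityI subsetI)
    fix x assume "x \<in> {v 0 + (\<Sum>j=1..r. l j * v j) | l. \<forall>j\<in>{1..r}. l j \<in> int_box d e (real (L' j))}"
    then obtain l where l: "x = (\<Sum>j<r. l (Suc j) * w j)" "\<forall>j\<in>{1..r}. l j \<in> int_box d e (real (L' j))"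
      unfolding sum v0 by auto
    have "\<forall>j<r. l (Suc j) \<in> int_box d e (real (L j))"
      using l(2) by (force simp: L'_def)
    then show "x \<in> osum r w L" unfolding osum_def l(1) by (intro CollectI exI[of _ "\<lambda>j. l (Suc j)"]) simp
  next
    fix x assume "x \<in> osum r w L"
    then obtain \<alpha> where \<alpha>: "x = (\<Sum>j<r. \<alpha> j * w j)" "\<forall>j<r. \<alpha> j \<in> int_box d e (real (L j))"
      unfolding osum_def by blast
    have "\<forall>j\<in>{1..r}. \<alpha> (j - 1) \<in> int_box d e (real (L' j))"
      using \<alpha>(2) ex by (fastforce simp: L'_def)
    moreover have "x = v 0 + (\<Sum>j=1..r. \<alpha> (j - 1) * v j)" unfolding sum v0 \<alpha>(1) by simp
    ultimately show "x \<in> {v 0 + (\<Sum>j=1..r. l j * v j) | l. \<forall>j\<in>{1..r}. l j \<in> int_box d e (real (L' j))}"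
      by (intro CollectI exI[of _ "\<lambda>j. \<alpha> (j - 1)"]) simp
  qed
  moreover have "\<forall>j\<le>r. v j \<in> K" using assms(1,3) by (auto simp: v_def split: nat.splits)
  moreover have "\<forall>j\<in>{1..r}. 0 < L' j" using assms(2) ex by (fastforce simp: L'_def)
  ultimately show "is_OK_GAP K d e r v L' (osum r w L)" unfolding is_OK_GAP_def by simp
  assume pr: "oproper p r w L"
  show "proper_OK_GAP p d e r v L'"
    unfolding proper_OK_GAP_def
  proof (rule inj_onI)
    fix l l' assume l: "l \<in> (\<Pi>\<^sub>E j\<in>{1..r}. int_box d e (real (p * L' j)))" "l' \<in> (\<Pi>\<^sub>E j\<in>{1..r}. int_box d e (real (p * L' j)))"
      and eq: "of_nat p * v 0 + (\<Sum>j=1..r. l j * v j) = of_nat p * v 0 + (\<Sum>j=1..r. l' j * v j)"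
    have box: "k (Suc j) \<in> int_box d e (real (p * L j))"
      if "k \<in> (\<Pi>\<^sub>E j\<in>{1..r}. int_box d e (real (p * L' j)))" "j < r" for k j
      using PiE_mem[OF that(1), of "Suc j"] that(2) by (simp add: L'_def)
    have "(\<Sum>j<r. l (Suc j) * w j) = (\<Sum>j<r. l' (Suc j) * w j)" using eq unfolding sum by simp
    then have "\<forall>j<r. l (Suc j) = l' (Suc j)"
      using pr[unfolded oproper_def, THEN spec[of _ "\<lambda>j. l (Suc j)"], THEN spec[of _ "\<lambda>j. l' (Suc j)"]] box[OF l(1)] box[OF l(2)]
      by blast
    then show "l = l'" using ex by (intro PiE_ext[OF l]) blast
  qed
qed

end

section \<open>From the hypothesis to dilates by the whole field\<close>

lemma finite_sum_of_dilates: "finite A \<Longrightarrow> finite (sum_of_dilates k lam A)"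
proof -
  assume A: "finite A"
  have "sum_of_dilates k lam A \<subseteq> (\<lambda>a. a 0 + (\<Sum>i=1..k. lam i * a i)) ` (\<Pi>\<^sub>E i\<in>{..k}. A)"
  proof
    fix x assume "x \<in> sum_of_dilates k lam A"
    then obtain a where a: "x = a 0 + (\<Sum>i=1..k. lam i * a i)" "\<forall>i\<le>k. a i \<in> A" unfolding sum_of_dilates_def by blast
    have "x = restrict a {..k} 0 + (\<Sum>i=1..k. lam i * restrict a {..k} i)" unfolding a(1) by simp
    then show "x \<in> (\<lambda>a. a 0 + (\<Sum>i=1..k. lam i * a i)) ` (\<Pi>\<^sub>E i\<in>{..k}. A)"
      using a(2) by (intro image_eqI[of _ _ "restrict a {..k}"]) auto
  qed
  then show ?thesis by (rule finite_subset) (intro finite_imageI finite_PiE, use A in auto)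
qed

text \<open>Freezing all other summands at one element \<open>b\<close> leaves a translate of the
  sum of two dilates.\<close>

lemma card_dilate_le_sum_of_dilates:
  assumes A: "finite A" "A \<noteq> {}" and i: "i \<in> {1..k}"
  shows "card (A + (*) (lam i) ` A) \<le> card (sum_of_dilates k lam A)"
proof -
  obtain b where b: "b \<in> A" using A by blast
  define s where "s = (\<Sum>j\<in>{1..k} - {i}. lam j * b)"
  have "(+) s ` (A + (*) (lam i) ` A) \<subseteq> sum_of_dilates k lam A"
  proof
    fix x assume "x \<in> (+) s ` (A + (*) (lam i) ` A)"
    then obtain y where y: "y \<in> A + (*) (lam i) ` A" "x = s + y" by blast
    then obtain a a' where a: "a \<in> A" "a' \<in> A" "y = a + lam i * a'" by (auto elim!: set_plus_elim)
    define f where "f j = (if j = 0 then a else if j = i then a' else b)" for j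
    have "(\<Sum>j=1..k. lam j * f j) = lam i * f i + (\<Sum>j\<in>{1..k} - {i}. lam j * f j)"
      using i by (intro sum.remove) auto
    also have "(\<Sum>j\<in>{1..k} - {i}. lam j * f j) = s" unfolding s_def by (intro sum.cong refl) (auto simp: f_def)
    also have "lam i * f i = lam i * a'" using i by (simp add: f_def)
    finally have "x = f 0 + (\<Sum>j=1..k. lam j * f j)" using y(2) a(3) by (simp add: f_def)
    moreover have "\<forall>j\<le>k. f j \<in> A" using a b by (simp add: f_def)
    ultimately show "x \<in> sum_of_dilates k lam A" unfolding sum_of_dilates_def by blast
  qed
  then have "card ((+) s ` (A + (*) (lam i) ` A)) \<le> card (sum_of_dilates k lam A)"
    by (rule card_mono[OF finite_sum_of_dilates[OF A(1)]])
  then show ?thesis by (simp add: card_translate)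
qed

lemma (in finite_family) tame_rat_adjoin:
  assumes "\<And>x. x \<in> S \<Longrightarrow> tame \<A> x" "\<exists>x\<in>S. x \<noteq> 0" "\<mu> \<in> rat_adjoin S"
  shows "tame \<A> \<mu>"
proof -
  have t1: "tame \<A> 1" using assms(1,2) tame_1 by blast
  show ?thesis
    using assms(3)
    by (induction rule: rat_adjoin_induct) (auto intro: t1 assms(1) tame_uminus tame_inverse tame_add tame_mult)
qed

lemma dil_subset_rat_adjoin:
  assumes "set mus \<subseteq> rat_adjoin S" "A \<subseteq> rat_adjoin S"
  shows "dil mus A \<subseteq> rat_adjoin S"
  using assms(1)
proof (induction mus)
  case (Cons \<mu> mus)
  show ?case
  proof
    fix x assume "x \<in> dil (\<mu> # mus) A"
    then have "x \<in> (*) \<mu> ` A + dil mus A" by simp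
    then obtain y t where y: "y \<in> (*) \<mu> ` A" "t \<in> dil mus A" "x = y + t" by (rule set_plus_elim)
    then show "x \<in> rat_adjoin S" using Cons assms(2) by (auto intro!: rat_adjoin_add rat_adjoin_mult)
  qed
qed (simp add: rat_adjoin_0)

theorem theorem1p9:
  fixes k d :: nat and lam e :: "nat \<Rightarrow> complex" and K :: "complex set"
  assumes lam_algebraic: "\<forall>i\<in>{1..k}. algebraic (lam i)"
    and lam_nonzero: "\<exists>i\<in>{1..k}. lam i \<noteq> 0"
    and K: "K = rat_adjoin (lam ` {1..k})"
    and d: "d = degree_over_rat K"
    and basis: "int_basis d e (ring_of_integers K)"
    and e1: "e 1 = 1"
  shows "\<forall>(C::real) (p::nat). C > 0 \<longrightarrow>
    (\<exists>(n::nat) (F::real). \<forall>A. finite A \<longrightarrow> A \<noteq> {} \<longrightarrow> A \<subseteq> K \<longrightarrow>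
       real (card (sum_of_dilates k lam A)) \<le> C * real (card A) \<longrightarrow>
       (\<exists>m v L P. is_OK_GAP K d e m v L P \<and> proper_OK_GAP p d e m v L \<and>
          A \<subseteq> P \<and> m \<le> n \<and> real (card P) \<le> F * real (card A)))"
proof (intro allI impI)
  fix C :: real and p :: nat
  assume "C > 0"
  have K_alg: "algebraic x" if "x \<in> lam ` {1..k}" for x using that lam_algebraic by auto
  note order = int_order_ring_of_integers[OF K_alg K basis]
  interpret O: int_order d e by (rule order(1))
  define \<A> where "\<A> = {A. finite A \<and> A \<noteq> {} \<and> A \<subseteq> K \<and> real (card (sum_of_dilates k lam A)) \<le> C * card A}"
  interpret finite_family \<A> by standard (auto simp: \<A>_def)
  have tame_lam: "tame \<A> x" if x: "x \<in> lam ` {1..k}" for x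
  proof -
    obtain i where i: "i \<in> {1..k}" "x = lam i" using x by blast
    have "real (card (A + (*) (lam i) ` A)) \<le> C * card A" if A: "A \<in> \<A>" for A
    proof -
      have "card (A + (*) (lam i) ` A) \<le> card (sum_of_dilates k lam A)"
        using fin[OF A] ne[OF A] i(1) by (rule card_dilate_le_sum_of_dilates)
      then show ?thesis using A by (simp add: \<A>_def)
    qed
    then show ?thesis unfolding i(2) tame_def by blast
  qed
  have "\<exists>x\<in>lam ` {1..k}. x \<noteq> 0" using lam_nonzero by blast
  then have tame_K: "tame \<A> \<mu>" if "\<mu> \<in> K" for \<mu>
    using tame_rat_adjoin[OF tame_lam, of "lam ` {1..k}"] that K by blast
  have K_1: "1 \<in> K" "- 1 \<in> K" "0 \<in> K"
    using K rat_adjoin_1 rat_adjoin_uminus rat_adjoin_0 by auto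
  have bound: "\<exists>c::real. \<forall>A\<in>\<A>. real (card (dil mus A)) \<le> c * card A" if "set mus \<subseteq> K" for mus
    using dil_bound[of mus] tame_K that by blast
  \<comment> \<open>Three sizes have to be controlled: 6A - 6A for the cyclic model, 3A - 2A for the
    covering lemma, and the dilates in \<open>E\<close> for the image of the box.\<close>
  obtain c6 :: real where c6: "\<forall>A\<in>\<A>. real (card (dil (replicate 6 1 @ replicate 6 (-1)) A)) \<le> c6 * card A"
    using bound[of "replicate 6 1 @ replicate 6 (-1)"] K_1 by auto
  obtain c5 :: real where c5: "\<forall>A\<in>\<A>. real (card (dil [1, 1, 1, -1, -1] A)) \<le> c5 * card A"
    using bound[of "[1, 1, 1, -1, -1]"] K_1 by auto
  define E where "E = concat (map (\<lambda>i. map ((*) (e i)) [1, 1, -1, -1, 1, 1, -1, -1]) [1..<Suc d])"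
  have e_K: "e i \<in> K" if "i \<in> {1..d}" for i using O.R_basis[OF that] order(2) by blast
  then have "set E \<subseteq> K"
    using K by (auto simp: E_def less_Suc_eq_le intro!: rat_adjoin_uminus)
  then obtain cE :: real where cE: "\<forall>A\<in>\<A>. real (card (dil E A)) \<le> cE * card A" using bound by blast
  obtain n0 :: nat and c0 :: real where br: "\<forall>A. finite A \<longrightarrow> A \<noteq> {} \<longrightarrow>
    real (card (dil (replicate 6 1 @ replicate 6 (-1)) A)) \<le> c6 * card A \<longrightarrow>
    (\<exists>r v M. r \<le> n0 \<and> (\<forall>j<r. 0 \<le> M j) \<and> gap r v M \<subseteq> dil [1, 1, -1, -1] A \<and>
       real (card A) \<le> c0 * card (gap r v M))"
    using bogolyubov_ruzsa[of c6] by (elim exE)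
  \<comment> \<open>The covering lemma needs at most |c5| |c0| translates, the size of the
    progression cancelling; \<open>n0\<close> bounds the rank of the progression.\<close>
  define n1 where "n1 = nat \<lceil>\<bar>c5\<bar> * \<bar>c0\<bar>\<rceil> + n0"
  obtain F where F: "\<And>n L v. \<forall>j<n. 0 < L j \<Longrightarrow> O.properly_coverable p (F n) n L v"
    using O.proper_cover[of _ p] by metis
  \<comment> \<open>The number of generators varies with \<open>A\<close> but never exceeds
    \<open>n1\<close>, so a maximum over finitely many constants makes the bound uniform.\<close>
  define F1 where "F1 = Max (F ` {..n1})"
  define F2 where "F2 = real F1 * (3 ^ (d * n1) * \<bar>cE\<bar>)"
  have "\<exists>m v L P. is_OK_GAP K d e m v L P \<and> proper_OK_GAP p d e m v L \<and>
          A \<subseteq> P \<and> m \<le> n1 * d \<and> real (card P) \<le> F2 * real (card A)" if A: "A \<in> \<A>" for A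
  proof -
    have AK: "A \<subseteq> K" using A by (simp add: \<A>_def)
    have cA: "card A > 0" using fin[OF A] ne[OF A] by (simp add: card_gt_0_iff)
    have "\<exists>r v M. r \<le> n0 \<and> (\<forall>j<r. 0 \<le> M j) \<and> gap r v M \<subseteq> dil [1, 1, -1, -1] A \<and>
       real (card A) \<le> c0 * card (gap r v M)"
      using br fin[OF A] ne[OF A] c6 A by blast
    then obtain r v0 M0 where r: "r \<le> n0" and M0: "\<forall>j<r. 0 \<le> M0 j"
      and gap0: "gap r v0 M0 \<subseteq> dil [1, 1, -1, -1] A" and size0: "real (card A) \<le> c0 * card (gap r v0 M0)"
      by (elim exE conjE)
    define v where "v j = (if M0 j = 0 then 0 else v0 j)" for j
    define M where "M j = max 1 (M0 j)" for j
    have M: "1 \<le> M j" if "j < r" for j by (simp add: M_def)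
    have "gap r v M = gap r v0 M0" unfolding v_def M_def by (rule gap_positive) (use M0 in simp)
    then have gap: "gap r v M \<subseteq> dil [1, 1, -1, -1] A" and size: "real (card A) \<le> c0 * card (gap r v M)"
      using gap0 size0 by simp_all
    have fing: "finite (gap r v M)" using gap finite_dil[OF fin[OF A]] by (rule finite_subset)
    have cg: "card (gap r v M) > 0" using size cA by (cases "card (gap r v M)") auto
    then have neg: "gap r v M \<noteq> {}" by auto
    obtain Z where Z: "Z \<subseteq> A" "card Z * card (gap r v M) \<le> card (A + gap r v M)"
      "A \<subseteq> Z + (gap r v M + uminus ` gap r v M)"
      using ruzsa_covering[OF fin[OF A] fing neg] by blast
    have "A + gap r v M \<subseteq> A + dil [1, 1, -1, -1] A" using gap by (intro set_plus_mono2) auto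
    then have "card (A + gap r v M) \<le> card (dil [1, 1, 1, -1, -1] A)"
      by (intro card_mono finite_dil[OF fin[OF A]]) simp
    with Z(2) have "real (card Z * card (gap r v M)) \<le> real (card (dil [1, 1, 1, -1, -1] A))" by linarith
    also have "\<dots> \<le> c5 * card A" using c5 A by blast
    also have "\<dots> \<le> \<bar>c5\<bar> * (c0 * card (gap r v M))" using size by (intro mult_mono) auto
    also have "\<dots> \<le> \<bar>c5\<bar> * (\<bar>c0\<bar> * card (gap r v M))" by (intro mult_left_mono mult_right_mono) auto
    finally have "real (card Z) \<le> \<bar>c5\<bar> * \<bar>c0\<bar>" using cg by simp
    then have n: "card Z + r \<le> n1" unfolding n1_def using r by linarith
    have finZ: "finite Z" using Z(1) fin[OF A] by (rule finite_subset)
    obtain f where f: "bij_betw f {..<card Z} Z"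
      using ex_bij_betw_nat_finite[OF finZ] by (auto simp: atLeast0LessThan)
    define V where "V = O.join (card Z) f v"
    define L where "L = O.lengths (card Z) M"
    have L: "\<forall>j<card Z + r. 0 < L j" unfolding L_def by (rule O.lengths_pos[OF _ e1]) (rule M)
    have cover: "A \<subseteq> O.ball_image (card Z + r) L V 1"
    proof
      fix a assume "a \<in> A"
      then have "a \<in> Z + (gap r v M + uminus ` gap r v M)" using Z(3) by blast
      then obtain x t where x: "x \<in> Z" "t \<in> gap r v M + uminus ` gap r v M" "a = x + t" by (rule set_plus_elim)
      then obtain g g' where g: "g \<in> gap r v M" "g' \<in> gap r v M" "t = g - g'" by (auto elim!: set_plus_elim)
      obtain j where "j < card Z" "x = f j" using x(1) f by (auto simp: bij_betw_def)
      then show "a \<in> O.ball_image (card Z + r) L V 1"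
        using O.mem_ball_image_join[OF M e1 _ g(1,2)] unfolding L_def V_def x(3) g(3) by simp
    qed
    have "card (O.ball_image (card Z + r) L V 1) \<le> 3 ^ (d * card Z) * card (dil E A)"
      unfolding L_def V_def E_def by (rule O.card_ball_image_join[OF _ e1 fin[OF A] gap]) (rule M)
    also have "\<dots> \<le> 3 ^ (d * n1) * card (dil E A)"
      using n by (intro mult_right_mono power_increasing) auto
    finally have "real (card (O.ball_image (card Z + r) L V 1)) \<le> real (3 ^ (d * n1) * card (dil E A))"
      by (simp only: of_nat_le_iff)
    also have "\<dots> = 3 ^ (d * n1) * real (card (dil E A))" by simp
    also have "\<dots> \<le> 3 ^ (d * n1) * (\<bar>cE\<bar> * card A)"
    proof (intro mult_left_mono)
      have "real (card (dil E A)) \<le> cE * card A" using cE A by blast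
      also have "\<dots> \<le> \<bar>cE\<bar> * card A" by (intro mult_right_mono) auto
      finally show "real (card (dil E A)) \<le> \<bar>cE\<bar> * card A" .
    qed simp
    finally have ball: "real (card (O.ball_image (card Z + r) L V 1)) \<le> 3 ^ (d * n1) * (\<bar>cE\<bar> * card A)" .
    have "F (card Z + r) \<le> F1" unfolding F1_def using n by (intro Max_ge) auto
    then have "O.properly_coverable p F1 (card Z + r) L V"
      using F[OF L] by (rule O.properly_coverable_mono[rotated])
    then obtain r' w L' where r': "r' \<le> card (O.lat_basis (card Z + r))" and L': "\<forall>j<r'. 0 < L' j"
      and w: "\<forall>j<r'. \<exists>x\<in>O.lat (card Z + r). \<exists>M::nat. w j = O.lin (card Z + r) V x / of_nat M"
      and sub: "O.ball_image (card Z + r) L V 1 \<subseteq> O.osum r' w L'"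
      and card: "card (O.osum r' w L') \<le> F1 * card (O.ball_image (card Z + r) L V 1)"
      and pr: "O.oproper p r' w L'"
      unfolding O.properly_coverable_def by (elim exE conjE)
    have v_K: "v j \<in> K" if "j < r" for j
    proof -
      have "v j \<in> gap r v M" by (rule mem_gap[OF that]) (rule M)
      then have "v j \<in> dil [1, 1, -1, -1] A" using gap by blast
      then show ?thesis using dil_subset_rat_adjoin[of "[1, 1, -1, -1]" "lam ` {1..k}" A] AK K_1 K by auto
    qed
    have V_K: "V j \<in> K" if "j < card Z + r" for j
    proof (cases "j < card Z")
      case True
      then have "f j \<in> Z" using f by (auto simp: bij_betw_def)
      then show ?thesis using True Z(1) AK by (auto simp: V_def O.join_def)
    next
      case False
      then have "v (j - card Z) \<in> K" using that by (intro v_K) linarith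
      then show ?thesis using False by (simp add: V_def O.join_def)
    qed
    have w_K: "w j \<in> K" if j: "j < r'" for j
    proof -
      obtain x m where x: "x \<in> O.lat (card Z + r)" "w j = O.lin (card Z + r) V x / of_nat m" using w j by blast
      have "x i \<in> K" for i using O.latD[OF x(1), of i] order(2) by blast
      then have "O.lin (card Z + r) V x \<in> K"
        unfolding O.lin_def using V_K K by (auto intro!: rat_adjoin_sum rat_adjoin_mult)
      \<comment> \<open>\<open>properly_coverable\<close> allows \<open>m = 0\<close>; then the
        quotient is 0, which also lies in \<open>K\<close>.\<close>
      moreover have "inverse (of_nat m) \<in> K"
        using K rat_adjoin_inverse[OF rat_adjoin_of_nat, of m] K_1 by (cases "m = 0") auto
      ultimately show ?thesis unfolding x(2) divide_inverse using K by (auto intro: rat_adjoin_mult)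
    qed
    define v' where "v' j = (case j of 0 \<Rightarrow> 0 | Suc i \<Rightarrow> w i)" for j
    define L'' where "L'' j = (case j of 0 \<Rightarrow> 0 | Suc i \<Rightarrow> L' i)" for j
    have P1: "is_OK_GAP K d e r' v' L'' (O.osum r' w L')"
      unfolding v'_def L''_def by (rule O.osum_is_OK_GAP(1)[OF _ L' K_1(3)]) (rule w_K)
    have P2: "proper_OK_GAP p d e r' v' L''"
      unfolding v'_def L''_def by (rule O.osum_is_OK_GAP(2)[OF _ L' K_1(3) pr]) (rule w_K)
    have "card (O.lat_basis (card Z + r)) \<le> n1 * d"
      using O.card_lat_basis_le[of "card Z + r"] n by (meson le_trans mult_le_mono1)
    then have "r' \<le> n1 * d" using r' by simp
    moreover have "real (card (O.osum r' w L')) \<le> F2 * card A"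
    proof -
      have "real (card (O.osum r' w L')) \<le> real F1 * real (card (O.ball_image (card Z + r) L V 1))"
        using card by (simp flip: of_nat_mult)
      also have "\<dots> \<le> real F1 * (3 ^ (d * n1) * (\<bar>cE\<bar> * card A))" using ball by (intro mult_left_mono) auto
      finally show ?thesis by (simp add: F2_def mult.assoc)
    qed
    moreover have "A \<subseteq> O.osum r' w L'" using cover sub by (rule subset_trans)
    ultimately show ?thesis using P1 P2
      by (intro exI[of _ r'] exI[of _ v'] exI[of _ L''] exI[of _ "O.osum r' w L'"] conjI)
  qed
  then show "\<exists>(n::nat) (F::real). \<forall>A. finite A \<longrightarrow> A \<noteq> {} \<longrightarrow> A \<subseteq> K \<longrightarrow>
       real (card (sum_of_dilates k lam A)) \<le> C * real (card A) \<longrightarrow>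
       (\<exists>m v L P. is_OK_GAP K d e m v L P \<and> proper_OK_GAP p d e m v L \<and>
          A \<subseteq> P \<and> m \<le> n \<and> real (card P) \<le> F * real (card A))"
    by (intro exI[of _ "n1 * d"] exI[of _ F2]) (simp add: \<A>_def)
qed

end
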